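(* Let $M=(M_t)_{t\in[0,T]}$ be a centered Gaussian martingale with Lipschitz continuous variance function, and let $X=(X_t)_{t\in[0,T]}$ be a Gaussian process that is Hölder continuous of order $\alpha$ for some $\alpha>\frac12$ ($M$ and $X$ are not assumed independent). Put $Y=M+X$, a centered continuous Gaussian process with covariance $R(t,s)=\mathbb{E}[Y_tY_s]$ and variance $V(t)=R(t,t)$, and assume: (a) $R(s,t)>0$ for all $s,t>0$; (b) there exist $c,\delta>0$ such that $V(s)\ge cs^2$ for $s\le\delta$; (c) there exists $\delta>0$ such that $\sup_{0<t<2\delta}\sup_{t/2\le s\le t}\frac{R(s,s)}{R(t,s)}<\infty$; (d) $Y$ is adapted to the filtration $\mathcal{F}^M$ generated by $M$. Let $f:\mathbb{R}\to\mathbb{R}$ be a linear combination of convex functions, with left derivative $f'_-$ and second-derivative (signed) measure $f''$. Then there exists a local time process $L_t^a(Y)$ such that, for $t\in[0,T]$, almost surely $$f(Y_t)=f(Y_0)+\int_0^t f'_-(Y_u)\,dY_u+\frac12\int_{-\infty}^\infty L_t^a(Y)\,f''(da),$$ where the stochastic integral is a Föllmer integral along a suitable sequence of partitions of $[0,T]$ with mesh tending to $0$.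
   Context: Fix $T>0$. Hölder continuity: a process $X$ on $[0,T]$ is Hölder continuous of order $\alpha$ if there is an almost surely finite random variable $C_T$ with $|X_t-X_s|\le C_T|t-s|^\alpha$ almost surely for all $s,t\in[0,T]$. Let $(\pi_n)$ be a sequence of partitions $\pi_n=\{0=t_0^n<\dots<t_{k(n)}^n=T\}$ with $|\pi_n|=\max_j|t_j^n-t_{j-1}^n|\to0$. Föllmer integral: for a continuous process $Z$ and a process $H$, the Föllmer integral of $H$ with respect to $Z$ along $(\pi_n)$ is $$\int_0^t H_u\,dZ_u=\lim_{n\to\infty}\sum_{t_j^n\in\pi_n\cap(0,t]}H_{t_{j-1}^n}\,(Z_{t_j^n}-Z_{t_{j-1}^n}),$$ provided the limit exists almost surely. Quadratic variation: a continuous process $Z$ has quadratic variation $\langle Z\rangle$ along $(\pi_n)$ if $\langle Z\rangle_t=\lim_{n}\sum_{t_j^n\in\pi_n\cap(0,t]}(Z_{t_j^n}-Z_{t_{j-1}^n})^2$ exists almost surely. Local time: for a continuous process $Y$ with quadratic variation $\langle Y\rangle$, its local time $L_t^a(Y)$ is the process defined by the occupation time formula $$\int_{-\infty}^\infty g(a)\,L_t^a(Y)\,da=\int_0^t g(Y_u)\,d\langle Y\rangle_u$$ almost surely for every bounded Borel measurable function $g$. *)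

theory Defs
  imports "HOL-Probability.Probability"
begin

text \<open>Processes on \<open>[0,T]\<close> are maps \<open>X :: real \<Rightarrow> 'a \<Rightarrow> real\<close>, time first, of which only the
  values at times in \<open>{0..T}\<close> are ever used.\<close>

section \<open>Gaussian processes\<close>

text \<open>Degenerate (almost surely constant) variables count as Gaussian.\<close>

definition gaussian_rv :: "'a measure \<Rightarrow> ('a \<Rightarrow> real) \<Rightarrow> bool" where
  "gaussian_rv P Z \<longleftrightarrow> Z \<in> borel_measurable P \<and>
     ((\<exists>m s. 0 < s \<and> distributed P lborel Z (normal_density m s)) \<or>
      (\<exists>m. AE \<omega> in P. Z \<omega> = m))"

definition gaussian_process :: "'a measure \<Rightarrow> real \<Rightarrow> (real \<Rightarrow> 'a \<Rightarrow> real) \<Rightarrow> bool" where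
  "gaussian_process P T X \<longleftrightarrow>
     (\<forall>S c. finite S \<and> S \<subseteq> {0..T} \<longrightarrow> gaussian_rv P (\<lambda>\<omega>. \<Sum>t\<in>S. c t * X t \<omega>))"

definition centered :: "'a measure \<Rightarrow> real \<Rightarrow> (real \<Rightarrow> 'a \<Rightarrow> real) \<Rightarrow> bool" where
  "centered P T X \<longleftrightarrow> (\<forall>t\<in>{0..T}. integrable P (X t) \<and> integral\<^sup>L P (X t) = 0)"

text \<open>The covariance of a centered process.\<close>

definition covar :: "'a measure \<Rightarrow> (real \<Rightarrow> 'a \<Rightarrow> real) \<Rightarrow> real \<Rightarrow> real \<Rightarrow> real" where
  "covar P X t s = integral\<^sup>L P (\<lambda>\<omega>. X t \<omega> * X s \<omega>)"

definition continuous_process :: "'a measure \<Rightarrow> real \<Rightarrow> (real \<Rightarrow> 'a \<Rightarrow> real) \<Rightarrow> bool" where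
  "continuous_process P T X \<longleftrightarrow>
     (\<forall>t\<in>{0..T}. X t \<in> borel_measurable P) \<and>
     (AE \<omega> in P. continuous_on {0..T} (\<lambda>t. X t \<omega>))"

definition holder_process :: "'a measure \<Rightarrow> real \<Rightarrow> real \<Rightarrow> (real \<Rightarrow> 'a \<Rightarrow> real) \<Rightarrow> bool" where
  "holder_process P T \<alpha> X \<longleftrightarrow>
     (\<exists>C \<in> borel_measurable P. AE \<omega> in P. \<forall>s\<in>{0..T}. \<forall>t\<in>{0..T}.
        \<bar>X t \<omega> - X s \<omega>\<bar> \<le> C \<omega> * \<bar>t - s\<bar> powr \<alpha>)"

section \<open>Filtrations and martingales\<close>

definition natural_filtration :: "'a measure \<Rightarrow> (real \<Rightarrow> 'a \<Rightarrow> real) \<Rightarrow> real \<Rightarrow> 'a measure" where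
  "natural_filtration P X t =
     sigma (space P) {X s -` A \<inter> space P | s A. 0 \<le> s \<and> s \<le> t \<and> A \<in> sets borel}"

definition adapted_process :: "real \<Rightarrow> (real \<Rightarrow> 'a measure) \<Rightarrow> (real \<Rightarrow> 'a \<Rightarrow> real) \<Rightarrow> bool" where
  "adapted_process T F X \<longleftrightarrow> (\<forall>t\<in>{0..T}. X t \<in> borel_measurable (F t))"

definition martingale_process ::
    "'a measure \<Rightarrow> real \<Rightarrow> (real \<Rightarrow> 'a measure) \<Rightarrow> (real \<Rightarrow> 'a \<Rightarrow> real) \<Rightarrow> bool" where
  "martingale_process P T F X \<longleftrightarrow>
     adapted_process T F X \<and>
     (\<forall>t\<in>{0..T}. integrable P (X t)) \<and>
     (\<forall>t\<in>{0..T}. \<forall>s\<in>{0..t}. AE \<omega> in P. real_cond_exp P (F s) (X t) \<omega> = X s \<omega>)"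

section \<open>Partitions, Follmer integral, quadratic variation, local time\<close>

text \<open>The \<open>n\<close>-th partition is \<open>\<tau> n 0 < \<dots> < \<tau> n (k n)\<close>.\<close>

definition partition_seq :: "real \<Rightarrow> (nat \<Rightarrow> nat) \<Rightarrow> (nat \<Rightarrow> nat \<Rightarrow> real) \<Rightarrow> bool" where
  "partition_seq T k \<tau> \<longleftrightarrow>
     (\<forall>n. \<tau> n 0 = 0 \<and> \<tau> n (k n) = T \<and> strict_mono_on {0..k n} (\<tau> n)) \<and>
     (\<lambda>n. Max ((\<lambda>j. \<bar>\<tau> n j - \<tau> n (j - 1)\<bar>) ` {1..k n})) \<longlonglongrightarrow> 0"

definition has_follmer_integral ::
    "(nat \<Rightarrow> nat) \<Rightarrow> (nat \<Rightarrow> nat \<Rightarrow> real) \<Rightarrow> (real \<Rightarrow> real) \<Rightarrow> (real \<Rightarrow> real) \<Rightarrow> real \<Rightarrow> real \<Rightarrow> bool"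
where
  "has_follmer_integral k \<tau> h z t I \<longleftrightarrow>
     (\<lambda>n. \<Sum>j\<in>{j\<in>{1..k n}. \<tau> n j \<le> t}. h (\<tau> n (j - 1)) * (z (\<tau> n j) - z (\<tau> n (j - 1))))
       \<longlonglongrightarrow> I"

text \<open>The limits determine \<open>Q t\<close> only up to a null set depending on \<open>t\<close>. Continuity and
  monotonicity of the paths select the version for which integrals \<open>d Q\<close> make sense.\<close>

definition has_quadratic_variation ::
    "'a measure \<Rightarrow> real \<Rightarrow> (nat \<Rightarrow> nat) \<Rightarrow> (nat \<Rightarrow> nat \<Rightarrow> real) \<Rightarrow>
     (real \<Rightarrow> 'a \<Rightarrow> real) \<Rightarrow> (real \<Rightarrow> 'a \<Rightarrow> real) \<Rightarrow> bool" where
  "has_quadratic_variation P T k \<tau> Z Q \<longleftrightarrow>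
     (\<forall>t\<in>{0..T}. Q t \<in> borel_measurable P \<and>
        (AE \<omega> in P. (\<lambda>n. \<Sum>j\<in>{j\<in>{1..k n}. \<tau> n j \<le> t}. (Z (\<tau> n j) \<omega> - Z (\<tau> n (j - 1)) \<omega>)\<^sup>2)
           \<longlonglongrightarrow> Q t \<omega>)) \<and>
     (AE \<omega> in P. continuous_on {0..T} (\<lambda>t. Q t \<omega>) \<and> mono_on {0..T} (\<lambda>t. Q t \<omega>))"

text \<open>Lebesgue-Stieltjes measure of a continuous nondecreasing \<open>q\<close> on \<open>[0,T]\<close>; \<open>q\<close> is extended
  constantly to the left of \<open>0\<close> and to the right of \<open>T\<close>.\<close>

definition stieltjes :: "real \<Rightarrow> (real \<Rightarrow> real) \<Rightarrow> real measure" where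
  "stieltjes T q = interval_measure (\<lambda>u. q (max 0 (min T u)))"

text \<open>\<open>L t a \<omega>\<close> is the local time of \<open>Y\<close> at level \<open>a\<close> up to time \<open>t\<close>, where \<open>Q\<close> is the quadratic
  variation of \<open>Y\<close>.\<close>

definition is_local_time ::
    "'a measure \<Rightarrow> real \<Rightarrow> (real \<Rightarrow> 'a \<Rightarrow> real) \<Rightarrow> (real \<Rightarrow> 'a \<Rightarrow> real) \<Rightarrow>
     (real \<Rightarrow> real \<Rightarrow> 'a \<Rightarrow> real) \<Rightarrow> bool" where
  "is_local_time P T Y Q L \<longleftrightarrow>
     (\<forall>t\<in>{0..T}.
        (\<forall>a. L t a \<in> borel_measurable P) \<and>
        (AE \<omega> in P. integrable lborel (\<lambda>a. L t a \<omega>) \<and>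
           (\<forall>g \<in> borel_measurable borel. bounded (range g) \<longrightarrow>
              (\<integral>a. g a * L t a \<omega> \<partial>lborel) =
              (LINT u:{0..t}|stieltjes T (\<lambda>u. Q u \<omega>). g (Y u \<omega>)))))"

section \<open>Linear combinations of convex functions\<close>

definition lincomb_convex :: "(real \<Rightarrow> real) \<Rightarrow> bool" where
  "lincomb_convex f \<longleftrightarrow>
     (\<exists>(m::nat) c g. (\<forall>i<m. convex_on UNIV (g i)) \<and> f = (\<lambda>x. \<Sum>i<m. c i * g i x))"

definition left_deriv :: "(real \<Rightarrow> real) \<Rightarrow> real \<Rightarrow> real" where
  "left_deriv f x = vector_derivative f (at_left x)"

text \<open>\<open>f''\<close> is in general a difference \<open>\<mu> - \<nu>\<close> of two positive measures that are finite only on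
  bounded sets, characterised by \<open>f'' [a,b) = f'_-(b) - f'_-(a)\<close>.\<close>

definition second_deriv_measure :: "(real \<Rightarrow> real) \<Rightarrow> real measure \<Rightarrow> real measure \<Rightarrow> bool" where
  "second_deriv_measure f \<mu> \<nu> \<longleftrightarrow>
     sets \<mu> = sets borel \<and> sets \<nu> = sets borel \<and>
     (\<forall>a b. emeasure \<mu> {a..<b} < \<infinity> \<and> emeasure \<nu> {a..<b} < \<infinity>) \<and>
     (\<forall>a b. a \<le> b \<longrightarrow> measure \<mu> {a..<b} - measure \<nu> {a..<b} = left_deriv f b - left_deriv f a)"

text \<open>\<open>h\<close> is integrable with respect to \<open>f''\<close> (equivalently, to its total variation) and
  \<open>\<integral> h(a) f''(da) = J\<close>. The value \<open>J\<close> does not depend on the decomposition: if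
  \<open>\<mu> - \<nu> = \<mu>' - \<nu>'\<close> on half-open bounded intervals, then \<open>\<mu> + \<nu>' = \<mu>' + \<nu>\<close>.\<close>

definition has_second_deriv_integral :: "(real \<Rightarrow> real) \<Rightarrow> (real \<Rightarrow> real) \<Rightarrow> real \<Rightarrow> bool" where
  "has_second_deriv_integral f h J \<longleftrightarrow>
     (\<exists>\<mu> \<nu>. second_deriv_measure f \<mu> \<nu> \<and> integrable \<mu> h \<and> integrable \<nu> h \<and>
        J = (\<integral>a. h a \<partial>\<mu>) - (\<integral>a. h a \<partial>\<nu>))"

end

theory Submission
  imports Defs
begin

text \<open>For a convex function \<open>f\<close> the error of the first order expansion at \<open>x\<close> is a superposition of
  the errors of the functions \<open>(\<cdot> - a)\<^sup>+\<close>: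
  \<open>f z - f x - f'_-(x) (z - x) = \<integral> kink a x z f''(da)\<close>. Summing over a partition gives the
  change of \<open>f\<close> along a path as the Riemann sum of \<open>f'_-(Y) dY\<close> plus
  \<open>1/2 \<integral> L\<^sub>n(a) f''(da)\<close>, where the discrete local time \<open>L\<^sub>n(a)\<close> is twice the sum of the kinks of the
  path at level \<open>a\<close>. Hence everything reduces to the convergence of \<open>L\<^sub>n\<close>: the limit \<open>L\<close> has to exist
  almost surely for almost every \<open>a\<close>, with an integrable bound, both for \<open>|f''|\<close> and for Lebesgue
  measure, and it has to be an occupation density. No integral with respect to \<open>M\<close> or \<open>X\<close> is
  constructed; the Follmer integral exists because all other terms of the discrete formula converge.

  The partitions are the dyadic ones. Passing from level \<open>n\<close> to level \<open>n + 1\<close> changes \<open>L\<^sub>n(a)\<close>, up to a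
  boundary term, only on those intervals where the left end point and the midpoint lie on different
  sides of \<open>a\<close> (lemma \<open>disc_lt_diff\<close>); there it changes by the increment of \<open>Y\<close> over the right half.
  The expected number of such flips is estimated in \<open>expected_flips\<close>, uniformly in \<open>a\<close>: a flip
  needs \<open>Y s\<close> to be close to \<open>a\<close> or an unusually large Gaussian increment, the first has probability
  at most \<open>\<epsilon> / sqrt (V s)\<close>, and \<open>V s \<ge> \<kappa> s\<^sup>2\<close> makes these probabilities add up to a harmonic sum. The
  result is at most of order \<open>n (2r)\<^sup>n\<close> for every \<open>r < 1\<close> above
  \<open>2 powr -(1/2)\<close>. The increments of \<open>X\<close> are of order
  \<open>2 powr - (n \<alpha>)\<close> with \<open>\<alpha> > 1/2\<close>, so that their contribution is absolutely summable. The
  contribution of \<open>M\<close> is a martingale transform, since the flips are known at the midpoint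
  by adaptedness; orthogonality of the increments makes its second moment decay
  geometrically (\<open>flip_sum_second_moment\<close>). All bounds are uniform in \<open>a\<close>, so Tonelli's theorem
  yields dominated convergence with respect to any locally finite measure of levels
  (\<open>disc_lt_converges\<close>).

  Finally \<open>\<integral> g(a) L\<^sub>n(a) da\<close> differs little from \<open>\<Sum> g(Y) (\<Delta>Y)\<^sup>2\<close> for Lipschitz \<open>g\<close>, and the squared
  increments converge to the deterministic quadratic variation \<open>E M\<^sub>t\<^sup>2 - E M\<^sub>0\<^sup>2\<close>: compensated squared
  increments of \<open>M\<close> are orthogonal, and \<open>X\<close> has zero quadratic variation. This gives the
  occupation time formula for ramp functions \<open>g\<close>, and ramps determine a measure on the line.\<close>

section \<open>Kinks and the discrete local time of a path\<close>

text \<open>The error of the first order expansion at \<open>x\<close>, with the left derivative, of \<open>(\<cdot> - a)\<^sup>+\<close>. It equals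
  \<open>\<bar>z - a\<bar>\<close> if \<open>x \<le> a < z\<close> or \<open>z < a < x\<close>, and \<open>0\<close> otherwise.\<close>

definition kink :: "real \<Rightarrow> real \<Rightarrow> real \<Rightarrow> real" where
  "kink a x z = max (z - a) 0 - max (x - a) 0 - (if a < x then z - x else 0)"

lemma kink_nonneg: "0 \<le> kink a x z"
  by (auto simp: kink_def max_def)

lemma kink_le: "kink a x z \<le> \<bar>z - x\<bar>"
  by (auto simp: kink_def max_def)

lemma kink_eq_0: "kink a x z = 0" if "a < min x z \<or> max x z < a"
  using that by (auto simp: kink_def max_def min_def split: if_splits)

text \<open>Inserting a point \<open>y\<close> between \<open>x\<close> and \<open>z\<close> only changes the slope that is used on the second leg;
  this is visible only if \<open>x\<close> and \<open>y\<close> lie on different sides of \<open>a\<close>.\<close>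

lemma kink_split:
  "kink a x y + kink a y z - kink a x z = ((if a < x then 1 else 0) - (if a < y then 1 else 0)) * (z - y)"
  by (auto simp: kink_def max_def algebra_simps)

lemma borel_measurable_kink [measurable]:
  assumes [measurable]: "f \<in> borel_measurable N" "g \<in> borel_measurable N" "h \<in> borel_measurable N"
  shows "(\<lambda>u. kink (f u) (g u) (h u)) \<in> borel_measurable N"
  by (simp add: kink_def)

lemma has_bochner_integral_kink: "has_bochner_integral lborel (\<lambda>a. kink a x z) ((z - x)\<^sup>2 / 2)"
proof (cases "x \<le> z")
  case True
  have "has_bochner_integral lborel (\<lambda>a. (z - a) * indicator {x..z} a)
          ((z * z - z\<^sup>2 / 2) - (z * x - x\<^sup>2 / 2))"
    using True
    by (intro has_bochner_integral_FTC_Icc_real[where F = "\<lambda>a. z * a - a\<^sup>2 / 2"])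
       (auto intro!: derivative_eq_intros simp: power2_eq_square)
  moreover have "(\<lambda>a. (z - a) * indicator {x..z} a) = (\<lambda>a. kink a x z)"
    using True by (auto simp: kink_def max_def fun_eq_iff indicator_def)
  ultimately show ?thesis by (simp add: power2_eq_square algebra_simps add_divide_distrib diff_divide_distrib)
next
  case False
  have "has_bochner_integral lborel (\<lambda>a. (a - z) * indicator {z..x} a)
          ((x\<^sup>2 / 2 - z * x) - (z\<^sup>2 / 2 - z * z))"
    using False
    by (intro has_bochner_integral_FTC_Icc_real[where F = "\<lambda>a. a\<^sup>2 / 2 - z * a"])
       (auto intro!: derivative_eq_intros simp: power2_eq_square)
  then have "has_bochner_integral lborel (\<lambda>a. kink a x z) ((x\<^sup>2 / 2 - z * x) - (z\<^sup>2 / 2 - z * z))"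
  proof (subst has_bochner_integral_cong_AE[where g="\<lambda>a. (a - z) * indicator {z..x} a"])
    show "AE a in lborel. kink a x z = (a - z) * indicator {z..x} a"
      proof (rule AE_mp[OF AE_lborel_singleton[of x]], rule AE_I2, rule impI)
      fix a :: real assume "a \<noteq> x"
      with False show "kink a x z = (a - z) * indicator {z..x} a"
        by (auto simp: kink_def max_def indicator_def)
    qed
  qed simp_all
  then show ?thesis by (simp add: power2_eq_square algebra_simps add_divide_distrib diff_divide_distrib)
qed

text \<open>Since \<open>kink a x z\<close> has integral \<open>(z - x)\<^sup>2 / 2\<close> in \<open>a\<close> and lives on the levels between \<open>x\<close> and \<open>z\<close>,
  integrating it against \<open>g\<close> amounts to evaluating \<open>g\<close> at \<open>x\<close>, up to
  an error controlled by the Lipschitz constant.\<close>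

lemma kink_integral_approx:
  fixes g :: "real \<Rightarrow> real"
  assumes [measurable]: "g \<in> borel_measurable borel"
    and bdd: "\<And>a. \<bar>g a\<bar> \<le> b"
    and lip: "\<And>a c. \<bar>g a - g c\<bar> \<le> k * \<bar>a - c\<bar>" and k: "0 \<le> k"
  shows "integrable lborel (\<lambda>a. g a * kink a x z)"
    and "\<bar>2 * (\<integral>a. g a * kink a x z \<partial>lborel) - g x * (z - x)\<^sup>2\<bar> \<le> k * \<bar>z - x\<bar> * (z - x)\<^sup>2"
proof -
  note ik = has_bochner_integral_kink[of x z, THEN integrable.intros]
  note kk = has_bochner_integral_integral_eq[OF has_bochner_integral_kink]
  show i: "integrable lborel (\<lambda>a. g a * kink a x z)"
  proof (rule Bochner_Integration.integrable_bound)
    show "integrable lborel (\<lambda>a. b * kink a x z)" using ik by simp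
    have "0 \<le> b" using bdd[of 0] by simp
    then show "AE a in lborel. norm (g a * kink a x z) \<le> norm (b * kink a x z)"
      using bdd by (auto simp: abs_mult intro!: mult_right_mono)
  qed simp
  have "2 * (\<integral>a. g a * kink a x z \<partial>lborel) - g x * (z - x)\<^sup>2
      = 2 * (\<integral>a. (g a - g x) * kink a x z \<partial>lborel)"
    using i ik kk[of x z] by (simp add: left_diff_distrib)
  moreover have "\<bar>\<integral>a. (g a - g x) * kink a x z \<partial>lborel\<bar> \<le> (\<integral>a. (k * \<bar>z - x\<bar>) * kink a x z \<partial>lborel)"
  proof (rule order_trans[OF integral_abs_bound integral_mono])
    show "integrable lborel (\<lambda>a. \<bar>(g a - g x) * kink a x z\<bar>)"
      using i ik by (simp add: left_diff_distrib)
    show "\<bar>(g a - g x) * kink a x z\<bar> \<le> (k * \<bar>z - x\<bar>) * kink a x z" for a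
    proof (cases "kink a x z = 0")
      case False
      then have "\<bar>a - x\<bar> \<le> \<bar>z - x\<bar>" using kink_eq_0[of a x z] by linarith
      with lip[of a x] k have "\<bar>g a - g x\<bar> \<le> k * \<bar>z - x\<bar>"
        by (meson mult_left_mono order_trans)
      then show ?thesis using kink_nonneg[of a x z] by (auto simp: abs_mult intro!: mult_right_mono)
    qed simp
  qed (use ik in simp)
  ultimately show "\<bar>2 * (\<integral>a. g a * kink a x z \<partial>lborel) - g x * (z - x)\<^sup>2\<bar> \<le> k * \<bar>z - x\<bar> * (z - x)\<^sup>2"
    using kk[of x z] by (simp add: )
qed

section \<open>Dyadic partitions\<close>

definition dyadic :: "real \<Rightarrow> nat \<Rightarrow> nat \<Rightarrow> real" where
  "dyadic T n j = real j * T / 2 ^ n"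

text \<open>The number of complete intervals of level \<open>n\<close> in \<open>[0,t]\<close>.\<close>

definition steps :: "real \<Rightarrow> real \<Rightarrow> nat \<Rightarrow> nat" where
  "steps T t n = nat \<lfloor>t * 2 ^ n / T\<rfloor>"

lemma dyadic_Suc: "dyadic T (Suc n) (2 * j) = dyadic T n j"
  by (simp add: dyadic_def)

lemma dyadic_diff: "dyadic T n (Suc j) - dyadic T n j = T / 2 ^ n"
  by (simp add: dyadic_def field_simps)

lemma dyadic_0 [simp]: "dyadic T n 0 = 0" by (simp add: dyadic_def)

lemma dyadic_nonneg: "0 < T \<Longrightarrow> 0 \<le> dyadic T n j" by (simp add: dyadic_def)

lemma dyadic_mono: "0 < T \<Longrightarrow> i \<le> j \<Longrightarrow> dyadic T n i \<le> dyadic T n j"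
  by (simp add: dyadic_def divide_right_mono mult_right_mono)

lemma dyadic_le_iff:
  assumes "0 < T" "0 \<le> t" shows "dyadic T n j \<le> t \<longleftrightarrow> j \<le> steps T t n"
proof -
  have "dyadic T n j \<le> t \<longleftrightarrow> real j \<le> t * 2 ^ n / T"
    using assms by (simp add: dyadic_def field_simps)
  also have "\<dots> \<longleftrightarrow> j \<le> steps T t n"
    using assms by (simp add: steps_def le_nat_iff le_floor_iff)
  finally show ?thesis .
qed

lemma dyadic_steps_le: "0 < T \<Longrightarrow> 0 \<le> t \<Longrightarrow> dyadic T n (steps T t n) \<le> t"
  by (simp add: dyadic_le_iff)

lemma steps_le: "steps T t n \<le> 2 ^ n" if "0 < T" "0 \<le> t" "t \<le> T"
proof -
  have "dyadic T n (steps T t n) \<le> T" using dyadic_steps_le[OF that(1,2), of n] that(3) by simp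
  then have "real (steps T t n) \<le> real (2 ^ n)" using that by (simp add: dyadic_def field_simps)
  then show ?thesis by (simp only: of_nat_le_iff)
qed

lemma steps_T: "0 < T \<Longrightarrow> steps T T n = 2 ^ n"
  by (simp add: steps_def nat_eq_iff floor_eq_iff)

lemma dyadic_steps_gt: "t < dyadic T n (steps T t n) + T / 2 ^ n" if "0 < T" "0 \<le> t"
  using dyadic_le_iff[OF that, of n "Suc (steps T t n)"] dyadic_diff[of T n "steps T t n"] by simp

lemma steps_Suc: "steps T t (Suc n) = 2 * steps T t n \<or> steps T t (Suc n) = 2 * steps T t n + 1"
  if "0 < T" "0 \<le> t"
proof -
  have "dyadic T n (steps T t n) \<le> t" "\<not> dyadic T n (Suc (steps T t n)) \<le> t"
    using that by (simp_all add: dyadic_le_iff)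
  then have "2 * steps T t n \<le> steps T t (Suc n)" "\<not> 2 * Suc (steps T t n) \<le> steps T t (Suc n)"
    unfolding dyadic_le_iff[OF that, of "Suc n", symmetric] dyadic_Suc by simp_all
  then show ?thesis by auto
qed

lemma dyadic_steps_tendsto:
  assumes "0 < T" "0 \<le> t" shows "(\<lambda>n. dyadic T n (steps T t n)) \<longlonglongrightarrow> t"
proof (rule tendsto_sandwich)
  show "\<forall>\<^sub>F n in sequentially. t - T / 2 ^ n \<le> dyadic T n (steps T t n)"
    using dyadic_steps_gt[OF assms] by (intro always_eventually allI) (metis diff_le_eq less_imp_le)
  show "\<forall>\<^sub>F n in sequentially. dyadic T n (steps T t n) \<le> t"
    using dyadic_steps_le[OF assms] by simp
  have "(\<lambda>n. t - T / 2 ^ n) \<longlonglongrightarrow> t - 0"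
    by (intro tendsto_diff tendsto_const LIMSEQ_divide_realpow_zero) auto
  then show "(\<lambda>n. t - T / 2 ^ n) \<longlonglongrightarrow> t" by simp
qed auto

lemma dyadic_sum:
  assumes "0 < T" "0 \<le> t" "t \<le> T"
  shows "(\<Sum>j\<in>{j\<in>{1..2 ^ n}. dyadic T n j \<le> t}. G (j - 1) j) = (\<Sum>j<steps T t n. G j (Suc j))"
proof -
  have "{j\<in>{1..2 ^ n}. dyadic T n j \<le> t} = Suc ` {..<steps T t n}"
    unfolding image_Suc_lessThan using steps_le[OF assms, of n] dyadic_le_iff[OF assms(1,2), of n] by fastforce
  then show ?thesis by (simp add: sum.reindex)
qed

lemma partition_seq_dyadic:
  assumes "0 < T" shows "partition_seq T (\<lambda>n. 2 ^ n) (dyadic T)"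
  unfolding partition_seq_def
proof (intro conjI allI)
  show "strict_mono_on {0..2 ^ n} (dyadic T n)" for n
    using assms by (auto simp: strict_mono_on_def dyadic_def divide_strict_right_mono)
  have "(\<lambda>j. \<bar>dyadic T n j - dyadic T n (j - 1)\<bar>) ` {1..2 ^ n} = {T / 2 ^ n}" for n
  proof -
    have "\<bar>dyadic T n j - dyadic T n (j - 1)\<bar> = T / 2 ^ n" if "j \<in> {1..2 ^ n}" for j
      using that dyadic_diff[of T n "j - 1"] assms by simp
    moreover have "(1::nat) \<in> {1..2 ^ n}" by simp
    ultimately show ?thesis by (auto simp: image_iff simp del: atLeastAtMost_iff)
  qed
  then show "(\<lambda>n. Max ((\<lambda>j. \<bar>dyadic T n j - dyadic T n (j - 1)\<bar>) ` {1..2 ^ n})) \<longlonglongrightarrow> 0"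
    by (simp add: LIMSEQ_divide_realpow_zero)
qed (simp_all add: dyadic_def)

text \<open>The factor 2 normalises the discrete local time to have integral \<open>\<Sum> (\<Delta>y)\<^sup>2\<close> over all levels.\<close>

definition disc_lt :: "real \<Rightarrow> (real \<Rightarrow> real) \<Rightarrow> real \<Rightarrow> nat \<Rightarrow> real \<Rightarrow> real" where
  "disc_lt T y t n a = 2 * (\<Sum>j<steps T t n. kink a (y (dyadic T n j)) (y (dyadic T n (Suc j))))"

text \<open>Nonzero iff the path is on different sides of the level \<open>a\<close> at the left end point and at the
  midpoint of the \<open>j\<close>-th interval of level \<open>n\<close>.\<close>

definition flip :: "real \<Rightarrow> (real \<Rightarrow> real) \<Rightarrow> nat \<Rightarrow> real \<Rightarrow> nat \<Rightarrow> real" where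
  "flip T y n a j = (if a < y (dyadic T n j) then 1 else 0) -
     (if a < y (dyadic T (Suc n) (Suc (2 * j))) then 1 else 0)"

lemma sum_lessThan_double: "(\<Sum>j<2 * N. f j) = (\<Sum>j<N. f (2 * j) + f (Suc (2 * j)))"
  for f :: "nat \<Rightarrow> 'b::comm_monoid_add"
  by (induction N) (simp_all add: add.assoc)

text \<open>The first term accounts for the interval of level \<open>n + 1\<close> that may be completed before \<open>t\<close>
  although the surrounding interval of level \<open>n\<close> is not.\<close>

lemma disc_lt_diff:
  assumes T: "0 < T" "0 \<le> t"
  shows "\<bar>disc_lt T y t (Suc n) a - disc_lt T y t n a\<bar> \<le>
    2 * \<bar>y (dyadic T (Suc n) (steps T t (Suc n))) - y (dyadic T n (steps T t n))\<bar> +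
    2 * \<bar>\<Sum>j<steps T t n. flip T y n a j *
      (y (dyadic T (Suc n) (Suc (Suc (2 * j)))) - y (dyadic T (Suc n) (Suc (2 * j))))\<bar>"
proof -
  define u where "u j = y (dyadic T (Suc n) j)" for j
  define N where "N = steps T t n"
  have un2: "y (dyadic T (Suc n) (Suc (2 * j))) = u (Suc (2 * j))" for j by (simp add: u_def)
  have un: "y (dyadic T n j) = u (2 * j)" for j by (simp add: u_def dyadic_Suc)
  have "disc_lt T y t n a = 2 * (\<Sum>j<N. kink a (u (2 * j)) (u (2 * Suc j)))"
    unfolding disc_lt_def un N_def ..
  moreover have "(\<Sum>j<2 * N. kink a (u j) (u (Suc j)))
      = (\<Sum>j<N. kink a (u (2 * j)) (u (2 * Suc j))) +
        (\<Sum>j<N. flip T y n a j * (u (Suc (Suc (2 * j))) - u (Suc (2 * j))))"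
    unfolding sum_lessThan_double flip_def sum.distrib[symmetric] un
    un2 kink_split[of a, symmetric] by simp
  moreover have "disc_lt T y t (Suc n) a = 2 * (\<Sum>j<2 * N. kink a (u j) (u (Suc j)))
      + (if steps T t (Suc n) = 2 * N then 0 else 2 * kink a (u (2 * N)) (u (Suc (2 * N))))"
    using steps_Suc[OF T, of n] by (auto simp: disc_lt_def N_def u_def)
  moreover have "(if steps T t (Suc n) = 2 * N then 0 else 2 * kink a (u (2 * N)) (u (Suc (2 * N))))
      \<le> 2 * \<bar>u (steps T t (Suc n)) - u (2 * N)\<bar>"
    using steps_Suc[OF T, of n] kink_le by (auto simp: N_def)
  moreover have "0 \<le> (if steps T t (Suc n) = 2 * N then 0 else 2 * kink a (u (2 * N)) (u (Suc (2 * N))))"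
    by (auto intro: kink_nonneg)
  ultimately show ?thesis unfolding un u_def[symmetric] N_def[symmetric] by linarith
qed

lemma disc_lt_eq_0:
  assumes T: "0 < T" "0 \<le> t" "t \<le> T" and b: "\<And>s. s \<in> {0..T} \<Longrightarrow> \<bar>y s\<bar> \<le> b" and a: "b < \<bar>a\<bar>"
  shows "disc_lt T y t n a = 0"
proof -
  have "kink a (y (dyadic T n j)) (y (dyadic T n (Suc j))) = 0" if "j < steps T t n" for j
  proof -
    have "dyadic T n j \<le> t" "dyadic T n (Suc j) \<le> t" using that T by (simp_all add: dyadic_le_iff)
    then have "\<bar>y (dyadic T n j)\<bar> \<le> b" "\<bar>y (dyadic T n (Suc j))\<bar> \<le> b"
      using b T dyadic_nonneg[OF T(1)] by force+
    then show ?thesis using a by (intro kink_eq_0) linarith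
  qed
  then show ?thesis by (simp add: disc_lt_def)
qed

section \<open>Differences of convex functions\<close>

lemma integrable_bounded_support:
  fixes f :: "real \<Rightarrow> real" and \<mu> :: "real measure"
  assumes \<mu>: "sets \<mu> = sets borel" "\<And>a b. emeasure \<mu> {a..<b} < \<infinity>"
    and f: "f \<in> borel_measurable borel" "\<And>a. \<bar>f a\<bar> \<le> B" "\<And>a. c < \<bar>a\<bar> \<Longrightarrow> f a = 0"
  shows "integrable \<mu> f"
proof (rule Bochner_Integration.integrable_bound)
  show "integrable \<mu> (\<lambda>a. B * indicator {-c..<c + 1} a)"
    using \<mu> by (intro integrable_mult_right integrable_real_indicator) auto
  show "f \<in> borel_measurable \<mu>" using f(1) \<mu>(1) by (simp cong: measurable_cong_sets)
  have "norm (f a) \<le> norm (B * indicator {-c..<c + 1} a)" for a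
    using f(2)[of a] f(3)[of a] by (auto simp: indicator_def split: if_splits)
  then show "AE a in \<mu>. norm (f a) \<le> norm (B * indicator {-c..<c + 1} a)" by simp
qed

text \<open>Difference quotients at \<open>x\<close> increase with the end point, so those from the left have a limit, which
  is squeezed between the quotients on both sides.\<close>

lemma convex_has_left_deriv:
  fixes f :: "real \<Rightarrow> real"
  assumes f: "convex_on UNIV f"
  shows "(f has_real_derivative left_deriv f x) (at_left x)"
    and "t < x \<Longrightarrow> (f t - f x) / (t - x) \<le> left_deriv f x"
    and "x < z \<Longrightarrow> left_deriv f x \<le> (f z - f x) / (z - x)"
proof -
  define s where "s t = (f t - f x) / (t - x)" for t
  have mono: "s a \<le> s b" if "b < x" "a \<le> b" for a b
    using convex_on_slope_le(2)[OF f, of a x b] that by (cases "a = b") (auto simp: s_def)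
  have bnd: "s b \<le> s z" if "b < x" "x < z" for b z
  proof -
    have "(f b - f x) / (b - x) \<le> (f b - f z) / (b - z)" "(f b - f z) / (b - z) \<le> (f x - f z) / (x - z)"
      using convex_on_slope_le[OF f, of b z x] that by auto
    moreover have "(f x - f z) / (x - z) = s z"
      unfolding s_def by (metis minus_diff_eq minus_divide_divide)
    ultimately show ?thesis by (simp add: s_def)
  qed
  have "(s \<longlongrightarrow> Sup (s ` ({..<x} \<inter> UNIV))) (at x within ({..<x} \<inter> UNIV))"
    using mono bnd[of _ "x + 1"] by (intro Lim_left_bound) auto
  then have lim: "(s \<longlongrightarrow> Sup (s ` {..<x})) (at_left x)" by simp
  then have *: "(f has_real_derivative Sup (s ` {..<x})) (at_left x)"
    unfolding has_field_derivative_iff s_def[abs_def] .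
  then have "(f has_vector_derivative Sup (s ` {..<x})) (at_left x)"
    by (simp add: has_real_derivative_iff_has_vector_derivative)
  then have d: "left_deriv f x = Sup (s ` {..<x})"
    unfolding left_deriv_def by (intro vector_derivative_within) auto
  show "(f has_real_derivative left_deriv f x) (at_left x)" using * d by simp
  have bdd: "bdd_above (s ` {..<x})"
    using bnd[of _ "x + 1"] by (auto simp: bdd_above_def intro!: exI[of _ "s (x + 1)"])
  show "(f t - f x) / (t - x) \<le> left_deriv f x" if "t < x"
    unfolding d s_def[symmetric] using bdd that by (intro cSup_upper) auto
  show "left_deriv f x \<le> (f z - f x) / (z - x)" if "x < z"
    unfolding d s_def[symmetric] using bnd that by (intro cSup_least) auto
qed

lemma left_deriv_subgradient:
  fixes f :: "real \<Rightarrow> real"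
  assumes "convex_on UNIV f"
  shows "left_deriv f x * (z - x) \<le> f z - f x"
proof (cases z x rule: linorder_cases)
  case less
  then show ?thesis
    using convex_has_left_deriv(2)[OF assms less] by (simp add: neg_divide_le_eq)
next
  case greater
  then show ?thesis
    using convex_has_left_deriv(3)[OF assms greater] by (simp add: pos_le_divide_eq)
qed simp

lemma left_deriv_mono:
  fixes f :: "real \<Rightarrow> real"
  assumes "convex_on UNIV f" "x \<le> z"
  shows "left_deriv f x \<le> left_deriv f z"
proof (cases "x = z")
  case False
  then have "0 < z - x" using assms(2) by simp
  moreover have "left_deriv f x * (z - x) \<le> left_deriv f z * (z - x)"
    using left_deriv_subgradient[OF assms(1), of x z] left_deriv_subgradient[OF assms(1), of z x]
    by (simp add: algebra_simps)
  ultimately show ?thesis by simp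
qed simp

text \<open>The left derivative at \<open>x\<close> is the supremum of the slopes between \<open>t\<close> and \<open>x\<close> over all \<open>t < x\<close>. Each slope
  is continuous in \<open>x\<close>, so the supremum cannot jump upwards at \<open>x\<close>, and it is nondecreasing.\<close>

lemma left_deriv_left_continuous:
  fixes f :: "real \<Rightarrow> real"
  assumes f: "convex_on UNIV f"
  shows "(left_deriv f \<longlongrightarrow> left_deriv f x) (at_left x)"
proof (rule order_tendstoI)
  fix a assume a: "left_deriv f x < a"
  then have "left_deriv f u < a" if "u < x" for u
    using left_deriv_mono[OF f, of u x] that by simp
  then show "\<forall>\<^sub>F u in at_left x. left_deriv f u < a"
    by (intro eventually_at_leftI[of "x - 1"]) auto
next
  fix a assume a: "a < left_deriv f x"
  have "((\<lambda>t. (f t - f x) / (t - x)) \<longlongrightarrow> left_deriv f x) (at_left x)"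
    using convex_has_left_deriv(1)[OF f] by (simp add: has_field_derivative_iff)
  then have "\<forall>\<^sub>F t in at_left x. t < x \<and> a < (f t - f x) / (t - x)"
    by (intro eventually_conj order_tendstoD(1)[OF _ a]) (auto intro: eventually_at_leftI[of "x - 1"])
  then obtain t where t: "t < x" "a < (f t - f x) / (t - x)"
    using eventually_happens'[OF trivial_limit_at_left_real] by auto
  have "isCont f x"
    using convex_on_continuous[OF open_UNIV f] by (simp add: continuous_on_eq_continuous_at)
  then have "(f \<longlongrightarrow> f x) (at_left x)"
    by (simp add: isCont_def filterlim_at_split)
  then have "((\<lambda>u. (f t - f u) / (t - u)) \<longlongrightarrow> (f t - f x) / (t - x)) (at_left x)"
    using t by (intro tendsto_intros) auto
  from order_tendstoD(1)[OF this t(2)]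
  have "\<forall>\<^sub>F u in at_left x. a < (f t - f u) / (t - u)" .
  moreover have "\<forall>\<^sub>F u in at_left x. t < u" using t by (intro eventually_at_leftI[of t]) auto
  ultimately show "\<forall>\<^sub>F u in at_left x. a < left_deriv f u"
    by eventually_elim (use convex_has_left_deriv(2)[OF f] in fastforce)
qed

text \<open>The left derivative is nondecreasing and left continuous. Reflection turns it into a right
  continuous distribution function, and intervals closed on the right into intervals closed on
  the left.\<close>

lemma convex_second_deriv_measure:
  fixes f :: "real \<Rightarrow> real"
  assumes f: "convex_on UNIV f"
  obtains \<mu> :: "real measure" where "sets \<mu> = sets borel"
    "\<And>a b. a \<le> b \<Longrightarrow> emeasure \<mu> {a..<b} = ennreal (left_deriv f b - left_deriv f a)"
proof
  define F where "F x = - left_deriv f (- x)" for x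
  define \<mu> where "\<mu> = distr (interval_measure F) borel uminus"
  show "sets \<mu> = sets borel" by (simp add: \<mu>_def)
  have mono: "F x \<le> F y" if "x \<le> y" for x y
    using left_deriv_mono[OF f, of "- y" "- x"] that by (simp add: F_def)
  have cont: "continuous (at_right a) F" for a
  proof -
    have "((\<lambda>x. left_deriv f (- x)) \<longlongrightarrow> left_deriv f (- a)) (at_right a)"
      using left_deriv_left_continuous[OF f, of "- a"]
      by (simp add: at_left_minus[of "- a"] filterlim_filtermap)
    then show ?thesis by (simp add: continuous_within F_def[abs_def] tendsto_minus)
  qed
  show "emeasure \<mu> {a..<b} = ennreal (left_deriv f b - left_deriv f a)" if "a \<le> b" for a b
  proof -
    have "emeasure \<mu> {a..<b} = emeasure (interval_measure F) {- b<..- a}"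
      unfolding \<mu>_def by (subst emeasure_distr) (auto intro!: arg_cong2[where f=emeasure])
    also have "\<dots> = F (- a) - F (- b)"
      using that by (intro emeasure_interval_measure_Ioc mono cont) auto
    finally show ?thesis by (simp add: F_def)
  qed
qed

text \<open>Both increments over a short interval \<open>[u,v]\<close> lie between \<open>d u (v - u)\<close> and \<open>d v (v - u)\<close>. On a
  grid of \<open>n\<close> equal steps these gaps telescope to \<open>(d z - d x) (z - x) / n\<close>.\<close>

lemma eq_if_common_subgradient:
  fixes F G d :: "real \<Rightarrow> real"
  assumes F: "\<And>x z. d x * (z - x) \<le> F z - F x" and G: "\<And>x z. d x * (z - x) \<le> G z - G x"
  shows "F z - F x = G z - G x"
proof -
  define D where "D u = F u - G u" for u
  have step: "\<bar>D v - D u\<bar> \<le> (d v - d u) * (v - u)" for u v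
    using F[of u v] F[of v u] G[of u v] G[of v u] by (auto simp: D_def algebra_simps abs_if)
  have "\<bar>D z - D x\<bar> \<le> \<bar>(d z - d x) * (z - x)\<bar> / real n" if n: "0 < n" for n :: nat
  proof -
    \<comment> \<open>the grid of \<open>n\<close> equal steps from \<open>x\<close> to \<open>z\<close>, in either direction\<close>
    define p where "p i = x + real i * ((z - x) / real n)" for i
    have p: "p (Suc i) - p i = (z - x) / real n" for i by (simp add: p_def distrib_right add_divide_distrib)
    have p0: "p 0 = x" "p n = z" using n by (simp_all add: p_def)
    have "D z - D x = (\<Sum>i<n. D (p (Suc i)) - D (p i))"
      by (subst sum_lessThan_telescope) (simp add: p0)
    also have "\<bar>\<dots>\<bar> \<le> (\<Sum>i<n. (d (p (Suc i)) - d (p i)) * ((z - x) / real n))"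
      by (rule order_trans[OF sum_abs sum_mono]) (use step[of "p (Suc i)" "p i" for i] p in metis)
    also have "\<dots> = (d z - d x) * ((z - x) / real n)"
      unfolding sum_distrib_right[symmetric] by (subst sum_lessThan_telescope) (simp add: p0)
    also have "\<dots> \<le> \<bar>(d z - d x) * (z - x)\<bar> / real n"
      using n by (simp add: divide_right_mono)
    finally show ?thesis .
  qed
  then have "\<forall>\<^sub>F n in sequentially. \<bar>D z - D x\<bar> \<le> \<bar>(d z - d x) * (z - x)\<bar> / real n"
    by (intro eventually_sequentiallyI[of 1]) auto
  then have "\<bar>D z - D x\<bar> \<le> 0"
    by (rule tendsto_lowerbound[OF lim_const_over_n]) simp
  then show ?thesis by (simp add: D_def)
qed

text \<open>The function \<open>z \<mapsto> \<integral> kink a x z f''(da) + f'_-(x) (z - x)\<close> has \<open>f'_-\<close> as a subgradient at every point,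
  because kinks are nonnegative. So has \<open>f\<close>, hence the two functions have the same increments.\<close>

lemma convex_kink_formula:
  fixes f :: "real \<Rightarrow> real"
  assumes f: "convex_on UNIV f" and \<mu>: "sets \<mu> = sets borel"
    "\<And>a b. a \<le> b \<Longrightarrow> emeasure \<mu> {a..<b} = ennreal (left_deriv f b - left_deriv f a)"
  shows "integrable \<mu> (\<lambda>a. kink a x z)"
    and "(\<integral>a. kink a x z \<partial>\<mu>) = f z - f x - left_deriv f x * (z - x)"
proof -
  have fin: "emeasure \<mu> {a..<b} < \<infinity>" for a b
    using \<mu>(2)[of a b] by (cases "a \<le> b") auto
  have int: "integrable \<mu> (\<lambda>a. kink a x z)" for x z
  proof (rule integrable_bounded_support[OF \<mu>(1) fin])
    show "\<bar>kink a x z\<bar> \<le> \<bar>z - x\<bar>" for a using kink_le kink_nonneg by simp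
    show "kink a x z = 0" if "\<bar>x\<bar> + \<bar>z\<bar> < \<bar>a\<bar>" for a using that by (intro kink_eq_0) linarith
  qed simp
  show "integrable \<mu> (\<lambda>a. kink a x z)" by fact
  define J where "J u a = (if a < u then 1 else 0) - (if a < x then 1 else (0::real))" for u a
  have J: "integrable \<mu> (J u)" "(\<integral>a. J u a \<partial>\<mu>) = left_deriv f u - left_deriv f x" for u
  proof -
    have e: "J u = (\<lambda>a. indicator {x..<u} a - indicator {u..<x} a)"
      by (auto simp: J_def indicator_def fun_eq_iff)
    have i: "integrable \<mu> (indicat_real {a..<b})" for a b using fin by (simp add: \<mu>(1))
    have m: "measure \<mu> {a..<b} = (if a \<le> b then left_deriv f b - left_deriv f a else 0)" for a b
      using \<mu>(2)[of a b] left_deriv_mono[OF f, of a b] by (simp add: measure_def)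
    show "integrable \<mu> (J u)" "(\<integral>a. J u a \<partial>\<mu>) = left_deriv f u - left_deriv f x"
      using i sets_eq_imp_space_eq[OF \<mu>(1)] by (auto simp: e m)
  qed
  define G where "G u = (\<integral>a. kink a x u \<partial>\<mu>) + left_deriv f x * (u - x)" for u
  have "G z - G x = f z - f x"
  proof (rule eq_if_common_subgradient[of "left_deriv f"])
    show "left_deriv f u * (v - u) \<le> G v - G u" for u v
    proof -
      have "kink a x v - kink a x u - J u a * (v - u) = kink a u v" for a
        by (auto simp: J_def kink_def max_def algebra_simps)
      then have "0 \<le> (\<integral>a. kink a x v - kink a x u - J u a * (v - u) \<partial>\<mu>)"
        by (simp add: kink_nonneg)
      also have "\<dots> = (\<integral>a. kink a x v \<partial>\<mu>) - (\<integral>a. kink a x u \<partial>\<mu>) -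
          (left_deriv f u - left_deriv f x) * (v - u)"
        using int J by simp
      finally show ?thesis by (simp add: G_def algebra_simps)
    qed
  qed (rule left_deriv_subgradient[OF f])
  moreover have "kink a x x = 0" for a by (simp add: kink_def)
  ultimately show "(\<integral>a. kink a x z \<partial>\<mu>) = f z - f x - left_deriv f x * (z - x)"
    by (simp add: G_def)
qed

lemma lincomb_convex_diff:
  assumes "lincomb_convex f"
  obtains A B where "convex_on UNIV A" "convex_on UNIV B" "f = (\<lambda>x. A x - B x)"
proof -
  obtain m :: nat and c g where g: "\<And>i. i < m \<Longrightarrow> convex_on UNIV (g i)" and f: "f = (\<lambda>x. \<Sum>i<m. c i * g i x)"
    using assms by (auto simp: lincomb_convex_def)
  have cvx: "convex_on UNIV (\<lambda>x. \<Sum>i<m. b i * g i x)" if "\<And>i. 0 \<le> b i" for b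
    using g
  proof (induction m)
    case (Suc m)
    then show ?case using that by (auto intro!: convex_on_add convex_on_cmul)
  qed (simp add: convex_on_const)
  show ?thesis
  proof (rule that[OF cvx[of "\<lambda>i. max (c i) 0"] cvx[of "\<lambda>i. max (- c i) 0"]])
    show "f = (\<lambda>x. (\<Sum>i<m. max (c i) 0 * g i x) - (\<Sum>i<m. max (- c i) 0 * g i x))"
      unfolding f sum_subtractf[symmetric] by (intro ext sum.cong refl) (auto simp: max_def)
  qed auto
qed

lemma lincomb_convex_kink_formula:
  assumes "lincomb_convex f"
  obtains \<mu> \<nu> where "second_deriv_measure f \<mu> \<nu>" "continuous_on UNIV f"
    "\<And>x z. integrable \<mu> (\<lambda>a. kink a x z)" "\<And>x z. integrable \<nu> (\<lambda>a. kink a x z)"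
    "\<And>x z. f z - f x - left_deriv f x * (z - x) = (\<integral>a. kink a x z \<partial>\<mu>) - (\<integral>a. kink a x z \<partial>\<nu>)"
proof -
  obtain A B where A: "convex_on UNIV A" and B: "convex_on UNIV B" and f: "f = (\<lambda>x. A x - B x)"
    using lincomb_convex_diff[OF assms] .
  obtain \<mu> :: "real measure" where \<mu>: "sets \<mu> = sets borel"
    "\<And>a b. a \<le> b \<Longrightarrow> emeasure \<mu> {a..<b} = ennreal (left_deriv A b - left_deriv A a)"
    using convex_second_deriv_measure[OF A] by metis
  obtain \<nu> :: "real measure" where \<nu>: "sets \<nu> = sets borel"
    "\<And>a b. a \<le> b \<Longrightarrow> emeasure \<nu> {a..<b} = ennreal (left_deriv B b - left_deriv B a)"
    using convex_second_deriv_measure[OF B] by metis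
  have d: "left_deriv f x = left_deriv A x - left_deriv B x" for x
  proof -
    have "(f has_real_derivative (left_deriv A x - left_deriv B x)) (at_left x)"
      unfolding f by (intro DERIV_diff convex_has_left_deriv A B)
    then show ?thesis
      unfolding left_deriv_def[of f] has_real_derivative_iff_has_vector_derivative
      by (intro vector_derivative_within) auto
  qed
  show ?thesis
  proof (rule that)
    have "measure \<mu> {a..<b} - measure \<nu> {a..<b} = left_deriv f b - left_deriv f a" if "a \<le> b" for a b
      using \<mu>(2)[OF that] \<nu>(2)[OF that] left_deriv_mono[OF A that] left_deriv_mono[OF B that]
      by (simp add: measure_def d)
    moreover have "emeasure \<mu> {a..<b} < \<infinity> \<and> emeasure \<nu> {a..<b} < \<infinity>" for a b
      using \<mu>(2)[of a b] \<nu>(2)[of a b] by (cases "a \<le> b") auto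
    ultimately show "second_deriv_measure f \<mu> \<nu>" using \<mu>(1) \<nu>(1) by (simp add: second_deriv_measure_def)
    show "continuous_on UNIV f" unfolding f
      using A B by (intro continuous_on_diff convex_on_continuous) auto
    show "f z - f x - left_deriv f x * (z - x) = (\<integral>a. kink a x z \<partial>\<mu>) - (\<integral>a. kink a x z \<partial>\<nu>)" for x z
      using convex_kink_formula(2)[OF A \<mu>, of x z] convex_kink_formula(2)[OF B \<nu>, of x z]
      unfolding d by (simp add: f algebra_simps)
    show "integrable \<mu> (\<lambda>a. kink a x z)" "integrable \<nu> (\<lambda>a. kink a x z)" for x z
      by (rule convex_kink_formula(1)[OF A \<mu>] convex_kink_formula(1)[OF B \<nu>]; assumption)+
  qed
qed

section \<open>Centered Gaussian variables\<close>

lemma normal_density_le: "normal_density m s x \<le> 1 / (2 * s)" if "0 < s"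
proof -
  have "2 * s \<le> sqrt (2 * pi * s\<^sup>2)"
    using that pi_gt3 by (intro real_le_rsqrt) (simp add: power_mult_distrib)
  then have "1 / sqrt (2 * pi * s\<^sup>2) * exp (- (x - m)\<^sup>2 / (2 * s\<^sup>2)) \<le> 1 / (2 * s) * 1"
    using that by (intro mult_mono divide_left_mono) auto
  then show ?thesis by (simp add: normal_density_def)
qed

context prob_space
begin

lemma gaussian_rv_cases [consumes 2, case_names const normal]:
  assumes Z: "gaussian_rv M Z" and 0: "expectation Z = 0"
  obtains "AE \<omega> in M. Z \<omega> = 0" "Z \<in> borel_measurable M"
    | s where "0 < s" "distributed M lborel Z (normal_density 0 s)"
proof -
  from Z consider m s where "0 < s" "distributed M lborel Z (normal_density m s)"
    | m where "AE \<omega> in M. Z \<omega> = m" "Z \<in> borel_measurable M"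
    by (auto simp: gaussian_rv_def)
  then show thesis
  proof cases
    case 1
    then show ?thesis using normal_distributed_expectation[OF 1] 0 that(2) by metis
  next
    case 2
    then have "expectation Z = expectation (\<lambda>_. m)" by (intro integral_cong_AE) auto
    then have "m = 0" using 0 by (simp add: prob_space)
    then show ?thesis using 2 that(1) by simp
  qed
qed

lemma gaussian_moments:
  assumes Z: "gaussian_rv M Z" "expectation Z = 0"
  shows "integrable M (\<lambda>\<omega>. Z \<omega> ^ k)" (is ?I)
    and "expectation (\<lambda>\<omega>. Z \<omega> ^ (2 * k)) = fact (2 * k) / (2 ^ k * fact k) * expectation (\<lambda>\<omega>. (Z \<omega>)\<^sup>2) ^ k" (is ?E)
proof -
  have "?I \<and> ?E"
    using Z
  proof (cases rule: gaussian_rv_cases)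
    case const
    have e: "integrable M (\<lambda>\<omega>. Z \<omega> ^ j) \<and> expectation (\<lambda>\<omega>. Z \<omega> ^ j) = 0 ^ j" for j
    proof -
      have ae: "AE \<omega> in M. Z \<omega> ^ j = 0 ^ j" using const(1) by eventually_elim simp
      have "integrable M (\<lambda>\<omega>. Z \<omega> ^ j) \<longleftrightarrow> integrable M (\<lambda>\<omega>. (0 ^ j :: real))"
        using const(2) ae by (intro integrable_cong_AE) auto
      moreover have "expectation (\<lambda>\<omega>. Z \<omega> ^ j) = expectation (\<lambda>\<omega>. 0 ^ j)"
        using const(2) ae by (intro integral_cong_AE) auto
      ultimately show ?thesis by (simp add: prob_space)
    qed
    show ?thesis using e[of k] e[of "2 * k"] e[of 2] by (cases k) auto
  next
    case (normal s)
    have m: "expectation (\<lambda>\<omega>. Z \<omega> ^ (2 * k)) = fact (2 * k) / (2 ^ k * fact k) * (s\<^sup>2) ^ k" for k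
      using distributed_integral[OF normal(2), of "\<lambda>x. x ^ (2 * k)"] integral_normal_moment_even[OF normal(1), of 0 k]
      by (simp add: power_divide)
    have "integrable M (\<lambda>\<omega>. Z \<omega> ^ k)"
      using distributed_integrable[OF normal(2), of "\<lambda>x. x ^ k"] integrable_normal_moment[OF normal(1), of 0 k]
      by simp
    moreover have "expectation (\<lambda>\<omega>. (Z \<omega>)\<^sup>2) = s\<^sup>2" using m[of 1] by simp
    ultimately show ?thesis using m[of k] by simp
  qed
  then show ?I ?E by auto
qed

lemma gaussian_fourth_moment:
  assumes Z: "gaussian_rv M Z" "expectation Z = 0"
  shows "expectation (\<lambda>\<omega>. Z \<omega> ^ 4) = 3 * (expectation (\<lambda>\<omega>. (Z \<omega>)\<^sup>2))\<^sup>2"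
  using gaussian_moments(2)[OF Z, of 2] by (simp add: eval_nat_numeral)

text \<open>In product form the estimate also covers the degenerate case, where the standard deviation
  vanishes.\<close>

lemma gaussian_small_ball:
  assumes Z: "gaussian_rv M Z" "expectation Z = 0" and e: "0 \<le> e"
  shows "prob {\<omega> \<in> space M. \<bar>Z \<omega> - a\<bar> \<le> e} * sqrt (expectation (\<lambda>\<omega>. (Z \<omega>)\<^sup>2)) \<le> e"
  using Z
proof (cases rule: gaussian_rv_cases)
  case const
  have "AE \<omega> in M. (Z \<omega>)\<^sup>2 = 0" using const(1) by eventually_elim simp
  then have "expectation (\<lambda>\<omega>. (Z \<omega>)\<^sup>2) = 0" using const(2) by (intro integral_eq_zero_AE)
  then show ?thesis using e by simp
next
  case (normal s)
  have "expectation (\<lambda>\<omega>. (Z \<omega>)\<^sup>2) = s\<^sup>2"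
    using normal_distributed_variance[OF normal] Z(2) by simp
  moreover have "prob {\<omega> \<in> space M. \<bar>Z \<omega> - a\<bar> \<le> e} \<le> e / s"
  proof -
    have "emeasure M (Z -` {a - e..a + e} \<inter> space M)
        = (\<integral>\<^sup>+x. ennreal (normal_density 0 s x) * indicator {a - e..a + e} x \<partial>lborel)"
      by (intro distributed_emeasure[OF normal(2)]) simp
    also have "\<dots> \<le> (\<integral>\<^sup>+x. ennreal (1 / (2 * s)) * indicator {a - e..a + e} x \<partial>lborel)"
      using normal_density_le[OF normal(1)] by (intro nn_integral_mono mult_right_mono ennreal_leI) auto
    also have "\<dots> = ennreal (1 / (2 * s)) * ennreal (2 * e)"
      using e by (subst nn_integral_cmult_indicator) simp_all
    also have "\<dots> = ennreal (e / s)"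
      using e normal(1) by (subst ennreal_mult[symmetric]) auto
    finally have "ennreal (prob (Z -` {a - e..a + e} \<inter> space M)) \<le> ennreal (e / s)"
      by (simp add: emeasure_eq_measure)
    moreover have "Z -` {a - e..a + e} \<inter> space M = {\<omega> \<in> space M. \<bar>Z \<omega> - a\<bar> \<le> e}"
      by (auto simp: abs_le_iff)
    ultimately show ?thesis using e normal(1) by simp
  qed
  ultimately show ?thesis using normal(1) by (simp add: pos_le_divide_eq)
qed

lemma gaussian_tail:
  assumes Z: "gaussian_rv M Z" "expectation Z = 0" and e: "0 < e"
  shows "prob {\<omega> \<in> space M. e < \<bar>Z \<omega>\<bar>}
    \<le> fact (2 * k) / (2 ^ k * fact k) * (expectation (\<lambda>\<omega>. (Z \<omega>)\<^sup>2) / e\<^sup>2) ^ k"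
proof -
  have [measurable]: "Z \<in> borel_measurable M" using Z by (simp add: gaussian_rv_def)
  have i: "integrable M (\<lambda>\<omega>. Z \<omega> ^ (2 * k))" using gaussian_moments(1)[OF Z] .
  have "prob {\<omega> \<in> space M. e < \<bar>Z \<omega>\<bar>} = expectation (indicator {\<omega> \<in> space M. e < \<bar>Z \<omega>\<bar>})" by simp
  also have "\<dots> \<le> expectation (\<lambda>\<omega>. Z \<omega> ^ (2 * k) / e ^ (2 * k))"
  proof (intro integral_mono)
    fix \<omega>
    have "\<bar>Z \<omega>\<bar> ^ (2 * k) = Z \<omega> ^ (2 * k)" by (rule power_even_abs) simp
    then have "1 \<le> Z \<omega> ^ (2 * k) / e ^ (2 * k)" if "e < \<bar>Z \<omega>\<bar>"
      using power_mono[of e "\<bar>Z \<omega>\<bar>" "2 * k"] that e by (simp only: le_divide_eq_1_pos zero_less_power less_imp_le)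
    then show "indicator {\<omega> \<in> space M. e < \<bar>Z \<omega>\<bar>} \<omega> \<le> Z \<omega> ^ (2 * k) / e ^ (2 * k)"
      using e by (simp add: indicator_def)
    show "integrable M (indicat_real {\<omega> \<in> space M. e < \<bar>Z \<omega>\<bar>})"
      by (rule integrable_real_indicator) (auto simp: emeasure_eq_measure)
  qed (use i in simp)
  also have "\<dots> = fact (2 * k) / (2 ^ k * fact k) * (expectation (\<lambda>\<omega>. (Z \<omega>)\<^sup>2) / e\<^sup>2) ^ k"
    using i gaussian_moments(2)[OF Z, of k] by (simp add: power_divide power_mult)
  finally show ?thesis .
qed

text \<open>Times may occur repeatedly here, in contrast to the definition of a Gaussian process; increments
  over adjacent intervals share an end point.\<close>

lemma gaussian_process_sum:
  assumes X: "gaussian_process M T X" and I: "finite I" "t ` I \<subseteq> {0..T}"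
  shows "gaussian_rv M (\<lambda>\<omega>. \<Sum>i\<in>I. a i * X (t i) \<omega>)"
proof -
  have "(\<Sum>s\<in>t ` I. (\<Sum>i | i \<in> I \<and> t i = s. a i) * X s \<omega>) = (\<Sum>i\<in>I. a i * X (t i) \<omega>)" for \<omega>
  proof -
    have "(\<Sum>i | i \<in> I \<and> t i = s. a i) * X s \<omega> = (\<Sum>i | i \<in> I \<and> t i = s. a i * X (t i) \<omega>)" for s
      unfolding sum_distrib_right by (rule sum.cong) auto
    then show ?thesis
      by (simp only: sum.image_gen[OF I(1), of "\<lambda>i. a i * X (t i) \<omega>" t, symmetric])
  qed
  moreover have "gaussian_rv M (\<lambda>\<omega>. \<Sum>s\<in>t ` I. (\<Sum>i | i \<in> I \<and> t i = s. a i) * X s \<omega>)"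
    using X[unfolded gaussian_process_def, rule_format, of "t ` I" "\<lambda>s. \<Sum>i | i \<in> I \<and> t i = s. a i"] I by simp
  ultimately show ?thesis by (simp only:)
qed

lemma gaussian_process_increments:
  assumes X: "gaussian_process M T X" and t: "s \<in> {0..T}" "u \<in> {0..T}" "v \<in> {0..T}" "w \<in> {0..T}"
  shows "gaussian_rv M (\<lambda>\<omega>. a * (X u \<omega> - X s \<omega>) + b * (X w \<omega> - X v \<omega>))"
proof -
  have "gaussian_rv M (\<lambda>\<omega>. \<Sum>i\<in>{0, 1, 2, 3::nat}. [a, -a, b, -b] ! i * X ([u, s, w, v] ! i) \<omega>)"
    using t by (intro gaussian_process_sum[OF X]) auto
  then show ?thesis by (simp add: algebra_simps)
qed

lemma gaussian_process_diff:
  assumes X: "gaussian_process M T X" and t: "s \<in> {0..T}" "u \<in> {0..T}"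
  shows "gaussian_rv M (\<lambda>\<omega>. X u \<omega> - X s \<omega>)"
  using gaussian_process_increments[OF X t t, of 1 0] by simp

lemma gaussian_process_at:
  assumes X: "gaussian_process M T X" and t: "u \<in> {0..T}"
  shows "gaussian_rv M (X u)"
  using gaussian_process_sum[OF X, of "{u}" "\<lambda>t. t" "\<lambda>_. 1"] t by simp

text \<open>A special case of Isserlis' theorem. By polarisation it follows from the formula for the
  fourth moment, applied to \<open>A + B\<close> and \<open>A - B\<close>.\<close>

lemma uncorrelated_squares:
  assumes g: "\<And>a b. gaussian_rv M (\<lambda>\<omega>. a * A \<omega> + b * B \<omega>)"
    and 0: "expectation A = 0" "expectation B = 0" "integrable M A" "integrable M B"
    and AB: "expectation (\<lambda>\<omega>. A \<omega> * B \<omega>) = 0"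
  shows "integrable M (\<lambda>\<omega>. (A \<omega>)\<^sup>2 * (B \<omega>)\<^sup>2)" (is ?I)
    and "expectation (\<lambda>\<omega>. (A \<omega>)\<^sup>2 * (B \<omega>)\<^sup>2) = expectation (\<lambda>\<omega>. (A \<omega>)\<^sup>2) * expectation (\<lambda>\<omega>. (B \<omega>)\<^sup>2)" (is ?E)
proof -
  have c: "expectation (\<lambda>\<omega>. a * A \<omega> + b * B \<omega>) = 0" for a b using 0 by simp
  note mom = gaussian_moments(1)[OF g c] and four = gaussian_fourth_moment[OF g c]
  have A: "integrable M (\<lambda>\<omega>. A \<omega> ^ k)" and B: "integrable M (\<lambda>\<omega>. B \<omega> ^ k)" for k
    using mom[of 1 0 k] mom[of 0 1 k] by auto
  have ab: "A \<omega> * B \<omega> = ((1 * A \<omega> + 1 * B \<omega>)\<^sup>2 - A \<omega> ^ 2 - B \<omega> ^ 2) / 2"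
      "(A \<omega>)\<^sup>2 * (B \<omega>)\<^sup>2 = ((1 * A \<omega> + 1 * B \<omega>) ^ 4 + (1 * A \<omega> + (-1) * B \<omega>) ^ 4 - 2 * A \<omega> ^ 4 - 2 * B \<omega> ^ 4) / 12" for \<omega>
    by (simp_all add: power2_eq_square power4_eq_xxxx algebra_simps)
  have iAB: "integrable M (\<lambda>\<omega>. A \<omega> * B \<omega>)"
    unfolding ab(1) using mom[of 1 1 2] A[of 2] B[of 2] by simp
  have sq: "expectation (\<lambda>\<omega>. (a * A \<omega> + b * B \<omega>)\<^sup>2) = a\<^sup>2 * expectation (\<lambda>\<omega>. (A \<omega>)\<^sup>2) + b\<^sup>2 * expectation (\<lambda>\<omega>. (B \<omega>)\<^sup>2)" for a b
  proof -
    have "(a * A \<omega> + b * B \<omega>)\<^sup>2 = a\<^sup>2 * (A \<omega>)\<^sup>2 + b\<^sup>2 * (B \<omega>)\<^sup>2 + 2 * a * b * (A \<omega> * B \<omega>)" for \<omega>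
      by (simp add: power2_eq_square algebra_simps)
    then show ?thesis using A B iAB AB by simp
  qed
  show ?I
    unfolding ab(2) using mom[of 1 1 4] mom[of 1 "-1" 4] A[of 4] B[of 4] by simp
  have "expectation (\<lambda>\<omega>. (A \<omega>)\<^sup>2 * (B \<omega>)\<^sup>2) = (expectation (\<lambda>\<omega>. (1 * A \<omega> + 1 * B \<omega>) ^ 4) +
      expectation (\<lambda>\<omega>. (1 * A \<omega> + (-1) * B \<omega>) ^ 4) - 2 * expectation (\<lambda>\<omega>. A \<omega> ^ 4) - 2 * expectation (\<lambda>\<omega>. B \<omega> ^ 4)) / 12"
    unfolding ab(2) using mom[of 1 1 4] mom[of 1 "-1" 4] A[of 4] B[of 4] by simp
  also have "\<dots> = expectation (\<lambda>\<omega>. (A \<omega>)\<^sup>2) * expectation (\<lambda>\<omega>. (B \<omega>)\<^sup>2)"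
  proof -
    have "expectation (\<lambda>\<omega>. A \<omega> ^ 4) = 3 * (expectation (\<lambda>\<omega>. (A \<omega>)\<^sup>2))\<^sup>2"
      "expectation (\<lambda>\<omega>. B \<omega> ^ 4) = 3 * (expectation (\<lambda>\<omega>. (B \<omega>)\<^sup>2))\<^sup>2"
      using four[of 1 0] four[of 0 1] by simp_all
    then show ?thesis
      unfolding four sq by (simp only:) (simp add: power2_eq_square field_simps)
  qed
  finally show ?E .
qed

end

section \<open>A Gaussian martingale plus a smoother Gaussian process\<close>

lemma integrable_mult_squares:
  fixes f g :: "'a \<Rightarrow> real"
  assumes [measurable]: "f \<in> borel_measurable N" "g \<in> borel_measurable N"
    and f: "integrable N (\<lambda>x. (f x)\<^sup>2)" and g: "integrable N (\<lambda>x. (g x)\<^sup>2)"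
  shows "integrable N (\<lambda>x. f x * g x)"
proof (rule Bochner_Integration.integrable_bound)
  show "integrable N (\<lambda>x. (f x)\<^sup>2 + (g x)\<^sup>2)" using f g by simp
  have "\<bar>u * v\<bar> \<le> u\<^sup>2 + v\<^sup>2" for u v :: real
    using sum_squares_bound[of "\<bar>u\<bar>" "\<bar>v\<bar>"] unfolding abs_mult power2_abs by (metis abs_ge_zero mult_2 mult.assoc mult_nonneg_nonneg order_trans le_add_same_cancel1)
  then show "AE x in N. norm (f x * g x) \<le> norm ((f x)\<^sup>2 + (g x)\<^sup>2)" by simp
qed simp

lemma subalgebra_natural_filtration:
  assumes "\<And>s. 0 \<le> s \<Longrightarrow> s \<le> t \<Longrightarrow> X s \<in> borel_measurable P"
  shows "subalgebra P (natural_filtration P X t)"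
proof -
  have "{X s -` A \<inter> space P | s A. 0 \<le> s \<and> s \<le> t \<and> A \<in> sets borel} \<subseteq> sets P"
    using assms by (auto intro: measurable_sets)
  then have "sets (natural_filtration P X t) \<subseteq> sets P"
    unfolding natural_filtration_def
    by (subst sets_measure_of) (auto intro!: sets.sigma_sets_subset dest: sets.sets_into_space)
  then show ?thesis by (simp add: subalgebra_def natural_filtration_def space_measure_of_conv)
qed

lemma subalgebra_natural_filtration_mono:
  assumes "s \<le> t" shows "subalgebra (natural_filtration P X t) (natural_filtration P X s)"
proof -
  have sets: "sets (natural_filtration P X t) =
      sigma_sets (space P) {X s -` A \<inter> space P | s A. 0 \<le> s \<and> s \<le> t \<and> A \<in> sets borel}" for t
    unfolding natural_filtration_def by (rule sets_measure_of) auto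
  show ?thesis
    using assms unfolding subalgebra_def sets
    by (intro conjI sigma_sets_mono') (simp_all add: natural_filtration_def space_measure_of_conv, force)
qed

text \<open>\<open>Y_pos\<close> and \<open>Y_low\<close> are conditions on the variance function, since \<open>Y\<close> is centered.\<close>

locale perturbed_martingale = prob_space P for P :: "'a measure" +
  fixes T \<alpha> :: real and M X Y :: "real \<Rightarrow> 'a \<Rightarrow> real"
  assumes T: "0 < T"
    and M_gauss: "gaussian_process P T M" and M_cent: "centered P T M"
    and M_mart: "martingale_process P T (natural_filtration P M) M"
    and M_lip: "\<exists>K. K-lipschitz_on {0..T} (\<lambda>t. variance (M t))"
    and X_gauss: "gaussian_process P T X" and \<alpha>: "1 / 2 < \<alpha>" and X_holder: "holder_process P T \<alpha> X"
    and Y_def: "Y = (\<lambda>t \<omega>. M t \<omega> + X t \<omega>)"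
    and Y_gauss: "gaussian_process P T Y" and Y_cent: "centered P T Y" and Y_cont: "continuous_process P T Y"
    and Y_pos: "\<forall>s\<in>{0<..T}. 0 < expectation (\<lambda>\<omega>. (Y s \<omega>)\<^sup>2)"
    and Y_low: "\<exists>c>0. \<exists>\<delta>>0. \<forall>s\<in>{0..T}. s \<le> \<delta> \<longrightarrow> c * s\<^sup>2 \<le> expectation (\<lambda>\<omega>. (Y s \<omega>)\<^sup>2)"
    and Y_adapt: "adapted_process T (natural_filtration P M) Y"
begin

lemma meas [measurable]:
  assumes "t \<in> {0..T}"
  shows "M t \<in> borel_measurable P" "X t \<in> borel_measurable P" "Y t \<in> borel_measurable P"
  using gaussian_process_at[OF M_gauss assms] gaussian_process_at[OF X_gauss assms]
    gaussian_process_at[OF Y_gauss assms] by (simp_all add: gaussian_rv_def)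

lemma X_eq: "X t = (\<lambda>\<omega>. Y t \<omega> - M t \<omega>)" by (simp add: Y_def)

lemma mean_zero:
  assumes "t \<in> {0..T}"
  shows "integrable P (M t)" "expectation (M t) = 0" "integrable P (X t)" "expectation (X t) = 0"
    "integrable P (Y t)" "expectation (Y t) = 0"
  using M_cent Y_cent assms unfolding centered_def X_eq by auto

lemma increment_gaussian:
  assumes "s \<in> {0..T}" "u \<in> {0..T}" and Z: "Z = M \<or> Z = X \<or> Z = Y"
  shows "gaussian_rv P (\<lambda>\<omega>. Z u \<omega> - Z s \<omega>)" "expectation (\<lambda>\<omega>. Z u \<omega> - Z s \<omega>) = 0"
  using gaussian_process_diff[OF M_gauss assms(1,2)] gaussian_process_diff[OF X_gauss assms(1,2)]
    gaussian_process_diff[OF Y_gauss assms(1,2)] mean_zero assms by auto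

lemma integrable_powers:
  assumes "s \<in> {0..T}" "u \<in> {0..T}"
  shows "integrable P (\<lambda>\<omega>. M u \<omega> ^ k)" "integrable P (\<lambda>\<omega>. Y u \<omega> ^ k)"
    "integrable P (\<lambda>\<omega>. (M u \<omega> - M s \<omega>) ^ k)" "integrable P (\<lambda>\<omega>. (X u \<omega> - X s \<omega>) ^ k)"
    "integrable P (\<lambda>\<omega>. (Y u \<omega> - Y s \<omega>) ^ k)"
  using gaussian_moments(1)[OF gaussian_process_at[OF M_gauss assms(2)]]
    gaussian_moments(1)[OF gaussian_process_at[OF Y_gauss assms(2)]] mean_zero[OF assms(2)]
    gaussian_moments(1)[OF increment_gaussian[OF assms, of M]] gaussian_moments(1)[OF increment_gaussian[OF assms, of X]]
    gaussian_moments(1)[OF increment_gaussian[OF assms, of Y]] by simp_all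

definition m :: "real \<Rightarrow> real" where "m t = expectation (\<lambda>\<omega>. (M t \<omega>)\<^sup>2)"

abbreviation F :: "real \<Rightarrow> 'a measure" where "F \<equiv> natural_filtration P M"

lemma subalg: "t \<le> T \<Longrightarrow> subalgebra P (F t)"
  by (intro subalgebra_natural_filtration meas) auto

lemma adapted:
  assumes "0 \<le> s" "s \<le> t" "t \<le> T"
  shows "M s \<in> borel_measurable (F t)" "Y s \<in> borel_measurable (F t)"
proof -
  have "M s \<in> borel_measurable (F s)" "Y s \<in> borel_measurable (F s)"
    using M_mart Y_adapt assms by (auto simp: martingale_process_def adapted_process_def)
  then show "M s \<in> borel_measurable (F t)" "Y s \<in> borel_measurable (F t)"
    by (auto intro: measurable_from_subalg[OF subalgebra_natural_filtration_mono[OF assms(2)]])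
qed

text \<open>Square integrability of \<open>W\<close> is enough here, which admits weights built from earlier increments.\<close>

lemma martingale_orthogonal:
  assumes t: "0 \<le> s" "s \<le> u" "u \<le> T"
    and W: "W \<in> borel_measurable (F s)" and W2: "integrable P (\<lambda>\<omega>. (W \<omega>)\<^sup>2)"
  shows "integrable P (\<lambda>\<omega>. W \<omega> * (M u \<omega> - M s \<omega>))" (is ?I)
    and "expectation (\<lambda>\<omega>. W \<omega> * (M u \<omega> - M s \<omega>)) = 0" (is ?E)
proof -
  have s: "s \<in> {0..T}" and u: "u \<in> {0..T}" using t by auto
  interpret S: finite_measure_subalgebra P "F s"
    using t subalg[of s] by unfold_locales auto
  have WP[measurable]: "W \<in> borel_measurable P" by (rule measurable_from_subalg[OF S.subalg W])
  note [measurable] = meas[OF s] meas[OF u]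
  have iu: "integrable P (\<lambda>\<omega>. W \<omega> * M u \<omega>)" and i_s: "integrable P (\<lambda>\<omega>. W \<omega> * M s \<omega>)"
    using integrable_powers(1)[OF s s, of 2] integrable_powers(1)[OF s u, of 2] W2
    by (auto intro!: integrable_mult_squares)
  have "AE \<omega> in P. real_cond_exp P (F s) (M u) \<omega> = M s \<omega>"
    using M_mart s u t by (auto simp: martingale_process_def)
  then have "expectation (\<lambda>\<omega>. W \<omega> * real_cond_exp P (F s) (M u) \<omega>) = expectation (\<lambda>\<omega>. W \<omega> * M s \<omega>)"
    by (intro integral_cong_AE) auto
  then have e: "expectation (\<lambda>\<omega>. W \<omega> * M u \<omega>) = expectation (\<lambda>\<omega>. W \<omega> * M s \<omega>)"
    using S.real_cond_exp_intg(2)[OF iu W] by simp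
  show ?I ?E
    using iu i_s e by (simp_all add: right_diff_distrib)
qed

lemma M_increment_var:
  assumes t: "0 \<le> s" "s \<le> u" "u \<le> T"
  shows "expectation (\<lambda>\<omega>. (M u \<omega> - M s \<omega>)\<^sup>2) = m u - m s"
proof -
  have s: "s \<in> {0..T}" and u: "u \<in> {0..T}" using t by auto
  have "(M u \<omega> - M s \<omega>)\<^sup>2 = (M u \<omega>)\<^sup>2 - (M s \<omega>)\<^sup>2 - 2 * (M s \<omega> * (M u \<omega> - M s \<omega>))" for \<omega>
    by (simp add: power2_eq_square algebra_simps)
  moreover have "integrable P (\<lambda>\<omega>. M s \<omega> * (M u \<omega> - M s \<omega>))" "expectation (\<lambda>\<omega>. M s \<omega> * (M u \<omega> - M s \<omega>)) = 0"
    using martingale_orthogonal[OF t adapted(1)[of s s] integrable_powers(1)[OF s s]] t by auto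
  ultimately show ?thesis
    using integrable_powers(1)[OF s u, of 2] integrable_powers(1)[OF s s, of 2] by (simp add: m_def)
qed

lemma m_mono: "0 \<le> s \<Longrightarrow> s \<le> u \<Longrightarrow> u \<le> T \<Longrightarrow> m s \<le> m u"
  using M_increment_var[of s u] Bochner_Integration.integral_nonneg[of P "\<lambda>\<omega>. (M u \<omega> - M s \<omega>)\<^sup>2"] by simp

lemma m_lip: "\<exists>K>0. \<forall>s\<in>{0..T}. \<forall>u\<in>{0..T}. \<bar>m u - m s\<bar> \<le> K * \<bar>u - s\<bar>"
proof -
  obtain K where K: "K-lipschitz_on {0..T} (\<lambda>t. variance (M t))" using M_lip by blast
  have "variance (M t) = m t" if "t \<in> {0..T}" for t
    using mean_zero[OF that] by (simp add: m_def)
  then have "\<bar>m u - m s\<bar> \<le> \<bar>K\<bar> * \<bar>u - s\<bar>" if "s \<in> {0..T}" "u \<in> {0..T}" for s u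
    using lipschitz_onD[OF K that(2,1)] lipschitz_on_nonneg[OF K] that by (simp add: dist_real_def)
  then have "\<bar>m u - m s\<bar> \<le> (\<bar>K\<bar> + 1) * \<bar>u - s\<bar>" if "s \<in> {0..T}" "u \<in> {0..T}" for s u
    using that by (simp add: distrib_right add_increasing2)
  then show ?thesis by (intro exI[of _ "\<bar>K\<bar> + 1"]) auto
qed

text \<open>The random Hoelder constant is below some number \<open>N\<close> with probability greater than \<open>1/2\<close>.
  A Gaussian variable that is below \<open>e\<close> in absolute value with such a probability has standard
  deviation at most \<open>2 e\<close>. Since \<open>2 \<alpha> > 1\<close>, a Lipschitz bound for the variance follows.\<close>

lemma X_increment_var:
  "\<exists>K>0. \<forall>s\<in>{0..T}. \<forall>u\<in>{0..T}. expectation (\<lambda>\<omega>. (X u \<omega> - X s \<omega>)\<^sup>2) \<le> K * \<bar>u - s\<bar>"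
proof -
  obtain C where C [measurable]: "C \<in> borel_measurable P" and
    h: "AE \<omega> in P. \<forall>s\<in>{0..T}. \<forall>t\<in>{0..T}. \<bar>X t \<omega> - X s \<omega>\<bar> \<le> C \<omega> * \<bar>t - s\<bar> powr \<alpha>"
    using X_holder by (auto simp: holder_process_def)
  define B where "B n = {\<omega> \<in> space P. C \<omega> \<le> real n}" for n :: nat
  have "(\<Union>n. B n) = space P" by (auto simp: B_def intro: real_arch_simple)
  moreover have "(\<lambda>n. prob (B n)) \<longlonglongrightarrow> prob (\<Union>n. B n)"
    by (intro finite_Lim_measure_incseq) (auto simp: B_def incseq_def)
  ultimately have "(\<lambda>n. prob (B n)) \<longlonglongrightarrow> 1" by (simp add: prob_space)
  from order_tendstoD(1)[OF this, of "1 / 2"] obtain N where N: "1 / 2 < prob (B N)"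
    by (auto simp: eventually_sequentially)
  define K where "K = 4 * (real N)\<^sup>2 * T powr (2 * \<alpha> - 1) + 1"
  have "expectation (\<lambda>\<omega>. (X u \<omega> - X s \<omega>)\<^sup>2) \<le> K * \<bar>u - s\<bar>" if s: "s \<in> {0..T}" and u: "u \<in> {0..T}" for s u
  proof -
    define \<sigma> where "\<sigma> = sqrt (expectation (\<lambda>\<omega>. (X u \<omega> - X s \<omega>)\<^sup>2))"
    define e where "e = real N * \<bar>u - s\<bar> powr \<alpha>"
    note [measurable] = meas[OF s] meas[OF u]
    have "prob (B N) \<le> prob {\<omega> \<in> space P. \<bar>(X u \<omega> - X s \<omega>) - 0\<bar> \<le> e}"
    proof (rule finite_measure_mono_AE)
      show "AE \<omega> in P. \<omega> \<in> B N \<longrightarrow> \<omega> \<in> {\<omega> \<in> space P. \<bar>X u \<omega> - X s \<omega> - 0\<bar> \<le> e}"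
        using h
      proof eventually_elim
        case (elim \<omega>)
        then have "\<bar>X u \<omega> - X s \<omega>\<bar> \<le> C \<omega> * \<bar>u - s\<bar> powr \<alpha>" using s u by blast
        moreover have "C \<omega> * \<bar>u - s\<bar> powr \<alpha> \<le> e" if "\<omega> \<in> B N"
          using that by (auto simp: B_def e_def intro: mult_right_mono)
        ultimately show ?case by (auto simp: B_def)
      qed
    qed simp
    then have "1 / 2 * \<sigma> \<le> prob {\<omega> \<in> space P. \<bar>(X u \<omega> - X s \<omega>) - 0\<bar> \<le> e} * \<sigma>"
      using N by (intro mult_right_mono) (auto simp: \<sigma>_def)
    also have "\<dots> \<le> e"
      unfolding \<sigma>_def using increment_gaussian[OF s u, of X] by (intro gaussian_small_ball) (auto simp: e_def)
    finally have "\<sigma>\<^sup>2 \<le> (2 * e)\<^sup>2" by (intro power_mono) (auto simp: \<sigma>_def)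
    also have "(2 * e)\<^sup>2 = 4 * (real N)\<^sup>2 * \<bar>u - s\<bar> powr (2 * \<alpha>)"
      by (simp add: e_def power2_eq_square powr_add[symmetric])
    also have "\<bar>u - s\<bar> powr (2 * \<alpha>) = \<bar>u - s\<bar> powr (2 * \<alpha> - 1) * \<bar>u - s\<bar>"
      using powr_add[of "\<bar>u - s\<bar>" "2 * \<alpha> - 1" 1] by simp
    also have "4 * (real N)\<^sup>2 * (\<bar>u - s\<bar> powr (2 * \<alpha> - 1) * \<bar>u - s\<bar>) \<le> 4 * (real N)\<^sup>2 * (T powr (2 * \<alpha> - 1) * \<bar>u - s\<bar>)"
      using s u \<alpha> by (intro mult_left_mono mult_right_mono powr_mono2) auto
    also have "\<dots> \<le> K * \<bar>u - s\<bar>" by (simp add: K_def algebra_simps)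
    finally show ?thesis by (simp add: \<sigma>_def)
  qed
  moreover have "0 < K" by (simp add: K_def add_nonneg_pos)
  ultimately show ?thesis by blast
qed

lemma increment_var:
  "\<exists>K>0. \<forall>s\<in>{0..T}. \<forall>u\<in>{0..T}. expectation (\<lambda>\<omega>. (M u \<omega> - M s \<omega>)\<^sup>2) \<le> K * \<bar>u - s\<bar> \<and>
     expectation (\<lambda>\<omega>. (Y u \<omega> - Y s \<omega>)\<^sup>2) \<le> K * \<bar>u - s\<bar>"
proof -
  obtain K1 where K1: "0 < K1" "\<And>s u. s \<in> {0..T} \<Longrightarrow> u \<in> {0..T} \<Longrightarrow> \<bar>m u - m s\<bar> \<le> K1 * \<bar>u - s\<bar>"
    using m_lip by blast
  obtain K2 where K2: "0 < K2" "\<And>s u. s \<in> {0..T} \<Longrightarrow> u \<in> {0..T} \<Longrightarrow>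
      expectation (\<lambda>\<omega>. (X u \<omega> - X s \<omega>)\<^sup>2) \<le> K2 * \<bar>u - s\<bar>"
    using X_increment_var by blast
  have M: "expectation (\<lambda>\<omega>. (M u \<omega> - M s \<omega>)\<^sup>2) \<le> K1 * \<bar>u - s\<bar>" if "s \<in> {0..T}" "u \<in> {0..T}" for s u
  proof (cases "s \<le> u")
    case True
    then show ?thesis using M_increment_var[of s u] K1(2)[OF that] that by auto
  next
    case False
    then have "expectation (\<lambda>\<omega>. (M s \<omega> - M u \<omega>)\<^sup>2) \<le> K1 * \<bar>s - u\<bar>"
      using M_increment_var[of u s] K1(2)[OF that(2,1)] that by auto
    then show ?thesis by (simp add: power2_commute abs_minus_commute)
  qed
  have "expectation (\<lambda>\<omega>. (Y u \<omega> - Y s \<omega>)\<^sup>2) \<le> 2 * (K1 + K2) * \<bar>u - s\<bar>" if "s \<in> {0..T}" "u \<in> {0..T}" for s u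
  proof -
    note i = integrable_powers[OF that, of 2]
    have "expectation (\<lambda>\<omega>. (Y u \<omega> - Y s \<omega>)\<^sup>2) \<le> expectation (\<lambda>\<omega>. 2 * (M u \<omega> - M s \<omega>)\<^sup>2 + 2 * (X u \<omega> - X s \<omega>)\<^sup>2)"
    proof (rule integral_mono)
      fix \<omega>
      have "(a + b)\<^sup>2 \<le> 2 * a\<^sup>2 + 2 * b\<^sup>2" for a b :: real
        using zero_le_power2[of "a - b"] by (simp add: power2_eq_square algebra_simps)
      from this[of "M u \<omega> - M s \<omega>" "X u \<omega> - X s \<omega>"]
      show "(Y u \<omega> - Y s \<omega>)\<^sup>2 \<le> 2 * (M u \<omega> - M s \<omega>)\<^sup>2 + 2 * (X u \<omega> - X s \<omega>)\<^sup>2"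
        by (simp add: Y_def algebra_simps)
    qed (use i in auto)
    also have "\<dots> = 2 * expectation (\<lambda>\<omega>. (M u \<omega> - M s \<omega>)\<^sup>2) + 2 * expectation (\<lambda>\<omega>. (X u \<omega> - X s \<omega>)\<^sup>2)"
      using i by simp
    also have "\<dots> \<le> 2 * (K1 + K2) * \<bar>u - s\<bar>"
      using M[OF that] K2(2)[OF that] by (simp add: algebra_simps)
    finally show ?thesis .
  qed
  moreover have "K1 * \<bar>u - s\<bar> \<le> 2 * (K1 + K2) * \<bar>u - s\<bar>" for s u :: real
    using K1 K2 by (intro mult_right_mono) auto
  ultimately show ?thesis
    using K1(1) K2(1) by (intro exI[of _ "2 * (K1 + K2)"] conjI ballI) (simp, blast intro: order_trans[OF M], blast)
qed

text \<open>Near zero this is the assumption. Away from zero the variance is bounded below by compactness: a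
  sequence of times along which it vanishes would accumulate at a time of zero variance, as
  \<open>V s \<le> 2 V u + 2 E (Y u - Y s)\<^sup>2\<close>.\<close>

lemma Y_var_lower: "\<exists>\<kappa>>0. \<forall>s\<in>{0..T}. \<kappa> * s\<^sup>2 \<le> expectation (\<lambda>\<omega>. (Y s \<omega>)\<^sup>2)"
proof -
  define V where "V s = expectation (\<lambda>\<omega>. (Y s \<omega>)\<^sup>2)" for s
  obtain K where K: "0 < K" "\<And>s u. s \<in> {0..T} \<Longrightarrow> u \<in> {0..T} \<Longrightarrow> expectation (\<lambda>\<omega>. (Y u \<omega> - Y s \<omega>)\<^sup>2) \<le> K * \<bar>u - s\<bar>"
    using increment_var by blast
  obtain c \<delta> where c: "0 < c" "0 < \<delta>" "\<And>s. s \<in> {0..T} \<Longrightarrow> s \<le> \<delta> \<Longrightarrow> c * s\<^sup>2 \<le> V s"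
    using Y_low unfolding V_def by blast
  have V_le: "V s \<le> 2 * V u + 2 * K * \<bar>u - s\<bar>" if "s \<in> {0..T}" "u \<in> {0..T}" for s u
  proof -
    note i = integrable_powers[OF that, of 2] integrable_powers[OF that(2,1), of 2]
    have "V s \<le> expectation (\<lambda>\<omega>. 2 * (Y u \<omega>)\<^sup>2 + 2 * (Y u \<omega> - Y s \<omega>)\<^sup>2)"
      unfolding V_def
    proof (rule integral_mono)
      fix \<omega>
      have "a\<^sup>2 \<le> 2 * b\<^sup>2 + 2 * (b - a)\<^sup>2" for a b :: real
        using zero_le_power2[of "2 * b - a"] by (simp add: power2_eq_square algebra_simps)
      then show "(Y s \<omega>)\<^sup>2 \<le> 2 * (Y u \<omega>)\<^sup>2 + 2 * (Y u \<omega> - Y s \<omega>)\<^sup>2" .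
    qed (use i in auto)
    also have "\<dots> = 2 * V u + 2 * expectation (\<lambda>\<omega>. (Y u \<omega> - Y s \<omega>)\<^sup>2)"
      using i by (simp add: V_def)
    finally show ?thesis using K(2)[OF that] by simp
  qed
  have "\<exists>v>0. \<forall>s\<in>{\<delta>..T}. v \<le> V s"
  proof (rule ccontr)
    assume "\<not> ?thesis"
    then have "\<exists>s\<in>{\<delta>..T}. V s < inverse (real (Suc n))" for n
      by (metis inverse_positive_iff_positive of_nat_0_less_iff zero_less_Suc not_le)
    then obtain u where u: "\<And>n. u n \<in> {\<delta>..T}" "\<And>n. V (u n) < inverse (real (Suc n))" by metis
    obtain s r where s: "s \<in> {\<delta>..T}" "strict_mono r" "(u \<circ> r) \<longlonglongrightarrow> s"
      using compact_imp_seq_compact[OF compact_Icc, unfolded seq_compact_def, rule_format, of u] u(1) by metis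
    have "(\<lambda>n. 2 * inverse (real (Suc (r n))) + 2 * K * \<bar>u (r n) - s\<bar>) \<longlonglongrightarrow> 2 * 0 + 2 * K * \<bar>s - s\<bar>"
      using s(3) LIMSEQ_subseq_LIMSEQ[OF LIMSEQ_inverse_real_of_nat s(2)]
      by (intro tendsto_intros) (auto simp: o_def)
    moreover have "V s \<le> 2 * inverse (real (Suc (r n))) + 2 * K * \<bar>u (r n) - s\<bar>" for n
      using V_le[of s "u (r n)"] u(1)[of "r n"] u(2)[of "r n"] s(1) c(2) by auto
    ultimately have "V s \<le> 0"
      by (intro tendsto_lowerbound) (auto intro: always_eventually)
    moreover have "0 < V s" using Y_pos s(1) c(2) by (auto simp: V_def)
    ultimately show False by simp
  qed
  then obtain v where v: "0 < v" "\<And>s. s \<in> {\<delta>..T} \<Longrightarrow> v \<le> V s" by blast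
  have "min c (v / T\<^sup>2) * s\<^sup>2 \<le> V s" if s: "s \<in> {0..T}" for s
  proof (cases "s \<le> \<delta>")
    case True
    have "min c (v / T\<^sup>2) * s\<^sup>2 \<le> c * s\<^sup>2" by (intro mult_right_mono) auto
    also have "\<dots> \<le> V s" using c(3)[OF s True] .
    finally show ?thesis .
  next
    case False
    have "min c (v / T\<^sup>2) * s\<^sup>2 \<le> v / T\<^sup>2 * T\<^sup>2"
      using s v by (intro mult_mono power_mono) auto
    also have "\<dots> \<le> V s" using v(2)[of s] False s T by simp
    finally show ?thesis .
  qed
  then show ?thesis using c v T by (intro exI[of _ "min c (v / T\<^sup>2)"]) (auto simp: V_def)
qed

end

section \<open>Flips along dyadic partitions\<close>

lemma AE_summable_if_integrals_summable:
  fixes f :: "nat \<Rightarrow> 'a \<Rightarrow> real"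
  assumes f: "\<And>n. f n \<in> borel_measurable N" "\<And>n x. 0 \<le> f n x"
    and b: "\<And>n. (\<integral>\<^sup>+x. f n x \<partial>N) \<le> ennreal (b n)" "summable b" "\<And>n. 0 \<le> b n"
  shows "AE x in N. summable (\<lambda>n. f n x)"
proof -
  note [measurable] = f(1)
  have "(\<integral>\<^sup>+x. (\<Sum>n. ennreal (f n x)) \<partial>N) = (\<Sum>n. \<integral>\<^sup>+x. f n x \<partial>N)"
    by (intro nn_integral_suminf) measurable
  also have "\<dots> \<le> (\<Sum>n. ennreal (b n))" using b(1) by (intro suminf_le) auto
  also have "\<dots> = ennreal (\<Sum>n. b n)" using b by (intro suminf_ennreal2)
  finally have "(\<integral>\<^sup>+x. (\<Sum>n. ennreal (f n x)) \<partial>N) \<noteq> \<infinity>" by (auto simp: top_unique)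
  then have "AE x in N. (\<Sum>n. ennreal (f n x)) \<noteq> \<infinity>"
    by (intro nn_integral_PInf_AE) measurable
  then show ?thesis
    by eventually_elim (use f(2) in \<open>auto intro!: summable_suminf_not_top\<close>)
qed

lemma harmonic_dyadic: "(\<Sum>j<2 ^ n. 1 / real (Suc j)) \<le> real n + 1"
proof (induction n)
  case (Suc n)
  have "(\<Sum>j<2 ^ Suc n. 1 / real (Suc j)) = (\<Sum>j<2 ^ n. 1 / real (Suc j)) + (\<Sum>j\<in>{2 ^ n..<2 ^ Suc n}. 1 / real (Suc j))"
    unfolding lessThan_atLeast0 by (subst sum.atLeastLessThan_concat) auto
  also have "(\<Sum>j\<in>{2 ^ n..<2 ^ Suc n}. 1 / real (Suc j)) \<le> (\<Sum>j\<in>{2 ^ n..<2 ^ Suc n::nat}. 1 / 2 ^ n)"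
  proof (rule sum_mono)
    fix j :: nat assume "j \<in> {2 ^ n..<2 ^ Suc n}"
    then have "(2::nat) ^ n \<le> j" by simp
    then have "real (2 ^ n) \<le> real (Suc j)" unfolding of_nat_le_iff by simp
    then show "1 / real (Suc j) \<le> 1 / 2 ^ n" unfolding of_nat_power of_nat_numeral by (rule divide_left_mono) simp_all
  qed
  also have "\<dots> = 1" by simp
  finally show ?case using Suc by simp
qed simp

context perturbed_martingale
begin

lemma dyadic_in: "j \<le> 2 ^ n \<Longrightarrow> dyadic T n j \<in> {0..T}"
  using T steps_T[OF T, of n] dyadic_le_iff[of T T n j] dyadic_nonneg[OF T, of n j] by auto

abbreviation path :: "'a \<Rightarrow> real \<Rightarrow> real" where "path \<omega> \<equiv> \<lambda>t. Y t \<omega>"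

lemma flip_cases: "\<bar>flip T y n a j\<bar> = (if (a < y (dyadic T n j)) = (a < y (dyadic T (Suc n) (Suc (2 * j)))) then 0 else 1)"
  by (simp add: flip_def)

lemma flip_measurable [measurable]:
  assumes "j < 2 ^ n" shows "(\<lambda>\<omega>. flip T (path \<omega>) n a j) \<in> borel_measurable P"
proof -
  note [measurable] = meas(3)[OF dyadic_in[of j n]] meas(3)[OF dyadic_in[of "Suc (2 * j)" "Suc n"]]
  show ?thesis using assms unfolding flip_def by simp
qed

lemma flip_integrable:
  assumes "j < 2 ^ n" shows "integrable P (\<lambda>\<omega>. \<bar>flip T (path \<omega>) n a j\<bar>)"
proof (rule integrable_const_bound[of _ 1])
  show "(\<lambda>\<omega>. \<bar>flip T (path \<omega>) n a j\<bar>) \<in> borel_measurable P"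
    using flip_measurable[OF assms] by measurable
qed (simp add: flip_cases)

abbreviation flip_prob :: "nat \<Rightarrow> real \<Rightarrow> nat \<Rightarrow> real" where
  "flip_prob n a j \<equiv> expectation (\<lambda>\<omega>. \<bar>flip T (path \<omega>) n a j\<bar>)"

lemma expectation_flip_le:
  assumes j: "j < 2 ^ n" and e: "0 < e"
  shows "flip_prob n a j \<le>
    prob {\<omega> \<in> space P. \<bar>Y (dyadic T n j) \<omega> - a\<bar> \<le> e} +
    prob {\<omega> \<in> space P. e < \<bar>Y (dyadic T (Suc n) (Suc (2 * j))) \<omega> - Y (dyadic T n j) \<omega>\<bar>}"
    (is "_ \<le> prob ?A + prob ?B")
proof -
  note [measurable] = meas(3)[OF dyadic_in[of j n]] meas(3)[OF dyadic_in[of "Suc (2 * j)" "Suc n"]] flip_measurable[OF j]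
  have [measurable]: "?A \<in> sets P" "?B \<in> sets P" using j by simp_all
  have "flip_prob n a j \<le> expectation (\<lambda>\<omega>. indicator ?A \<omega> + indicator ?B \<omega>)"
  proof (rule integral_mono)
    show "integrable P (\<lambda>\<omega>. \<bar>flip T (path \<omega>) n a j\<bar>)" by (rule flip_integrable[OF j])
    show "\<bar>flip T (path \<omega>) n a j\<bar> \<le> indicator ?A \<omega> + indicator ?B \<omega>" if "\<omega> \<in> space P" for \<omega>
      using that by (auto simp: flip_cases indicator_def)
  qed (auto intro!: integrable_real_indicator simp: emeasure_eq_measure)
  also have "\<dots> = prob ?A + prob ?B"
    by (subst Bochner_Integration.integral_add) (auto intro!: integrable_real_indicator simp: emeasure_eq_measure)
  finally show ?thesis .
qed

text \<open>With the threshold \<open>\<epsilon> = r\<^sup>n\<close> the small ball probability at time \<open>j T / 2\<^sup>n\<close> is at most of order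
  \<open>(2 r)\<^sup>n / j\<close>, whence the harmonic sum. The increments have variance of order \<open>2\<^sup>-\<^sup>n\<close>, which is
  much smaller than \<open>\<epsilon>\<^sup>2\<close> as \<open>r\<^sup>2 > 1/2\<close>; a tail bound with sufficiently high moments beats the number
  \<open>2\<^sup>n\<close> of intervals.\<close>

lemma expected_flips:
  assumes r: "1 / 2 < r\<^sup>2" "0 < r" "r < 1"
  shows "\<exists>A>0. \<forall>n a. (\<Sum>j<2 ^ n. flip_prob n a j) \<le> A * (real n + 1) * (2 * r) ^ n"
proof -
  obtain \<kappa> where \<kappa>: "0 < \<kappa>" "\<And>s. s \<in> {0..T} \<Longrightarrow> \<kappa> * s\<^sup>2 \<le> expectation (\<lambda>\<omega>. (Y s \<omega>)\<^sup>2)"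
    using Y_var_lower by blast
  obtain K where K: "0 < K" "\<And>s u. s \<in> {0..T} \<Longrightarrow> u \<in> {0..T} \<Longrightarrow> expectation (\<lambda>\<omega>. (Y u \<omega> - Y s \<omega>)\<^sup>2) \<le> K * \<bar>u - s\<bar>"
    using increment_var by blast
  \<comment> \<open>\<open>q\<^sup>n\<close> is the order of the variance of an increment divided by \<open>\<epsilon>\<^sup>2 = r\<^sup>2\<^sup>n\<close>\<close>
  define q where "q = 1 / (2 * r\<^sup>2)"
  have q: "0 < q" "q < 1" using r by (simp_all add: q_def)
  obtain p where p: "q ^ p < 1 / 2" using real_arch_pow_inv[of "1 / 2" q] q by auto
  define cp :: real where "cp = fact (2 * p) / (2 ^ p * fact p)"
  define B where "B = cp * (K * T) ^ p"
  have cp: "0 < cp" by (simp add: cp_def)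
  have B: "0 \<le> B" using cp K T by (simp add: B_def)
  define c where "c = 1 / (sqrt \<kappa> * T)"
  have c: "0 < c" using \<kappa> T by (simp add: c_def)
  have bound: "flip_prob n a j \<le>
      (if j = 0 then 1 else 0) + c * (2 * r) ^ n * (2 / real (Suc j)) + B / 2 ^ n"
    (is "?E \<le> _") if j: "j < 2 ^ n" for n a j
  proof -
    define s u where "s = dyadic T n j" and "u = dyadic T (Suc n) (Suc (2 * j))"
    have s: "s \<in> {0..T}" and u: "u \<in> {0..T}"
      using dyadic_in[of j n] dyadic_in[of "Suc (2 * j)" "Suc n"] j unfolding s_def u_def by auto
    have us: "u - s = T / 2 ^ Suc n" unfolding s_def u_def using dyadic_diff[of T "Suc n" "2 * j"] by (simp only: dyadic_Suc)
    have rn: "0 < r ^ n" using r by simp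
    have "prob {\<omega> \<in> space P. r ^ n < \<bar>Y u \<omega> - Y s \<omega>\<bar>} \<le> cp * (expectation (\<lambda>\<omega>. (Y u \<omega> - Y s \<omega>)\<^sup>2) / (r ^ n)\<^sup>2) ^ p"
      unfolding cp_def using increment_gaussian[OF s u, of Y] rn by (intro gaussian_tail) auto
    also have "\<dots> \<le> cp * (K * T * q ^ n) ^ p"
    proof -
      have "expectation (\<lambda>\<omega>. (Y u \<omega> - Y s \<omega>)\<^sup>2) \<le> K * T / 2 ^ n"
      proof -
        have "\<bar>u - s\<bar> \<le> T / 2 ^ n" unfolding us using T by (simp add: field_simps)
        then have "K * \<bar>u - s\<bar> \<le> K * (T / 2 ^ n)" using K(1) by (intro mult_left_mono) auto
        then show ?thesis using K(2)[OF s u] by simp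
      qed
      then have "expectation (\<lambda>\<omega>. (Y u \<omega> - Y s \<omega>)\<^sup>2) / (r ^ n)\<^sup>2 \<le> K * T / 2 ^ n / (r ^ n)\<^sup>2"
        by (rule divide_right_mono) simp
      also have "\<dots> = K * T * q ^ n"
        by (simp add: q_def power_divide power_mult_distrib power_mult[symmetric] mult.commute)
      finally show ?thesis using cp by (intro mult_left_mono power_mono) auto
    qed
    also have "\<dots> = B * (q ^ p) ^ n" by (simp add: B_def power_mult_distrib power_mult[symmetric] mult.commute)
    also have "\<dots> \<le> B * (1 / 2) ^ n" using p q B by (intro mult_left_mono power_mono) auto
    finally have b2: "prob {\<omega> \<in> space P. r ^ n < \<bar>Y u \<omega> - Y s \<omega>\<bar>} \<le> B / 2 ^ n" by (simp add: power_divide)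
    show ?thesis
    proof (cases "j = 0")
      case True
      note [measurable] = flip_measurable[OF j]
      have "?E \<le> expectation (\<lambda>\<omega>. 1)"
        by (intro integral_mono flip_integrable[OF j]) (simp_all add: flip_cases)
      then have "?E \<le> 1" by (simp add: prob_space)
      moreover have "0 \<le> c * (2 * r) ^ n * (2 / real (Suc j)) + B / 2 ^ n"
        using c r B by (intro add_nonneg_nonneg mult_nonneg_nonneg) auto
      ultimately show ?thesis using True by simp
    next
      case False
      have s0: "0 < s" using False T by (simp add: s_def dyadic_def)
      have "sqrt \<kappa> * s \<le> sqrt (expectation (\<lambda>\<omega>. (Y s \<omega>)\<^sup>2))"
        using real_sqrt_le_mono[OF \<kappa>(2)[OF s]] s0 by (simp add: real_sqrt_mult)
      then have "prob {\<omega> \<in> space P. \<bar>Y s \<omega> - a\<bar> \<le> r ^ n} * (sqrt \<kappa> * s)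
          \<le> prob {\<omega> \<in> space P. \<bar>Y s \<omega> - a\<bar> \<le> r ^ n} * sqrt (expectation (\<lambda>\<omega>. (Y s \<omega>)\<^sup>2))"
        by (intro mult_left_mono) auto
      also have "\<dots> \<le> r ^ n"
        using gaussian_process_at[OF Y_gauss s] mean_zero[OF s] rn by (intro gaussian_small_ball) auto
      finally have "prob {\<omega> \<in> space P. \<bar>Y s \<omega> - a\<bar> \<le> r ^ n} \<le> r ^ n / (sqrt \<kappa> * s)"
        using \<kappa> s0 by (simp add: pos_le_divide_eq)
      also have "\<dots> = c * (2 * r) ^ n * (1 / real j)"
        by (simp add: c_def s_def dyadic_def power_mult_distrib mult_ac)
      also have "\<dots> \<le> c * (2 * r) ^ n * (2 / real (Suc j))"
        using False c r by (intro mult_left_mono) (auto simp: field_simps)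
      finally show ?thesis
        using expectation_flip_le[OF j rn, of a] b2 False unfolding s_def u_def by simp
    qed
  qed
  define A where "A = 1 + B + 2 * c"
  have "(\<Sum>j<2 ^ n. flip_prob n a j) \<le> A * (real n + 1) * (2 * r) ^ n" for n a
  proof -
    \<comment> \<open>absorbs the contribution 1 of the first interval, where \<open>Y\<close> may start from a constant\<close>
    have "1 / 2 < r"
      using r by (smt (verit, best) mult_left_le power2_eq_square)
    then have r1: "1 \<le> (2 * r) ^ n" by (intro one_le_power) auto
    have "(\<Sum>j<2 ^ n. flip_prob n a j) \<le>
      (\<Sum>j<2 ^ n. (if j = 0 then 1 else 0) + c * (2 * r) ^ n * (2 / real (Suc j)) + B / 2 ^ n)"
      by (intro sum_mono bound) auto
    also have "\<dots> = 1 + 2 * c * (2 * r) ^ n * (\<Sum>j<2 ^ n. 1 / real (Suc j)) + B"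
    proof -
      have "(\<Sum>j<2 ^ n. c * (2 * r) ^ n * (2 / real (Suc j))) = 2 * c * (2 * r) ^ n * (\<Sum>j<2 ^ n. 1 / real (Suc j))"
        unfolding sum_distrib_left by (intro sum.cong) auto
      then show ?thesis by (simp only: sum.distrib) simp
    qed
    also have "\<dots> \<le> 1 * ((real n + 1) * (2 * r) ^ n) + 2 * c * (2 * r) ^ n * (real n + 1) + B * ((real n + 1) * (2 * r) ^ n)"
    proof (intro add_mono)
      have "1 * 1 \<le> (real n + 1) * (2 * r) ^ n" using r1 by (intro mult_mono) auto
      then show "1 \<le> 1 * ((real n + 1) * (2 * r) ^ n)" "B \<le> B * ((real n + 1) * (2 * r) ^ n)"
        using B mult_left_mono[of 1 "(real n + 1) * (2 * r) ^ n" B] by auto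
      show "2 * c * (2 * r) ^ n * (\<Sum>j<2 ^ n. 1 / real (Suc j)) \<le> 2 * c * (2 * r) ^ n * (real n + 1)"
        using c r by (intro mult_left_mono harmonic_dyadic) auto
    qed
    also have "\<dots> = A * (real n + 1) * (2 * r) ^ n" by (simp add: A_def algebra_simps)
    finally show ?thesis .
  qed
  moreover have "0 < A" using B c by (simp add: A_def)
  ultimately show ?thesis by blast
qed

end

text \<open>Young's inequality \<open>\<bar>z\<bar> \<le> \<mu> + z\<^sup>2 / \<mu>\<close>, applied with \<open>\<mu>\<close> of the order of the standard deviation.\<close>

lemma (in prob_space) expectation_abs_le:
  fixes Z :: "'a \<Rightarrow> real"
  assumes [measurable]: "Z \<in> borel_measurable M" and i: "integrable M (\<lambda>\<omega>. (Z \<omega>)\<^sup>2)" and \<mu>: "0 < \<mu>"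
  shows "expectation (\<lambda>\<omega>. \<bar>Z \<omega>\<bar>) \<le> \<mu> + expectation (\<lambda>\<omega>. (Z \<omega>)\<^sup>2) / \<mu>" "integrable M Z"
proof -
  have le: "\<bar>Z \<omega>\<bar> \<le> \<mu> + (Z \<omega>)\<^sup>2 / \<mu>" for \<omega>
  proof (cases "\<bar>Z \<omega>\<bar> \<le> \<mu>")
    case True
    moreover have "0 \<le> (Z \<omega>)\<^sup>2 / \<mu>" using \<mu> by simp
    ultimately show ?thesis by linarith
  next
    case False
    then have "\<mu> * \<bar>Z \<omega>\<bar> \<le> \<bar>Z \<omega>\<bar> * \<bar>Z \<omega>\<bar>" by (intro mult_right_mono) auto
    then have "\<bar>Z \<omega>\<bar> \<le> (Z \<omega>)\<^sup>2 / \<mu>" using \<mu> by (simp add: pos_le_divide_eq power2_eq_square mult.commute)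
    then show ?thesis using \<mu> by simp
  qed
  have ib: "integrable M (\<lambda>\<omega>. \<mu> + (Z \<omega>)\<^sup>2 / \<mu>)" using i by simp
  show iZ: "integrable M Z"
  proof (rule Bochner_Integration.integrable_bound[OF ib])
    have "norm (Z \<omega>) \<le> norm (\<mu> + (Z \<omega>)\<^sup>2 / \<mu>)" for \<omega>
      using le[of \<omega>] by simp
    then show "AE \<omega> in M. norm (Z \<omega>) \<le> norm (\<mu> + (Z \<omega>)\<^sup>2 / \<mu>)" by simp
  qed simp
  have "expectation (\<lambda>\<omega>. \<bar>Z \<omega>\<bar>) \<le> expectation (\<lambda>\<omega>. \<mu> + (Z \<omega>)\<^sup>2 / \<mu>)"
    using iZ ib le by (intro integral_mono) auto
  then show "expectation (\<lambda>\<omega>. \<bar>Z \<omega>\<bar>) \<le> \<mu> + expectation (\<lambda>\<omega>. (Z \<omega>)\<^sup>2) / \<mu>"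
    using i by (simp add: prob_space)
qed

context perturbed_martingale
begin

text \<open>Mixed terms vanish: the sum up to time \<open>l n\<close> times the weight \<open>D n\<close> is known at the beginning of
  the increment that it multiplies.\<close>

lemma martingale_transform_var:
  fixes l r :: "nat \<Rightarrow> real"
  assumes t: "\<And>j. j < N \<Longrightarrow> 0 \<le> l j" "\<And>j. j < N \<Longrightarrow> l j \<le> r j" "\<And>j. j < N \<Longrightarrow> r j \<le> T"
      "\<And>i j. i < j \<Longrightarrow> j < N \<Longrightarrow> r i \<le> l j"
    and D: "\<And>j. j < N \<Longrightarrow> D j \<in> borel_measurable (F (l j))" "\<And>j \<omega>. \<bar>D j \<omega>\<bar> \<le> 1"
  shows "integrable P (\<lambda>\<omega>. (\<Sum>j<N. D j \<omega> * (M (r j) \<omega> - M (l j) \<omega>))\<^sup>2)" (is ?I)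
    and "expectation (\<lambda>\<omega>. (\<Sum>j<N. D j \<omega> * (M (r j) \<omega> - M (l j) \<omega>))\<^sup>2) =
      (\<Sum>j<N. expectation (\<lambda>\<omega>. (D j \<omega> * (M (r j) \<omega> - M (l j) \<omega>))\<^sup>2))" (is ?E)
proof -
  define S where "S n \<omega> = (\<Sum>j<n. D j \<omega> * (M (r j) \<omega> - M (l j) \<omega>))" for n \<omega>
  have F_meas: "D j \<in> borel_measurable (F s)" "M (l j) \<in> borel_measurable (F s)" "M (r j) \<in> borel_measurable (F s)"
    if "j < N" "r j \<le> s" "s \<le> T" for j s
  proof -
    have "l j \<le> s" using t(2)[OF that(1)] that by simp
    then show "D j \<in> borel_measurable (F s)"
      using D(1)[OF that(1)] by (rule measurable_from_subalg[OF subalgebra_natural_filtration_mono])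
    show "M (l j) \<in> borel_measurable (F s)" "M (r j) \<in> borel_measurable (F s)"
      using adapted(1)[of "l j" s] adapted(1)[of "r j" s] t(1,2)[OF that(1)] that \<open>l j \<le> s\<close> by auto
  qed
  have S_meas: "S n \<in> borel_measurable (F s)" if "n \<le> N" "\<And>j. j < n \<Longrightarrow> r j \<le> s" "s \<le> T" for n s
    unfolding S_def[abs_def]
    using that by (intro borel_measurable_sum borel_measurable_times borel_measurable_diff F_meas) auto
  have "integrable P (\<lambda>\<omega>. (S n \<omega>)\<^sup>2) \<and> expectation (\<lambda>\<omega>. (S n \<omega>)\<^sup>2) =
      (\<Sum>j<n. expectation (\<lambda>\<omega>. (D j \<omega> * (M (r j) \<omega> - M (l j) \<omega>))\<^sup>2))" if "n \<le> N" for n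
    using that
  proof (induction n)
    case (Suc n)
    define Z where "Z \<omega> = M (r n) \<omega> - M (l n) \<omega>" for \<omega>
    have n: "n < N" using Suc.prems by simp
    have lr: "l n \<in> {0..T}" "r n \<in> {0..T}" using t(1,2,3)[OF n] by auto
    have F1: "S n \<in> borel_measurable (F (l n))" using S_meas[of n "l n"] t(4)[OF _ n] lr n by auto
    have P1[measurable]: "S n \<in> borel_measurable P" "D n \<in> borel_measurable P"
      using F1 D(1)[OF n] measurable_from_subalg[OF subalg] lr by auto
    have Zm[measurable]: "Z \<in> borel_measurable P"
      unfolding Z_def[abs_def] using meas(1)[OF lr(1)] meas(1)[OF lr(2)] by simp
    have iS: "integrable P (\<lambda>\<omega>. (S n \<omega>)\<^sup>2)" and eS: "expectation (\<lambda>\<omega>. (S n \<omega>)\<^sup>2) =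
      (\<Sum>j<n. expectation (\<lambda>\<omega>. (D j \<omega> * (M (r j) \<omega> - M (l j) \<omega>))\<^sup>2))" using Suc by auto
    have D2: "(D n \<omega>)\<^sup>2 \<le> 1" for \<omega> using D(2)[of n \<omega>] abs_le_square_iff[of "D n \<omega>" 1] by simp
    have iDZ: "integrable P (\<lambda>\<omega>. (D n \<omega> * Z \<omega>)\<^sup>2)"
    proof (rule Bochner_Integration.integrable_bound)
      show "integrable P (\<lambda>\<omega>. (Z \<omega>)\<^sup>2)" unfolding Z_def using integrable_powers(3)[OF lr] .
      have "norm ((D n \<omega> * Z \<omega>)\<^sup>2) \<le> norm ((Z \<omega>)\<^sup>2)" for \<omega>
        using mult_right_mono[OF D2, of "(Z \<omega>)\<^sup>2" \<omega>] by (simp add: power_mult_distrib)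
      then show "AE \<omega> in P. norm ((D n \<omega> * Z \<omega>)\<^sup>2) \<le> norm ((Z \<omega>)\<^sup>2)" by simp
    qed simp
    have "integrable P (\<lambda>\<omega>. (S n \<omega> * D n \<omega>)\<^sup>2)"
    proof (rule Bochner_Integration.integrable_bound[OF iS])
      have "norm ((S n \<omega> * D n \<omega>)\<^sup>2) \<le> norm ((S n \<omega>)\<^sup>2)" for \<omega>
        using mult_left_mono[OF D2, of "(S n \<omega>)\<^sup>2" \<omega>] by (simp add: power_mult_distrib)
      then show "AE \<omega> in P. norm ((S n \<omega> * D n \<omega>)\<^sup>2) \<le> norm ((S n \<omega>)\<^sup>2)" by simp
    qed simp
    moreover have "(\<lambda>\<omega>. S n \<omega> * D n \<omega>) \<in> borel_measurable (F (l n))" using F1 D(1)[OF n] by simp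
    ultimately have c: "integrable P (\<lambda>\<omega>. S n \<omega> * D n \<omega> * Z \<omega>)" "expectation (\<lambda>\<omega>. S n \<omega> * D n \<omega> * Z \<omega>) = 0"
      unfolding Z_def using martingale_orthogonal[of "l n" "r n" "\<lambda>\<omega>. S n \<omega> * D n \<omega>"] t(2)[OF n] lr by auto
    have e: "(S (Suc n) \<omega>)\<^sup>2 = (S n \<omega>)\<^sup>2 + 2 * (S n \<omega> * D n \<omega> * Z \<omega>) + (D n \<omega> * Z \<omega>)\<^sup>2" for \<omega>
      by (simp add: S_def Z_def power2_eq_square algebra_simps)
    show ?case unfolding e using iS eS c iDZ by (simp add: Z_def)
  qed (simp add: S_def)
  from this[of N]
  show ?I ?E
    by (simp_all add: S_def)
qed

definition flip_sum :: "nat \<Rightarrow> nat \<Rightarrow> real \<Rightarrow> 'a \<Rightarrow> real" where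
  "flip_sum n N a \<omega> = (\<Sum>j<N. flip T (path \<omega>) n a j *
     (M (dyadic T (Suc n) (Suc (Suc (2 * j)))) \<omega> - M (dyadic T (Suc n) (Suc (2 * j))) \<omega>))"

text \<open>The square of a flip times an increment \<open>z\<close> of \<open>M\<close> is at most \<open>\<theta> h \<bar>flip\<bar> + z\<^sup>4 / (\<theta> h)\<close> for every
  \<open>\<theta> > 0\<close>, where \<open>h = 2\<^sup>-\<^sup>n\<close>. So the estimate follows from the expected number of flips and the fourth
  moments of the increments; \<open>\<theta>\<close> is optimised later.\<close>

lemma flip_sum_second_moment:
  assumes r: "1 / 2 < r\<^sup>2" "0 < r" "r < 1"
  shows "\<exists>A>0. \<forall>n N a \<theta>. 0 < \<theta> \<longrightarrow> N \<le> 2 ^ n \<longrightarrow>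
     integrable P (\<lambda>\<omega>. (flip_sum n N a \<omega>)\<^sup>2) \<and>
     expectation (\<lambda>\<omega>. (flip_sum n N a \<omega>)\<^sup>2) \<le> A * (\<theta> * (real n + 1) * r ^ n + 1 / \<theta>)"
proof -
  obtain A where A: "0 < A" "\<And>n a. (\<Sum>j<2 ^ n. flip_prob n a j) \<le> A * (real n + 1) * (2 * r) ^ n"
    using expected_flips[OF r] by blast
  obtain K where K: "0 < K" "\<And>s u. s \<in> {0..T} \<Longrightarrow> u \<in> {0..T} \<Longrightarrow> expectation (\<lambda>\<omega>. (M u \<omega> - M s \<omega>)\<^sup>2) \<le> K * \<bar>u - s\<bar>"
    using increment_var by blast
  \<comment> \<open>the fourth moment of an increment of variance at most \<open>K T h\<close> contributes \<open>3 (K T h)\<^sup>2\<close>\<close>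
  define A' where "A' = A + 3 * (K * T)\<^sup>2"
  have A': "0 < A'" using A by (simp add: A'_def add_pos_nonneg)
  have "integrable P (\<lambda>\<omega>. (flip_sum n N a \<omega>)\<^sup>2) \<and>
     expectation (\<lambda>\<omega>. (flip_sum n N a \<omega>)\<^sup>2) \<le> A' * (\<theta> * (real n + 1) * r ^ n + 1 / \<theta>)"
    if \<theta>: "0 < \<theta>" and N: "N \<le> 2 ^ n" for n N a \<theta>
  proof -
    define l rr where "l j = dyadic T (Suc n) (Suc (2 * j))" and "rr j = dyadic T (Suc n) (Suc (Suc (2 * j)))" for j
    define D where "D j \<omega> = flip T (path \<omega>) n a j" for j \<omega>
    let ?dM = "\<lambda>j \<omega>. M (rr j) \<omega> - M (l j) \<omega>"
    have lr: "l j \<in> {0..T}" "rr j \<in> {0..T}" "dyadic T n j \<in> {0..T}" "l j \<le> rr j" "dyadic T n j \<le> l j" if "j < N" for j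
      using that N T dyadic_in[of j n] dyadic_in[of "Suc (2 * j)" "Suc n"] dyadic_in[of "Suc (Suc (2 * j))" "Suc n"]
        dyadic_mono[OF T, of "Suc (2 * j)" "Suc (Suc (2 * j))" "Suc n"] dyadic_mono[OF T, of "2 * j" "Suc (2 * j)" "Suc n"]
      by (auto simp: l_def rr_def dyadic_Suc)
    have rl: "rr i \<le> l j" if "i < j" for i j
      unfolding l_def rr_def using that by (intro dyadic_mono T) auto
    have Dm: "D j \<in> borel_measurable (F (l j))" if "j < N" for j
    proof -
      have [measurable]: "Y (l j) \<in> borel_measurable (F (l j))" "Y (dyadic T n j) \<in> borel_measurable (F (l j))"
        using adapted(2) lr[OF that] by auto
      show ?thesis unfolding D_def[abs_def] flip_def l_def[symmetric] by simp
    qed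
    have D1: "\<bar>D j \<omega>\<bar> \<le> 1" for j \<omega> by (simp add: D_def flip_cases)
    have tv: "integrable P (\<lambda>\<omega>. (flip_sum n N a \<omega>)\<^sup>2)"
      "expectation (\<lambda>\<omega>. (flip_sum n N a \<omega>)\<^sup>2) = (\<Sum>j<N. expectation (\<lambda>\<omega>. (D j \<omega> * ?dM j \<omega>)\<^sup>2))"
      using martingale_transform_var[of N l rr D, OF _ _ _ rl Dm D1] lr
      unfolding flip_sum_def D_def l_def rr_def by auto
    define h :: real where "h = 1 / 2 ^ n"
    have h: "0 < h" by (simp add: h_def)
    have "expectation (\<lambda>\<omega>. (D j \<omega> * ?dM j \<omega>)\<^sup>2) \<le>
        \<theta> * h * expectation (\<lambda>\<omega>. \<bar>D j \<omega>\<bar>) + 3 * (K * T)\<^sup>2 * h / \<theta>" if j: "j < N" for j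
    proof -
      have jn: "j < 2 ^ n" using j N by simp
      note g = increment_gaussian[OF lr(1)[OF j] lr(2)[OF j], of M]
      have i: "integrable P (\<lambda>\<omega>. ?dM j \<omega> ^ k)" for k
        using integrable_powers(3)[OF lr(1)[OF j] lr(2)[OF j]] .
      have iD: "integrable P (\<lambda>\<omega>. \<bar>D j \<omega>\<bar>)" unfolding D_def using flip_integrable[OF jn] .
      have [measurable]: "D j \<in> borel_measurable P" unfolding D_def[abs_def] using flip_measurable[OF jn] .
      have var: "expectation (\<lambda>\<omega>. (?dM j \<omega>)\<^sup>2) \<le> K * T * h"
      proof -
        have "rr j - l j = T / 2 ^ Suc n" unfolding rr_def l_def by (rule dyadic_diff)
        moreover have "\<bar>T / 2 ^ Suc n\<bar> \<le> T * h" using T by (simp add: h_def field_simps)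
        ultimately have "\<bar>rr j - l j\<bar> \<le> T * h" by (simp only:)
        then have "K * \<bar>rr j - l j\<bar> \<le> K * (T * h)" using K(1) by (intro mult_left_mono) auto
        then show ?thesis using K(2)[OF lr(1)[OF j] lr(2)[OF j]] by simp
      qed
      have four: "expectation (\<lambda>\<omega>. ?dM j \<omega> ^ 4) \<le> 3 * (K * T * h)\<^sup>2"
        unfolding gaussian_fourth_moment[OF g, simplified] using var
        by (intro mult_left_mono power_mono) auto
      have le: "(D j \<omega> * z)\<^sup>2 \<le> \<theta> * h * \<bar>D j \<omega>\<bar> + z ^ 4 / (\<theta> * h)" for \<omega> z
      proof (cases "D j \<omega> = 0")
        case True
        then show ?thesis using \<theta> h by simp
      next
        case False
        then have 1: "\<bar>D j \<omega>\<bar> = 1" "(D j \<omega>)\<^sup>2 = 1" by (auto simp: D_def flip_def split: if_splits)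
        show ?thesis
        proof (cases "z\<^sup>2 \<le> \<theta> * h")
          case True
          have "0 \<le> z ^ 4 / (\<theta> * h)" using \<theta> h by simp
          then show ?thesis using True 1 by (simp add: power_mult_distrib)
        next
          case False
          then have "z\<^sup>2 * (\<theta> * h) \<le> z\<^sup>2 * z\<^sup>2" by (intro mult_left_mono) auto
          then have "z\<^sup>2 \<le> z ^ 4 / (\<theta> * h)" using \<theta> h by (simp add: pos_le_divide_eq power2_eq_square power4_eq_xxxx mult.assoc)
          moreover have "0 \<le> \<theta> * h" using \<theta> h by simp
          ultimately show ?thesis using 1 by (simp add: power_mult_distrib)
        qed
      qed
      have "expectation (\<lambda>\<omega>. (D j \<omega> * ?dM j \<omega>)\<^sup>2) \<le>
          expectation (\<lambda>\<omega>. \<theta> * h * \<bar>D j \<omega>\<bar> + ?dM j \<omega> ^ 4 / (\<theta> * h))"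
      proof (rule integral_mono')
        show "integrable P (\<lambda>\<omega>. \<theta> * h * \<bar>D j \<omega>\<bar> + ?dM j \<omega> ^ 4 / (\<theta> * h))"
          using i[of 4] iD by simp
        show "0 \<le> \<theta> * h * \<bar>D j \<omega>\<bar> + ?dM j \<omega> ^ 4 / (\<theta> * h)" for \<omega>
          using \<theta> h by simp
      qed (rule le)
      also have "\<dots> = \<theta> * h * expectation (\<lambda>\<omega>. \<bar>D j \<omega>\<bar>) + expectation (\<lambda>\<omega>. ?dM j \<omega> ^ 4) / (\<theta> * h)"
        using i[of 4] iD by simp
      also have "\<dots> \<le> \<theta> * h * expectation (\<lambda>\<omega>. \<bar>D j \<omega>\<bar>) + 3 * (K * T * h)\<^sup>2 / (\<theta> * h)"
        using four \<theta> h by (intro add_left_mono divide_right_mono) auto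
      also have "3 * (K * T * h)\<^sup>2 / (\<theta> * h) = 3 * (K * T)\<^sup>2 * h / \<theta>"
        using \<theta> h by (simp add: power2_eq_square)
      finally show ?thesis .
    qed
    then have "expectation (\<lambda>\<omega>. (flip_sum n N a \<omega>)\<^sup>2) \<le>
        (\<Sum>j<N. \<theta> * h * expectation (\<lambda>\<omega>. \<bar>D j \<omega>\<bar>) + 3 * (K * T)\<^sup>2 * h / \<theta>)"
      unfolding tv(2) by (intro sum_mono) auto
    also have "\<dots> \<le> (\<Sum>j<2 ^ n. \<theta> * h * expectation (\<lambda>\<omega>. \<bar>D j \<omega>\<bar>) + 3 * (K * T)\<^sup>2 * h / \<theta>)"
      using N \<theta> h by (intro sum_mono2) auto
    also have "\<dots> = \<theta> * h * (\<Sum>j<2 ^ n. expectation (\<lambda>\<omega>. \<bar>D j \<omega>\<bar>)) + 3 * (K * T)\<^sup>2 / \<theta>"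
      by (simp add: sum.distrib sum_distrib_left h_def)
    also have "\<dots> \<le> \<theta> * h * (A * (real n + 1) * (2 * r) ^ n) + 3 * (K * T)\<^sup>2 / \<theta>"
      using A(2)[of n a] \<theta> h unfolding D_def by (intro add_right_mono mult_left_mono) auto
    also have "\<dots> = A * (\<theta> * (real n + 1) * r ^ n) + 3 * (K * T)\<^sup>2 * (1 / \<theta>)"
      by (simp add: h_def power_mult_distrib)
    also have "\<dots> \<le> A' * (\<theta> * (real n + 1) * r ^ n) + A' * (1 / \<theta>)"
      using A \<theta> r by (intro add_mono mult_right_mono) (auto simp: A'_def)
    finally show ?thesis using tv(1) by (simp add: distrib_left)
  qed
  then show ?thesis using A' by blast
qed

end

section \<open>Quadratic variation\<close>

lemma (in perturbed_martingale) increments_orthogonal: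
  assumes t: "0 \<le> s" "s \<le> u" "u \<le> v" "v \<le> w" "w \<le> T"
  shows "integrable P (\<lambda>\<omega>. ((M u \<omega> - M s \<omega>)\<^sup>2 - (m u - m s)) * ((M w \<omega> - M v \<omega>)\<^sup>2 - (m w - m v)))" (is ?I)
    "expectation (\<lambda>\<omega>. ((M u \<omega> - M s \<omega>)\<^sup>2 - (m u - m s)) * ((M w \<omega> - M v \<omega>)\<^sup>2 - (m w - m v))) = 0" (is ?E)
proof -
  define A B where "A \<omega> = M u \<omega> - M s \<omega>" and "B \<omega> = M w \<omega> - M v \<omega>" for \<omega>
  have i: "s \<in> {0..T}" "u \<in> {0..T}" "v \<in> {0..T}" "w \<in> {0..T}" using t by auto
  have A: "A \<in> borel_measurable (F v)" unfolding A_def[abs_def] using adapted(1)[of s v] adapted(1)[of u v] t by auto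
  have iA: "integrable P (\<lambda>\<omega>. A \<omega> ^ k)" and iB: "integrable P (\<lambda>\<omega>. B \<omega> ^ k)" for k
    unfolding A_def B_def using integrable_powers(3)[OF i(1,2)] integrable_powers(3)[OF i(3,4)] by auto
  have eA: "expectation (\<lambda>\<omega>. (A \<omega>)\<^sup>2) = m u - m s" and eB: "expectation (\<lambda>\<omega>. (B \<omega>)\<^sup>2) = m w - m v"
    unfolding A_def B_def using M_increment_var[of s u] M_increment_var[of v w] t by auto
  have g: "gaussian_rv P (\<lambda>\<omega>. a * A \<omega> + b * B \<omega>)" for a b
    unfolding A_def B_def by (rule gaussian_process_increments[OF M_gauss i])
  have mean: "expectation A = 0" "expectation B = 0"
    using increment_gaussian(2)[OF i(1,2), of M] increment_gaussian(2)[OF i(3,4), of M]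
    unfolding A_def[abs_def] B_def[abs_def] by auto
  have int: "integrable P A" "integrable P B" using iA[of 1] iB[of 1] by auto
  have AB: "expectation (\<lambda>\<omega>. A \<omega> * B \<omega>) = 0"
    unfolding B_def using martingale_orthogonal(2)[OF _ _ _ A iA] t by auto
  note us = uncorrelated_squares[OF g mean int AB]
  have e: "((A \<omega>)\<^sup>2 - (m u - m s)) * ((B \<omega>)\<^sup>2 - (m w - m v)) = (A \<omega>)\<^sup>2 * (B \<omega>)\<^sup>2
      - (m u - m s) * (B \<omega>)\<^sup>2 - (m w - m v) * (A \<omega>)\<^sup>2 + (m u - m s) * (m w - m v)" for \<omega>
    by (simp add: algebra_simps)
  have "integrable P (\<lambda>\<omega>. ((A \<omega>)\<^sup>2 - (m u - m s)) * ((B \<omega>)\<^sup>2 - (m w - m v)))"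
    unfolding e using us(1) iA[of 2] iB[of 2] by simp
  moreover have "expectation (\<lambda>\<omega>. ((A \<omega>)\<^sup>2 - (m u - m s)) * ((B \<omega>)\<^sup>2 - (m w - m v))) = 0"
    unfolding e using us(1) iA[of 2] iB[of 2] by (simp add: us(2) eA eB prob_space)
  ultimately show ?I ?E
    by (simp_all add: A_def B_def)
qed

lemma (in perturbed_martingale) M_compensated_square:
  assumes t: "0 \<le> s" "s \<le> u" "u \<le> T"
  shows "integrable P (\<lambda>\<omega>. ((M u \<omega> - M s \<omega>)\<^sup>2 - (m u - m s))\<^sup>2)"
    "expectation (\<lambda>\<omega>. ((M u \<omega> - M s \<omega>)\<^sup>2 - (m u - m s))\<^sup>2) = 2 * (m u - m s)\<^sup>2"
proof -
  have i: "s \<in> {0..T}" "u \<in> {0..T}" using t by auto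
  have e: "((M u \<omega> - M s \<omega>)\<^sup>2 - (m u - m s))\<^sup>2 = (M u \<omega> - M s \<omega>) ^ 4
     - 2 * (m u - m s) * (M u \<omega> - M s \<omega>)\<^sup>2 + (m u - m s)\<^sup>2" for \<omega>
    by (simp add: power2_eq_square power4_eq_xxxx algebra_simps)
  note j = integrable_powers(3)[OF i]
  show "integrable P (\<lambda>\<omega>. ((M u \<omega> - M s \<omega>)\<^sup>2 - (m u - m s))\<^sup>2)"
    unfolding e using j by simp
  have four: "expectation (\<lambda>\<omega>. (M u \<omega> - M s \<omega>) ^ 4) = 3 * (m u - m s)\<^sup>2"
    using gaussian_fourth_moment[OF increment_gaussian[OF i, of M]] M_increment_var[OF t] by simp
  show "expectation (\<lambda>\<omega>. ((M u \<omega> - M s \<omega>)\<^sup>2 - (m u - m s))\<^sup>2) = 2 * (m u - m s)\<^sup>2"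
  proof -
    have "expectation (\<lambda>\<omega>. ((M u \<omega> - M s \<omega>)\<^sup>2 - (m u - m s))\<^sup>2) =
        3 * (m u - m s)\<^sup>2 - 2 * (m u - m s) * (m u - m s) + (m u - m s)\<^sup>2"
      unfolding e using j by (simp add: prob_space four M_increment_var[OF t])
    then show ?thesis by (simp add: power2_eq_square)
  qed
qed

text \<open>The compensated squared increments are orthogonal, so the second moment of their sum is of order
  \<open>2\<^sup>n 4\<^sup>-\<^sup>n\<close>. It is summable, which gives almost sure convergence along the full dyadic sequence.\<close>

lemma (in perturbed_martingale) M_quadratic_variation:
  assumes t: "t \<in> {0..T}"
  shows "AE \<omega> in P. (\<lambda>n. \<Sum>j<steps T t n. (M (dyadic T n (Suc j)) \<omega> - M (dyadic T n j) \<omega>)\<^sup>2) \<longlonglongrightarrow> m t - m 0"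
proof -
  obtain K where K: "0 < K" "\<And>s u. s \<in> {0..T} \<Longrightarrow> u \<in> {0..T} \<Longrightarrow> \<bar>m u - m s\<bar> \<le> K * \<bar>u - s\<bar>"
    using m_lip by blast
  have d: "dyadic T n j \<in> {0..T}" if "j \<le> steps T t n" for n j
    using dyadic_in[of j n] steps_le[of T t n] T t that by auto
  define Z where "Z n j \<omega> = (M (dyadic T n (Suc j)) \<omega> - M (dyadic T n j) \<omega>)\<^sup>2 - (m (dyadic T n (Suc j)) - m (dyadic T n j))" for n j \<omega>
  have Zm: "Z n j \<in> borel_measurable P" if "j < steps T t n" for n j
    unfolding Z_def[abs_def] using meas(1)[OF d, of "Suc j" n] meas(1)[OF d, of j n] that by simp
  have "integrable P (\<lambda>\<omega>. (\<Sum>j<steps T t n. Z n j \<omega>)\<^sup>2) \<and>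
    expectation (\<lambda>\<omega>. (\<Sum>j<steps T t n. Z n j \<omega>)\<^sup>2) \<le> 2 * (K * T)\<^sup>2 * (1 / 2) ^ n" for n
  proof -
    define N where "N = steps T t n"
    have sq: "(\<Sum>j<N. Z n j \<omega>)\<^sup>2 = (\<Sum>i<N. \<Sum>j<N. Z n i \<omega> * Z n j \<omega>)" for \<omega>
      by (simp add: power2_eq_square sum_product)
    have off: "integrable P (\<lambda>\<omega>. Z n i \<omega> * Z n j \<omega>) \<and> expectation (\<lambda>\<omega>. Z n i \<omega> * Z n j \<omega>) = 0"
      if "i < j" "j < N" for i j
      unfolding Z_def using d[of i n] d[of "Suc i" n] d[of j n] d[of "Suc j" n] that T
      by (intro conjI increments_orthogonal dyadic_mono) (auto simp: N_def)
    have diag: "integrable P (\<lambda>\<omega>. Z n j \<omega> * Z n j \<omega>)" "expectation (\<lambda>\<omega>. Z n j \<omega> * Z n j \<omega>) \<le> 2 * (K * (T / 2 ^ n))\<^sup>2" if "j < N" for j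
    proof -
      have dj: "dyadic T n j \<in> {0..T}" "dyadic T n (Suc j) \<in> {0..T}" using d that by (auto simp: N_def)
      have le: "dyadic T n j \<le> dyadic T n (Suc j)" using dyadic_mono[OF T] by simp
      note c = M_compensated_square[of "dyadic T n j" "dyadic T n (Suc j)"]
      show "integrable P (\<lambda>\<omega>. Z n j \<omega> * Z n j \<omega>)"
        unfolding Z_def power2_eq_square[symmetric] using c(1) dj le by auto
      have "\<bar>m (dyadic T n (Suc j)) - m (dyadic T n j)\<bar> \<le> K * (T / 2 ^ n)"
        using K(2)[OF dj] T unfolding dyadic_diff by simp
      then have "(m (dyadic T n (Suc j)) - m (dyadic T n j))\<^sup>2 \<le> (K * (T / 2 ^ n))\<^sup>2"
        by (rule abs_le_square_iff[THEN iffD1, OF order_trans]) (rule abs_ge_self)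
      then show "expectation (\<lambda>\<omega>. Z n j \<omega> * Z n j \<omega>) \<le> 2 * (K * (T / 2 ^ n))\<^sup>2"
        unfolding Z_def power2_eq_square[symmetric] using c(2) dj le by auto
    qed
    have ij: "integrable P (\<lambda>\<omega>. Z n i \<omega> * Z n j \<omega>)" (is ?I) "expectation (\<lambda>\<omega>. Z n i \<omega> * Z n j \<omega>) \<le> (if i = j then 2 * (K * (T / 2 ^ n))\<^sup>2 else 0)" (is ?E)
      if "i < N" "j < N" for i j
    proof -
      have "?I \<and> ?E"
      proof (cases i j rule: linorder_cases)
        case less then show ?thesis using off[of i j] that by simp
      next
        case equal then show ?thesis using diag[of i] that by simp
      next
        case greater then show ?thesis using off[of j i] that by (simp add: mult.commute)
      qed
      then show ?I ?E by auto
    qed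
    have int: "integrable P (\<lambda>\<omega>. (\<Sum>j<N. Z n j \<omega>)\<^sup>2)" unfolding sq using ij(1) by (intro Bochner_Integration.integrable_sum) auto
    have "expectation (\<lambda>\<omega>. (\<Sum>j<N. Z n j \<omega>)\<^sup>2) = (\<Sum>i<N. \<Sum>j<N. expectation (\<lambda>\<omega>. Z n i \<omega> * Z n j \<omega>))"
      unfolding sq using ij(1)
      by (subst Bochner_Integration.integral_sum)
         (auto intro!: Bochner_Integration.integrable_sum sum.cong Bochner_Integration.integral_sum)
    also have "\<dots> \<le> (\<Sum>i<N. \<Sum>j<N. if i = j then 2 * (K * (T / 2 ^ n))\<^sup>2 else 0)"
      using ij(2) by (intro sum_mono) auto
    also have "\<dots> = real N * (2 * (K * (T / 2 ^ n))\<^sup>2)" by simp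
    also have "\<dots> \<le> 2 ^ n * (2 * (K * (T / 2 ^ n))\<^sup>2)"
    proof (rule mult_right_mono)
      have "real N \<le> real (2 ^ n)" unfolding of_nat_le_iff N_def using steps_le T t by auto
      then show "real N \<le> 2 ^ n" by simp
    qed simp
    also have "\<dots> = 2 * (K * T)\<^sup>2 * (1 / 2) ^ n" by (simp add: power2_eq_square power_divide)
    finally show ?thesis using int by (simp add: N_def)
  qed
  note Z2 = this
  have "AE \<omega> in P. summable (\<lambda>n. (\<Sum>j<steps T t n. Z n j \<omega>)\<^sup>2)"
  proof (rule AE_summable_if_integrals_summable[where b = "\<lambda>n. 2 * (K * T)\<^sup>2 * (1 / 2) ^ n"])
    show "(\<lambda>\<omega>. (\<Sum>j<steps T t n. Z n j \<omega>)\<^sup>2) \<in> borel_measurable P" for n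
      using Zm by (intro borel_measurable_power borel_measurable_sum) auto
    show "(\<integral>\<^sup>+\<omega>. ennreal ((\<Sum>j<steps T t n. Z n j \<omega>)\<^sup>2) \<partial>P) \<le> ennreal (2 * (K * T)\<^sup>2 * (1 / 2) ^ n)" for n
      using Z2[of n] by (subst nn_integral_eq_integral) (auto intro: ennreal_leI)
    show "summable (\<lambda>n. 2 * (K * T)\<^sup>2 * (1 / 2) ^ n)"
      by (intro summable_mult summable_geometric) simp
  qed auto
  then show ?thesis
  proof eventually_elim
    case (elim \<omega>)
    have "(\<lambda>n. \<Sum>j<steps T t n. Z n j \<omega>) \<longlonglongrightarrow> 0"
      using summable_LIMSEQ_zero[OF elim] by simp
    moreover have "(\<lambda>n. m (dyadic T n (steps T t n))) \<longlonglongrightarrow> m t"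
    proof (rule LIM_zero_cancel, rule Lim_null_comparison)
      show "\<forall>\<^sub>F n in sequentially. norm (m (dyadic T n (steps T t n)) - m t) \<le> K * \<bar>dyadic T n (steps T t n) - t\<bar>"
        using K(2)[OF t d] by (intro always_eventually) auto
      show "(\<lambda>n. K * \<bar>dyadic T n (steps T t n) - t\<bar>) \<longlonglongrightarrow> 0"
        using dyadic_steps_tendsto[OF T, of t] t by (intro tendsto_mult_right_zero tendsto_rabs_zero LIM_zero) auto
    qed
    ultimately have "(\<lambda>n. (\<Sum>j<steps T t n. Z n j \<omega>) + (m (dyadic T n (steps T t n)) - m 0)) \<longlonglongrightarrow> 0 + (m t - m 0)"
      by (intro tendsto_intros)
    moreover have "(\<Sum>j<steps T t n. Z n j \<omega>) + (m (dyadic T n (steps T t n)) - m 0) =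
        (\<Sum>j<steps T t n. (M (dyadic T n (Suc j)) \<omega> - M (dyadic T n j) \<omega>)\<^sup>2)" for n
      using sum_lessThan_telescope[of "\<lambda>j. m (dyadic T n j)" "steps T t n"] by (simp add: Z_def sum_subtractf)
    ultimately show ?case by simp
  qed
qed

context perturbed_martingale
begin

abbreviation dX :: "nat \<Rightarrow> nat \<Rightarrow> 'a \<Rightarrow> real" where
  "dX n j \<omega> \<equiv> X (dyadic T n (Suc j)) \<omega> - X (dyadic T n j) \<omega>"

lemma X_holder_path:
  "AE \<omega> in P. \<exists>C\<ge>0. \<forall>n. \<forall>j<2 ^ n. \<bar>dX n j \<omega>\<bar> \<le> C * (2 powr - \<alpha>) ^ n"
proof -
  obtain C where "C \<in> borel_measurable P" and
    h: "AE \<omega> in P. \<forall>s\<in>{0..T}. \<forall>t\<in>{0..T}. \<bar>X t \<omega> - X s \<omega>\<bar> \<le> C \<omega> * \<bar>t - s\<bar> powr \<alpha>"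
    using X_holder by (auto simp: holder_process_def)
  have e: "(T / 2 ^ n) powr \<alpha> = T powr \<alpha> * (2 powr - \<alpha>) ^ n" for n :: nat
  proof -
    have "(2 ^ n) powr \<alpha> = ((2::real) powr \<alpha>) ^ n"
      by (simp add: powr_realpow[symmetric] powr_powr mult.commute)
    moreover have "(2 powr - \<alpha>) ^ n = 1 / ((2::real) powr \<alpha>) ^ n"
      by (simp add: powr_minus_divide power_one_over)
    ultimately show ?thesis using powr_divide[of T "2 ^ n" \<alpha>] T by simp
  qed
  from h show ?thesis
  proof eventually_elim
    case (elim \<omega>)
    show ?case
    proof (intro exI[of _ "\<bar>C \<omega>\<bar> * T powr \<alpha>"] conjI allI impI)
      fix n j :: nat assume j: "j < 2 ^ n"
      have "\<bar>dX n j \<omega>\<bar> \<le> C \<omega> * \<bar>dyadic T n (Suc j) - dyadic T n j\<bar> powr \<alpha>"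
        using elim dyadic_in[of j n] dyadic_in[of "Suc j" n] j by simp
      also have "\<dots> = C \<omega> * (T powr \<alpha> * (2 powr - \<alpha>) ^ n)" unfolding dyadic_diff using T e[of n] by simp
      also have "\<dots> \<le> \<bar>C \<omega>\<bar> * (T powr \<alpha> * (2 powr - \<alpha>) ^ n)" by (intro mult_right_mono) auto
      finally show "\<bar>dX n j \<omega>\<bar> \<le> \<bar>C \<omega>\<bar> * T powr \<alpha> * (2 powr - \<alpha>) ^ n"
        by simp
    qed simp
  qed
qed

text \<open>The sum of \<open>(\<Delta>X)\<^sup>2\<close> is of order \<open>2\<^sup>n 2 powr (- 2 n \<alpha>)\<close> and hence vanishes; the mixed sum vanishes by
  the Cauchy-Schwarz inequality.\<close>

lemma Y_quadratic_variation:
  assumes t: "t \<in> {0..T}"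
  shows "AE \<omega> in P. (\<lambda>n. \<Sum>j<steps T t n. (Y (dyadic T n (Suc j)) \<omega> - Y (dyadic T n j) \<omega>)\<^sup>2) \<longlonglongrightarrow> m t - m 0"
  using M_quadratic_variation[OF t] X_holder_path
proof eventually_elim
  case (elim \<omega>)
  obtain C where C: "0 \<le> C" "\<And>n j. j < 2 ^ n \<Longrightarrow> \<bar>dX n j \<omega>\<bar> \<le> C * (2 powr - \<alpha>) ^ n"
    using elim(2) by blast
  define x y where "x n j = dX n j \<omega>"
    and "y n j = M (dyadic T n (Suc j)) \<omega> - M (dyadic T n j) \<omega>" for n j
  define N where "N n = steps T t n" for n
  have N: "N n \<le> 2 ^ n" for n using steps_le T t by (auto simp: N_def)
  define \<theta> :: real where "\<theta> = 2 * (2 powr - \<alpha>)\<^sup>2"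
  have "\<theta> = 2 powr (1 - 2 * \<alpha>)"
    by (simp add: \<theta>_def power2_eq_square powr_add[symmetric] powr_mult_base)
  then have \<theta>: "0 < \<theta>" "\<theta> < 1" using \<alpha> by (auto simp: powr_less_one)
  have xx: "(\<lambda>n. \<Sum>j<N n. (x n j)\<^sup>2) \<longlonglongrightarrow> 0"
  proof (rule Lim_null_comparison)
    have "norm (\<Sum>j<N n. (x n j)\<^sup>2) \<le> C\<^sup>2 * \<theta> ^ n" for n
    proof -
      have "(\<Sum>j<N n. (x n j)\<^sup>2) \<le> (\<Sum>j<N n. (C * (2 powr - \<alpha>) ^ n)\<^sup>2)"
      proof (rule sum_mono)
        fix j assume "j \<in> {..<N n}"
        then have "\<bar>x n j\<bar> \<le> C * (2 powr - \<alpha>) ^ n" using C(2)[of j n] N[of n] by (simp add: x_def)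
        from power_mono[OF this, of 2] show "(x n j)\<^sup>2 \<le> (C * (2 powr - \<alpha>) ^ n)\<^sup>2" by simp
      qed
      also have "\<dots> = real (N n) * (C * (2 powr - \<alpha>) ^ n)\<^sup>2" by simp
      also have "\<dots> \<le> 2 ^ n * (C * (2 powr - \<alpha>) ^ n)\<^sup>2"
      proof (rule mult_right_mono)
        have "real (N n) \<le> real (2 ^ n)" unfolding of_nat_le_iff by (rule N)
        then show "real (N n) \<le> 2 ^ n" by simp
      qed simp
      also have "\<dots> = C\<^sup>2 * \<theta> ^ n"
        by (simp add: \<theta>_def power_mult_distrib power_mult[symmetric] mult.commute mult.left_commute)
      finally show ?thesis by (simp add: sum_nonneg)
    qed
    then show "\<forall>\<^sub>F n in sequentially. norm (\<Sum>j<N n. (x n j)\<^sup>2) \<le> C\<^sup>2 * \<theta> ^ n" by simp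
    show "(\<lambda>n. C\<^sup>2 * \<theta> ^ n) \<longlonglongrightarrow> 0"
      using \<theta> by (intro tendsto_mult_right_zero LIMSEQ_realpow_zero) auto
  qed
  have yy: "(\<lambda>n. \<Sum>j<N n. (y n j)\<^sup>2) \<longlonglongrightarrow> m t - m 0" using elim(1) by (simp add: N_def y_def)
  have xy: "(\<lambda>n. \<Sum>j<N n. y n j * x n j) \<longlonglongrightarrow> 0"
  proof -
    have "(\<lambda>n. (\<Sum>j<N n. y n j * x n j)\<^sup>2) \<longlonglongrightarrow> 0"
    proof (rule Lim_null_comparison)
      show "\<forall>\<^sub>F n in sequentially. norm ((\<Sum>j<N n. y n j * x n j)\<^sup>2) \<le> (\<Sum>j<N n. (y n j)\<^sup>2) * (\<Sum>j<N n. (x n j)\<^sup>2)"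
        by (intro always_eventually allI) (simp add: Cauchy_Schwarz_ineq_sum)
      show "(\<lambda>n. (\<Sum>j<N n. (y n j)\<^sup>2) * (\<Sum>j<N n. (x n j)\<^sup>2)) \<longlonglongrightarrow> 0"
        using tendsto_mult[OF yy xx] by simp
    qed
    then show ?thesis by simp
  qed
  have "(\<lambda>n. (\<Sum>j<N n. (y n j)\<^sup>2) + 2 * (\<Sum>j<N n. y n j * x n j) + (\<Sum>j<N n. (x n j)\<^sup>2)) \<longlonglongrightarrow> m t - m 0 + 2 * 0 + 0"
    by (intro tendsto_intros xx yy xy)
  moreover have "(Y (dyadic T n (Suc j)) \<omega> - Y (dyadic T n j) \<omega>)\<^sup>2 = (y n j)\<^sup>2 + 2 * (y n j * x n j) + (x n j)\<^sup>2" for n j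
    by (simp add: Y_def x_def y_def power2_eq_square algebra_simps)
  ultimately show ?case by (simp add: N_def sum.distrib sum_distrib_left)
qed

section \<open>Convergence of the discrete local times\<close>

text \<open>A bound, up to a random factor that does not depend on \<open>n\<close> and \<open>a\<close>, for the change of the discrete
  local time from level \<open>n\<close> to level \<open>n + 1\<close>. In the last term the increments of \<open>X\<close> are already
  replaced by their Hoelder bound without its random constant, which makes the term integrable.\<close>

definition lt_step :: "real \<Rightarrow> nat \<Rightarrow> real \<Rightarrow> 'a \<Rightarrow> real" where
  "lt_step t n a \<omega> = \<bar>Y (dyadic T (Suc n) (steps T t (Suc n))) \<omega> - Y (dyadic T n (steps T t n)) \<omega>\<bar>
     + \<bar>flip_sum n (steps T t n) a \<omega>\<bar> + (2 powr - \<alpha>) ^ n * (\<Sum>j<2 ^ n. \<bar>flip T (path \<omega>) n a j\<bar>)"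

lemma lt_step_nonneg: "0 \<le> lt_step t n a \<omega>"
  by (simp add: lt_step_def sum_nonneg)

text \<open>The increments of \<open>Y\<close> in \<open>disc_lt_diff\<close> are split into those of \<open>M\<close>, whose signs matter, and those
  of \<open>X\<close>, which are estimated absolutely.\<close>

lemma disc_lt_step:
  assumes t: "t \<in> {0..T}"
    and C: "0 \<le> C" "\<And>n j. j < 2 ^ n \<Longrightarrow> \<bar>dX n j \<omega>\<bar> \<le> C * (2 powr - \<alpha>) ^ n"
  shows "\<bar>disc_lt T (path \<omega>) t (Suc n) a - disc_lt T (path \<omega>) t n a\<bar> \<le> 2 * (1 + C) * lt_step t n a \<omega>"
proof -
  define N where "N = steps T t n"
  have N: "N \<le> 2 ^ n" using steps_le T t by (auto simp: N_def)
  define x where "x j = X (dyadic T (Suc n) (Suc (Suc (2 * j)))) \<omega> - X (dyadic T (Suc n) (Suc (2 * j))) \<omega>" for j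
  define q where "q = (2::real) powr - \<alpha>"
  have q: "0 < q" "q \<le> 1" using \<alpha> powr_mono[of "-\<alpha>" 0 2] by (auto simp: q_def)
  define fl where "fl j = flip T (path \<omega>) n a j" for j
  have x: "\<bar>x j\<bar> \<le> C * q ^ n" if "j < N" for j
  proof -
    have "\<bar>x j\<bar> \<le> C * q ^ Suc n" unfolding x_def q_def using that N by (intro C(2)) auto
    also have "\<dots> \<le> C * q ^ n" using C q by (intro mult_left_mono power_decreasing) auto
    finally show ?thesis .
  qed
  have "\<bar>\<Sum>j<N. fl j * x j\<bar> \<le> (\<Sum>j<N. \<bar>fl j\<bar> * (C * q ^ n))"
    by (rule order_trans[OF sum_abs sum_mono]) (use x in \<open>auto simp: abs_mult intro: mult_left_mono\<close>)
  also have "\<dots> \<le> (\<Sum>j<2 ^ n. \<bar>fl j\<bar> * (C * q ^ n))"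
    using N C q by (intro sum_mono2) auto
  also have "\<dots> = C * (q ^ n * (\<Sum>j<2 ^ n. \<bar>fl j\<bar>))" by (simp add: sum_distrib_left mult_ac)
  finally have X: "\<bar>\<Sum>j<N. fl j * x j\<bar> \<le> C * (q ^ n * (\<Sum>j<2 ^ n. \<bar>fl j\<bar>))" .
  have split: "(\<Sum>j<N. fl j * (Y (dyadic T (Suc n) (Suc (Suc (2 * j)))) \<omega> - Y (dyadic T (Suc n) (Suc (2 * j))) \<omega>))
      = flip_sum n N a \<omega> + (\<Sum>j<N. fl j * x j)"
    unfolding flip_sum_def sum.distrib[symmetric] fl_def
    by (intro sum.cong refl) (simp add: Y_def x_def algebra_simps)
  define e where "e = \<bar>Y (dyadic T (Suc n) (steps T t (Suc n))) \<omega> - Y (dyadic T n N) \<omega>\<bar>"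
  define G where "G = q ^ n * (\<Sum>j<2 ^ n. \<bar>fl j\<bar>)"
  have G: "0 \<le> G" using q by (simp add: G_def sum_nonneg)
  have "\<bar>disc_lt T (path \<omega>) t (Suc n) a - disc_lt T (path \<omega>) t n a\<bar> \<le> 2 * e + 2 * \<bar>flip_sum n N a \<omega> + (\<Sum>j<N. fl j * x j)\<bar>"
    using disc_lt_diff[OF T, of t "path \<omega>" n a] t
    unfolding split[symmetric] unfolding fl_def N_def e_def by simp
  also have "\<dots> \<le> 2 * e + 2 * \<bar>flip_sum n N a \<omega>\<bar> + 2 * (C * G)"
    using X abs_triangle_ineq[of "flip_sum n N a \<omega>" "\<Sum>j<N. fl j * x j"] unfolding G_def[symmetric] by argo
  also have "\<dots> \<le> 2 * (1 + C) * (e + \<bar>flip_sum n N a \<omega>\<bar> + G)"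
  proof -
    have "0 \<le> C * (e + \<bar>flip_sum n N a \<omega>\<bar>)" using C by (simp add: e_def)
    then show ?thesis using G by (simp add: algebra_simps)
  qed
  finally show ?thesis by (simp add: lt_step_def e_def G_def N_def q_def fl_def)
qed

lemma flip_measurable_pair:
  assumes [measurable]: "f \<in> borel_measurable N" "g \<in> measurable N P" and j: "j < 2 ^ n"
  shows "(\<lambda>x. flip T (path (g x)) n (f x) j) \<in> borel_measurable N"
proof -
  note [measurable] = measurable_compose[OF assms(2) meas(3)[OF dyadic_in[of j n]]]
    measurable_compose[OF assms(2) meas(3)[OF dyadic_in[of "Suc (2 * j)" "Suc n"]]]
  show ?thesis using j unfolding flip_def by simp
qed

lemma lt_step_measurable:
  assumes t: "t \<in> {0..T}" and f: "f \<in> borel_measurable N" and g: "g \<in> measurable N P"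
  shows "(\<lambda>x. lt_step t n (f x) (g x)) \<in> borel_measurable N"
proof -
  have 1: "(\<lambda>x. Y s (g x)) \<in> borel_measurable N" "(\<lambda>x. M s (g x)) \<in> borel_measurable N" if "s \<in> {0..T}" for s
    using measurable_compose[OF g meas(3)[OF that]] measurable_compose[OF g meas(1)[OF that]] by auto
  have N: "steps T t n \<le> 2 ^ n" "steps T t (Suc n) \<le> 2 ^ Suc n"
    using steps_le[of T t n] steps_le[of T t "Suc n"] T t by auto
  have 2: "(\<lambda>x. flip_sum n (steps T t n) (f x) (g x)) \<in> borel_measurable N"
    unfolding flip_sum_def
    using N by (intro borel_measurable_sum borel_measurable_times borel_measurable_diff flip_measurable_pair f g 1 dyadic_in) auto
  show ?thesis
    unfolding lt_step_def
    using N by (intro borel_measurable_add borel_measurable_abs borel_measurable_diff 1 dyadic_in 2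
        borel_measurable_times borel_measurable_const borel_measurable_sum flip_measurable_pair f g) auto
qed

text \<open>The constants have to satisfy \<open>r > 2 powr -(1/2)\<close> for the flip estimate and \<open>2 powr (1 - \<alpha>) * r < 1\<close> for
  the last term; both are possible as \<open>\<alpha> > 1/2\<close>. With \<open>\<rho> = r powr (1/4)\<close>, the choices \<open>\<mu> = \<rho>\<^sup>n\<close> and
  \<open>\<theta> = \<rho> powr (- 2 n)\<close> balance the other estimates: both summands of the second moment of the
  flip sum become at most of order \<open>n \<rho> powr (2 n)\<close>.\<close>

lemma lt_step_expectation:
  obtains b where "summable b" "\<And>n. 0 \<le> b n"
    "\<And>t n a. t \<in> {0..T} \<Longrightarrow> (\<integral>\<^sup>+\<omega>. ennreal (lt_step t n a \<omega>) \<partial>P) \<le> ennreal (b n)"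
proof -
  have "max (sqrt (1 / 2)) (1 / 2) < min 1 (2 powr (\<alpha> - 1))"
  proof -
    have "sqrt (1 / 2) = 2 powr (- (1 / 2))"
      by (simp add: powr_minus powr_half_sqrt real_sqrt_divide inverse_eq_divide)
    also have "\<dots> < 2 powr (\<alpha> - 1)" using \<alpha> by (intro powr_less_mono) auto
    finally have "sqrt (1 / 2) < 2 powr (\<alpha> - 1)" .
    moreover have "1 / 2 < sqrt (1 / 2 :: real)" by (rule real_less_rsqrt) (simp add: power2_eq_square)
    moreover have "sqrt (1 / 2 :: real) < 1" by simp
    ultimately show ?thesis by auto
  qed
  from dense[OF this] obtain r where r: "sqrt (1 / 2) < r" "1 / 2 < r" "r < 1" "r < 2 powr (\<alpha> - 1)"
    by auto
  have r2: "1 / 2 < r\<^sup>2" "0 < r" using power_strict_mono[OF r(1), of 2] r(2) by auto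
  define \<rho> where "\<rho> = sqrt (sqrt r)"
  have \<rho>: "0 < \<rho>" "\<rho> < 1" using r by (auto simp: \<rho>_def)
  have \<rho>4: "r = \<rho>\<^sup>2 * \<rho>\<^sup>2" using r by (simp add: \<rho>_def)
  have \<rho>2: "1 / 2 \<le> \<rho>\<^sup>2"
    using r(2) real_le_rsqrt[of "1 / 2" r] by (simp add: \<rho>_def power2_eq_square)
  define \<sigma> where "\<sigma> = 2 powr - \<alpha> * (2 * r)"
  have \<sigma>: "0 < \<sigma>" "\<sigma> < 1"
  proof -
    have "\<sigma> < 2 powr - \<alpha> * (2 * 2 powr (\<alpha> - 1))" unfolding \<sigma>_def using r by (intro mult_strict_left_mono) auto
    also have "\<dots> = 1" by (simp add: powr_diff powr_minus)
    finally show "\<sigma> < 1" .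
  qed (use r2 in \<open>simp add: \<sigma>_def\<close>)
  obtain A where A: "0 < A" "\<And>n a. (\<Sum>j<2 ^ n. flip_prob n a j) \<le> A * (real n + 1) * (2 * r) ^ n"
    using expected_flips[OF r2 r(3)] by blast
  obtain B where B: "0 < B" "\<And>n N a \<theta>. 0 < \<theta> \<Longrightarrow> N \<le> 2 ^ n \<Longrightarrow> integrable P (\<lambda>\<omega>. (flip_sum n N a \<omega>)\<^sup>2) \<and>
      expectation (\<lambda>\<omega>. (flip_sum n N a \<omega>)\<^sup>2) \<le> B * (\<theta> * (real n + 1) * r ^ n + 1 / \<theta>)"
    using flip_sum_second_moment[OF r2 r(3)] by blast
  obtain K where K: "0 < K" "\<And>s u. s \<in> {0..T} \<Longrightarrow> u \<in> {0..T} \<Longrightarrow> expectation (\<lambda>\<omega>. (Y u \<omega> - Y s \<omega>)\<^sup>2) \<le> K * \<bar>u - s\<bar>"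
    using increment_var by blast
  define b where "b n = \<rho> ^ n * (1 + K * T) + \<rho> ^ n * (1 + B * (real n + 2)) + A * (real n + 1) * \<sigma> ^ n" for n
  have b0: "0 \<le> b n" for n using \<rho> \<sigma> A B K T by (simp add: b_def)
  have geo: "summable (\<lambda>n. (real n + 1) * x ^ n)" if "0 < x" "x < 1" for x :: real
    using geometric_deriv_sums[of x] that by (auto simp: sums_iff add.commute)
  have sb: "summable b"
  proof -
    have "b = (\<lambda>n. (K * T + 2 + B) * \<rho> ^ n + B * ((real n + 1) * \<rho> ^ n) + A * ((real n + 1) * \<sigma> ^ n))"
      by (rule ext) (simp add: b_def algebra_simps)
    moreover have "summable (\<lambda>n. (K * T + 2 + B) * \<rho> ^ n + B * ((real n + 1) * \<rho> ^ n) + A * ((real n + 1) * \<sigma> ^ n))"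
      using \<rho> \<sigma> by (intro summable_add summable_mult geo summable_geometric) auto
    ultimately show ?thesis by (simp only:)
  qed
  have "(\<integral>\<^sup>+\<omega>. ennreal (lt_step t n a \<omega>) \<partial>P) \<le> ennreal (b n)" if t: "t \<in> {0..T}" for t n a
  proof -
    define s u where "s = dyadic T n (steps T t n)" and "u = dyadic T (Suc n) (steps T t (Suc n))"
    have N: "steps T t n \<le> 2 ^ n" "steps T t (Suc n) \<le> 2 ^ Suc n"
    using steps_le[of T t n] steps_le[of T t "Suc n"] T t by auto
    have su: "s \<in> {0..T}" "u \<in> {0..T}" unfolding s_def u_def using N by (auto simp del: atLeastAtMost_iff intro!: dyadic_in)
    have "T / 2 ^ Suc n \<le> T / 2 ^ n" using T by (simp add: field_simps)
    then have "\<bar>u - s\<bar> \<le> T / 2 ^ n"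
      using dyadic_steps_gt[OF T, of t n] dyadic_steps_gt[OF T, of t "Suc n"] dyadic_steps_le[OF T, of t n]
        dyadic_steps_le[OF T, of t "Suc n"] t unfolding s_def u_def abs_le_iff atLeastAtMost_iff
      by linarith
    then have "K * \<bar>u - s\<bar> \<le> K * (T / 2 ^ n)" using K by (intro mult_left_mono) auto
    then have var: "expectation (\<lambda>\<omega>. (Y u \<omega> - Y s \<omega>)\<^sup>2) \<le> K * T * (1 / 2) ^ n" using K(2)[OF su] by (simp add: power_divide)
    have \<rho>n: "0 < \<rho> ^ n" using \<rho> by simp
    have [measurable]: "Y s \<in> borel_measurable P" "Y u \<in> borel_measurable P" using meas(3) su by auto
    have "(\<lambda>\<omega>. lt_step t n a \<omega>) \<in> borel_measurable P" by (rule lt_step_measurable[OF t]) auto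
    note i1 = expectation_abs_le[of "\<lambda>\<omega>. Y u \<omega> - Y s \<omega>", OF _ integrable_powers(5)[OF su] \<rho>n]
    have "expectation (\<lambda>\<omega>. \<bar>Y u \<omega> - Y s \<omega>\<bar>) \<le> \<rho> ^ n + K * T * (\<rho>\<^sup>2) ^ n / \<rho> ^ n"
    proof -
      have "expectation (\<lambda>\<omega>. (Y u \<omega> - Y s \<omega>)\<^sup>2) \<le> K * T * (\<rho>\<^sup>2) ^ n"
        using var \<rho>2 K T by (meson mult_left_mono mult_nonneg_nonneg less_imp_le order_trans power_mono zero_le_divide_1_iff zero_le_numeral)
      then have "expectation (\<lambda>\<omega>. (Y u \<omega> - Y s \<omega>)\<^sup>2) / \<rho> ^ n \<le> K * T * (\<rho>\<^sup>2) ^ n / \<rho> ^ n"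
        using \<rho>n by (intro divide_right_mono) auto
      then show ?thesis using i1(1) by simp
    qed
    also have "\<dots> = \<rho> ^ n * (1 + K * T)"
      using \<rho>n by (simp add: power_mult[symmetric] power_mult_distrib power2_eq_square algebra_simps)
    finally have e1: "expectation (\<lambda>\<omega>. \<bar>Y u \<omega> - Y s \<omega>\<bar>) \<le> \<rho> ^ n * (1 + K * T)" .
    have ftm: "flip_sum n (steps T t n) a \<in> borel_measurable P"
    proof -
      have "M (dyadic T (Suc n) (Suc (Suc (2 * j)))) \<in> borel_measurable P" "M (dyadic T (Suc n) (Suc (2 * j))) \<in> borel_measurable P"
        "(\<lambda>\<omega>. flip T (path \<omega>) n a j) \<in> borel_measurable P" if "j < steps T t n" for j
        using that N by (auto intro!: meas(1) dyadic_in flip_measurable simp del: atLeastAtMost_iff)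
      then show ?thesis unfolding flip_sum_def[abs_def]
        by (intro borel_measurable_sum borel_measurable_times borel_measurable_diff) auto
    qed
    define \<theta> where "\<theta> = 1 / (\<rho> ^ n)\<^sup>2"
    have \<theta>: "0 < \<theta>" using \<rho> by (simp add: \<theta>_def)
    note i2 = expectation_abs_le[OF ftm B(2)[OF \<theta> N(1), THEN conjunct1] \<rho>n]
    have "expectation (\<lambda>\<omega>. (flip_sum n (steps T t n) a \<omega>)\<^sup>2) \<le> B * (\<theta> * (real n + 1) * r ^ n + 1 / \<theta>)"
      by (rule B(2)[OF \<theta> N(1), THEN conjunct2])
    also have "\<dots> = B * (real n + 2) * (\<rho> ^ n)\<^sup>2"
    proof -
      have "r ^ n = (\<rho> ^ n)\<^sup>2 * (\<rho> ^ n)\<^sup>2"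
        unfolding \<rho>4 power_mult_distrib by (simp add: power_mult[symmetric] mult.commute)
      moreover have "B * (1 / z * (x + 1) * (z * z) + 1 / (1 / z)) = B * (x + 2) * z" if "0 < z" for x z :: real
        using that by (simp add: field_simps)
      ultimately show ?thesis using \<rho>n by (simp only: \<theta>_def zero_less_power)
    qed
    finally have le: "expectation (\<lambda>\<omega>. (flip_sum n (steps T t n) a \<omega>)\<^sup>2) / \<rho> ^ n \<le> B * (real n + 2) * (\<rho> ^ n)\<^sup>2 / \<rho> ^ n"
      using \<rho>n by (intro divide_right_mono) auto
    have e2: "expectation (\<lambda>\<omega>. \<bar>flip_sum n (steps T t n) a \<omega>\<bar>) \<le> \<rho> ^ n * (1 + B * (real n + 2))"
    proof -
      have "B * (real n + 2) * (\<rho> ^ n)\<^sup>2 / \<rho> ^ n = B * (real n + 2) * \<rho> ^ n"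
        using \<rho>n by (simp add: power2_eq_square)
      moreover have "\<rho> ^ n * (1 + B * (real n + 2)) = \<rho> ^ n + B * (real n + 2) * \<rho> ^ n"
        by (simp only: distrib_left distrib_right mult_1_right mult_ac)
      moreover note i2(1)
      ultimately show ?thesis using le by linarith
    qed
    have i3: "integrable P (\<lambda>\<omega>. \<Sum>j<2 ^ n. \<bar>flip T (path \<omega>) n a j\<bar>)"
      by (intro Bochner_Integration.integrable_sum flip_integrable) auto
    have "expectation (\<lambda>\<omega>. (2 powr - \<alpha>) ^ n * (\<Sum>j<2 ^ n. \<bar>flip T (path \<omega>) n a j\<bar>))
        = (2 powr - \<alpha>) ^ n * (\<Sum>j<2 ^ n. flip_prob n a j)"
      by (subst integral_mult_right_zero, subst Bochner_Integration.integral_sum) (auto intro!: flip_integrable)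
    also have "\<dots> \<le> (2 powr - \<alpha>) ^ n * (A * (real n + 1) * (2 * r) ^ n)"
      by (intro mult_left_mono A) auto
    also have "\<dots> = A * (real n + 1) * \<sigma> ^ n" by (simp add: \<sigma>_def power_mult_distrib)
    finally have e3: "expectation (\<lambda>\<omega>. (2 powr - \<alpha>) ^ n * (\<Sum>j<2 ^ n. \<bar>flip T (path \<omega>) n a j\<bar>)) \<le> A * (real n + 1) * \<sigma> ^ n" .
    have int: "integrable P (\<lambda>\<omega>. \<bar>Y u \<omega> - Y s \<omega>\<bar>)" "integrable P (\<lambda>\<omega>. \<bar>flip_sum n (steps T t n) a \<omega>\<bar>)"
      using i1(2) i2(2) by auto
    have "integrable P (lt_step t n a)" "expectation (lt_step t n a) \<le> b n"
      using int i3 e1 e2 e3 unfolding lt_step_def[abs_def] s_def[symmetric] u_def[symmetric] b_def by auto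
    then show ?thesis
      by (subst nn_integral_eq_integral) (auto simp: lt_step_nonneg intro: ennreal_leI)
  qed
  with sb b0 show thesis using that by blast
qed

end

lemma sigma_finite_if_locally_finite:
  fixes \<mu> :: "real measure"
  assumes \<mu>: "sets \<mu> = sets borel" "\<And>a b. emeasure \<mu> {a..<b} < \<infinity>"
  shows "sigma_finite_measure \<mu>"
proof
  have "\<exists>n. a \<in> {- real n..<real n}" for a :: real
  proof -
    obtain n :: nat where "\<bar>a\<bar> < real n" using reals_Archimedean2 by blast
    then show ?thesis by (intro exI[of _ n]) auto
  qed
  then have "(\<Union>n. {- real n..<real n}) = space \<mu>"
    using sets_eq_imp_space_eq[OF \<mu>(1)] by auto
  then show "\<exists>A. countable A \<and> A \<subseteq> sets \<mu> \<and> \<Union> A = space \<mu> \<and> (\<forall>a\<in>A. emeasure \<mu> a \<noteq> \<infinity>)"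
    using \<mu> by (intro exI[of _ "range (\<lambda>n::nat. {- real n..<real n})"]) (auto simp: less_top)
qed

context perturbed_martingale
begin

text \<open>By Tonelli's theorem, as the expected steps are summable uniformly in the level \<open>a\<close>.\<close>

lemma lt_steps_summable:
  fixes \<mu> :: "real measure"
  assumes t: "t \<in> {0..T}" and \<mu>: "sets \<mu> = sets borel" "\<And>a b. emeasure \<mu> {a..<b} < \<infinity>"
  shows "AE \<omega> in P. \<forall>k::nat. (\<integral>\<^sup>+a. indicator {- real k..<real k} a * (\<Sum>n. ennreal (lt_step t n a \<omega>)) \<partial>\<mu>) \<noteq> \<infinity>"
    (is "AE \<omega> in P. \<forall>k. (\<integral>\<^sup>+a. ?f k a \<omega> \<partial>\<mu>) \<noteq> \<infinity>")
proof -
  obtain b where b: "summable b" "\<And>n. 0 \<le> b n"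
    "\<And>t n a. t \<in> {0..T} \<Longrightarrow> (\<integral>\<^sup>+\<omega>. ennreal (lt_step t n a \<omega>) \<partial>P) \<le> ennreal (b n)"
    using lt_step_expectation by blast
  note [measurable_cong] = \<mu>(1)
  interpret \<mu>: sigma_finite_measure \<mu> using \<mu> by (rule sigma_finite_if_locally_finite)
  interpret PS: pair_sigma_finite P \<mu> by unfold_locales
  have step[measurable]: "(\<lambda>x. lt_step t n (f x) (g x)) \<in> borel_measurable N"
    if "f \<in> borel_measurable N" "g \<in> measurable N P" for f g N n
    using lt_step_measurable[OF t that] .
  have "AE \<omega> in P. (\<integral>\<^sup>+a. ?f k a \<omega> \<partial>\<mu>) \<noteq> \<infinity>" for k :: nat
  proof (rule nn_integral_PInf_AE)
    have fm: "(\<lambda>(\<omega>, a). ?f k a \<omega>) \<in> borel_measurable (P \<Otimes>\<^sub>M \<mu>)"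
      by measurable
    then show "(\<lambda>\<omega>. \<integral>\<^sup>+a. ?f k a \<omega> \<partial>\<mu>) \<in> borel_measurable P"
      by measurable
    have "(\<integral>\<^sup>+\<omega>. (\<integral>\<^sup>+a. ?f k a \<omega> \<partial>\<mu>) \<partial>P)
        = (\<integral>\<^sup>+a. (\<integral>\<^sup>+\<omega>. ?f k a \<omega> \<partial>P) \<partial>\<mu>)"
      using PS.Fubini'[OF fm] by simp
    also have "\<dots> \<le> (\<integral>\<^sup>+a. ennreal (suminf b) * indicator {- real k..<real k} a \<partial>\<mu>)"
    proof (rule nn_integral_mono)
      fix a
      have "(\<integral>\<^sup>+\<omega>. (\<Sum>n. ennreal (lt_step t n a \<omega>)) \<partial>P) = (\<Sum>n. \<integral>\<^sup>+\<omega>. ennreal (lt_step t n a \<omega>) \<partial>P)"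
        by (intro nn_integral_suminf) measurable
      also have "\<dots> \<le> (\<Sum>n. ennreal (b n))" using b(3)[OF t] by (intro suminf_le) auto
      also have "\<dots> = ennreal (suminf b)" using b by (intro suminf_ennreal2)
      finally show "(\<integral>\<^sup>+\<omega>. ?f k a \<omega> \<partial>P)
          \<le> ennreal (suminf b) * indicator {- real k..<real k} a"
        by (auto simp: indicator_def)
    qed
    also have "\<dots> = ennreal (suminf b) * emeasure \<mu> {- real k..<real k}"
      using \<mu>(1) by (intro nn_integral_cmult_indicator) auto
    also have "\<dots> < \<infinity>" using \<mu>(2)[of "- real k" "real k"] by (simp add: ennreal_mult_less_top)
    finally show "(\<integral>\<^sup>+\<omega>. (\<integral>\<^sup>+a. ?f k a \<omega> \<partial>\<mu>) \<partial>P) \<noteq> \<infinity>"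
      by simp
  qed
  then show ?thesis by (simp add: AE_all_countable)
qed

text \<open>Where the limit does not exist, \<open>lim\<close> is some fixed real number; by \<open>disc_lt_converges\<close> this
  happens only for negligible \<open>a\<close> and \<open>\<omega>\<close>.\<close>

definition local_time :: "real \<Rightarrow> real \<Rightarrow> 'a \<Rightarrow> real" where
  "local_time t a \<omega> = lim (\<lambda>n. disc_lt T (path \<omega>) t n a)"

lemma path_bounded:
  "AE \<omega> in P. \<exists>b. \<forall>s\<in>{0..T}. \<bar>Y s \<omega>\<bar> \<le> b"
proof -
  have "AE \<omega> in P. continuous_on {0..T} (path \<omega>)" using Y_cont by (simp add: continuous_process_def)
  then show ?thesis
  proof eventually_elim
    case (elim \<omega>)
    have "bounded (path \<omega> ` {0..T})" by (intro compact_imp_bounded compact_continuous_image elim) simp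
    then show ?case by (auto simp: bounded_iff)
  qed
qed

lemma disc_lt_borel [measurable]: "(\<lambda>a. disc_lt T y t n a) \<in> borel_measurable borel"
  unfolding disc_lt_def by measurable

lemma local_time_borel: "(\<lambda>a. local_time t a \<omega>) \<in> borel_measurable borel"
  unfolding local_time_def by (intro borel_measurable_lim_metric disc_lt_borel)

lemma disc_lt_integrable:
  fixes \<mu> :: "real measure"
  assumes t: "t \<in> {0..T}" and \<mu>: "sets \<mu> = sets borel" "\<And>a b. emeasure \<mu> {a..<b} < \<infinity>"
    and b: "\<And>s. s \<in> {0..T} \<Longrightarrow> \<bar>y s\<bar> \<le> b"
  shows "integrable \<mu> (disc_lt T y t n)"
proof (rule integrable_bounded_support[OF \<mu>])
  have d: "dyadic T n j \<in> {0..T}" if "j \<le> steps T t n" for j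
    using dyadic_in[of j n] steps_le[of T t n] T t that by auto
  show "\<bar>disc_lt T y t n a\<bar> \<le> 2 * (\<Sum>j<steps T t n. 2 * b)" for a
  proof -
    have "kink a (y (dyadic T n j)) (y (dyadic T n (Suc j))) \<le> 2 * b" if "j < steps T t n" for j
      using kink_le[of a "y (dyadic T n j)" "y (dyadic T n (Suc j))"] b[OF d[of j]] b[OF d[of "Suc j"]] that by linarith
    then have "(\<Sum>j<steps T t n. kink a (y (dyadic T n j)) (y (dyadic T n (Suc j)))) \<le> (\<Sum>j<steps T t n. 2 * b)"
      by (intro sum_mono) auto
    moreover have "0 \<le> (\<Sum>j<steps T t n. kink a (y (dyadic T n j)) (y (dyadic T n (Suc j))))"
      by (intro sum_nonneg kink_nonneg)
    ultimately show ?thesis unfolding disc_lt_def by linarith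
  qed
  show "disc_lt T y t n a = 0" if "b < \<bar>a\<bar>" for a
    using disc_lt_eq_0[OF T _ _ b that] t by auto
  show "disc_lt T y t n \<in> borel_measurable borel" using disc_lt_borel[of y t n] by simp
qed

text \<open>Outside a bounded window of levels all discrete local times of a bounded path vanish; inside, the
  bound is \<open>\<bar>L\<^sub>0\<bar>\<close> plus the sum of all steps.\<close>

lemma disc_lt_converges:
  fixes \<mu> :: "real measure"
  assumes t: "t \<in> {0..T}" and \<mu>: "sets \<mu> = sets borel" "\<And>a b. emeasure \<mu> {a..<b} < \<infinity>"
  shows "AE \<omega> in P. \<exists>w. integrable \<mu> w \<and> (\<forall>n. AE a in \<mu>. \<bar>disc_lt T (path \<omega>) t n a\<bar> \<le> w a) \<and>
     (AE a in \<mu>. (\<lambda>n. disc_lt T (path \<omega>) t n a) \<longlonglongrightarrow> local_time t a \<omega>)"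
  using lt_steps_summable[OF assms] X_holder_path path_bounded AE_space
proof eventually_elim
  case (elim \<omega>)
  obtain C where C: "0 \<le> C" "\<And>n j. j < 2 ^ n \<Longrightarrow> \<bar>dX n j \<omega>\<bar> \<le> C * (2 powr - \<alpha>) ^ n"
    using elim(2) by blast
  obtain b where b: "\<And>s. s \<in> {0..T} \<Longrightarrow> \<bar>Y s \<omega>\<bar> \<le> b" using elim(3) by blast
  obtain k :: nat where k: "b < real k" using reals_Archimedean2 by blast
  let ?W = "{- real k..<real k}"
  define lev where "lev n a = disc_lt T (path \<omega>) t n a" for n a
  define G where "G a = (\<Sum>n. ennreal (lt_step t n a \<omega>))" for a
  have om: "(\<lambda>x. \<omega>) \<in> measurable borel P" if "\<omega> \<in> space P" using that by simp
  have out: "lev n a = 0" if "a \<notin> ?W" for n a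
    unfolding lev_def using that k t b by (intro disc_lt_eq_0[OF T _ _ b]) auto
  show ?case
  proof -
    have True: "\<omega> \<in> space P" by (rule elim(4))
    have Gm: "G \<in> borel_measurable borel" unfolding G_def[abs_def]
    proof -
      have [measurable]: "(\<lambda>a. lt_step t n a \<omega>) \<in> borel_measurable borel" for n
        using lt_step_measurable[OF t _ om[OF True], of "\<lambda>a. a"] by simp
      show "(\<lambda>a. \<Sum>n. ennreal (lt_step t n a \<omega>)) \<in> borel_measurable borel" by measurable
    qed
    then have hm: "(\<lambda>a. indicator ?W a * G a) \<in> borel_measurable \<mu>"
      using \<mu>(1) by (simp cong: measurable_cong_sets)
    have fin: "(\<integral>\<^sup>+a. indicator ?W a * G a \<partial>\<mu>) \<noteq> \<infinity>"
      using elim(1) unfolding G_def by blast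
    have ae: "AE a in \<mu>. indicator ?W a * G a \<noteq> \<infinity>"
      by (rule nn_integral_PInf_AE[OF hm fin])
    define g where "g a = enn2real (indicator ?W a * G a)" for a
    have g: "integrable \<mu> g"
    proof (rule integrableI_nonneg)
      show "g \<in> borel_measurable \<mu>" unfolding g_def[abs_def] using hm by simp
      have "(\<integral>\<^sup>+a. ennreal (g a) \<partial>\<mu>) \<le> (\<integral>\<^sup>+a. indicator ?W a * G a \<partial>\<mu>)"
      proof (rule nn_integral_mono)
        have "ennreal (enn2real z) \<le> z" for z by (cases z) auto
        then show "ennreal (g a) \<le> indicator ?W a * G a" for a by (simp add: g_def)
      qed
      then show "(\<integral>\<^sup>+a. ennreal (g a) \<partial>\<mu>) < \<infinity>"
        by (rule le_less_trans) (use fin in \<open>simp add: less_top[symmetric]\<close>)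
    qed (simp add: g_def)
    define w where "w a = \<bar>lev 0 a\<bar> + 2 * (1 + C) * g a" for a
    have l0: "integrable \<mu> (lev 0)" unfolding lev_def[abs_def] using disc_lt_integrable[OF t \<mu> b] .
    have iw: "integrable \<mu> w" unfolding w_def using l0 g by simp
    have main: "\<bar>lev n a\<bar> \<le> w a \<and> convergent (\<lambda>n. lev n a)"
      if fa: "indicator ?W a * G a \<noteq> \<infinity>" for n a
    proof (cases "a \<in> ?W")
      case False
      have "0 \<le> w a" using C by (simp add: w_def g_def)
      then show ?thesis using out[OF False] by (simp add: convergent_const)
    next
      case True
      then have Gfin: "G a \<noteq> \<infinity>" using fa by simp
      then have sm: "summable (\<lambda>n. lt_step t n a \<omega>)"
        unfolding G_def by (intro summable_suminf_not_top lt_step_nonneg) auto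
      have Gs: "G a = ennreal (\<Sum>n. lt_step t n a \<omega>)"
        unfolding G_def using sm by (intro suminf_ennreal2 lt_step_nonneg)
      then have ga: "g a = (\<Sum>n. lt_step t n a \<omega>)"
        using True sm by (simp add: g_def suminf_nonneg lt_step_nonneg)
      have st: "\<bar>lev (Suc n) a - lev n a\<bar> \<le> 2 * (1 + C) * lt_step t n a \<omega>" for n
        unfolding lev_def by (rule disc_lt_step[OF t C])
      have tele: "lev n a = lev 0 a + (\<Sum>i<n. lev (Suc i) a - lev i a)" for n
        by (subst sum_lessThan_telescope) simp
      have "\<bar>\<Sum>i<n. lev (Suc i) a - lev i a\<bar> \<le> (\<Sum>i<n. 2 * (1 + C) * lt_step t i a \<omega>)" for n
        by (rule order_trans[OF sum_abs sum_mono]) (rule st)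
      also have "\<dots> n \<le> 2 * (1 + C) * g a" for n
        unfolding ga sum_distrib_left[symmetric] using C sm
        by (intro mult_left_mono sum_le_suminf) (auto simp: lt_step_nonneg)
      finally have bound: "\<bar>lev n a\<bar> \<le> w a" for n unfolding w_def using tele[of n] by (smt (verit))
      have "summable (\<lambda>i. lev (Suc i) a - lev i a)"
        by (rule summable_comparison_test'[where g = "\<lambda>n. 2 * (1 + C) * lt_step t n a \<omega>" and N = 0])
           (use st sm in \<open>auto intro: summable_mult\<close>)
      then have "convergent (\<lambda>n. \<Sum>i<n. lev (Suc i) a - lev i a)" by (simp add: summable_iff_convergent)
      then have "convergent (\<lambda>n. lev 0 a + (\<Sum>i<n. lev (Suc i) a - lev i a))"
        by (intro convergent_add convergent_const)
      moreover have "(\<lambda>n. lev n a) = (\<lambda>n. lev 0 a + (\<Sum>i<n. lev (Suc i) a - lev i a))"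
        by (rule ext) (rule tele)
      ultimately have "convergent (\<lambda>n. lev n a)" by (simp only:)
      with bound show ?thesis by blast
    qed
    have "AE a in \<mu>. \<bar>lev n a\<bar> \<le> w a" for n using ae by eventually_elim (use main in blast)
    moreover have "AE a in \<mu>. (\<lambda>n. lev n a) \<longlonglongrightarrow> local_time t a \<omega>"
      using ae by eventually_elim (use main in \<open>auto simp: local_time_def lev_def convergent_LIMSEQ_iff\<close>)
    ultimately show ?thesis using iw unfolding lev_def by blast
  qed
qed

lemma local_time_integral_limit:
  fixes \<mu> :: "real measure"
  assumes t: "t \<in> {0..T}" and \<mu>: "sets \<mu> = sets borel" "\<And>a b. emeasure \<mu> {a..<b} < \<infinity>"
  shows "AE \<omega> in P. integrable \<mu> (\<lambda>a. local_time t a \<omega>) \<and> (AE a in \<mu>. 0 \<le> local_time t a \<omega>) \<and>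
     (\<forall>g\<in>borel_measurable borel. bounded (range g) \<longrightarrow>
        (\<lambda>n. \<integral>a. g a * disc_lt T (path \<omega>) t n a \<partial>\<mu>) \<longlonglongrightarrow> (\<integral>a. g a * local_time t a \<omega> \<partial>\<mu>))"
  using disc_lt_converges[OF assms]
proof eventually_elim
  case (elim \<omega>)
  then obtain w where w: "integrable \<mu> w" "\<And>n. AE a in \<mu>. \<bar>disc_lt T (path \<omega>) t n a\<bar> \<le> w a"
    "AE a in \<mu>. (\<lambda>n. disc_lt T (path \<omega>) t n a) \<longlonglongrightarrow> local_time t a \<omega>" by blast
  note [measurable_cong] = \<mu>(1)
  note [measurable] = local_time_borel
  have 1: "integrable \<mu> (\<lambda>a. local_time t a \<omega>)"
    by (rule integrable_dominated_convergence[OF _ _ w(1,3)]) (use w(2) in auto)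
  have 2: "AE a in \<mu>. 0 \<le> local_time t a \<omega>"
    using w(3)
  proof eventually_elim
    case (elim a)
    show ?case by (rule LIMSEQ_le_const[OF elim]) (auto simp: disc_lt_def intro!: sum_nonneg kink_nonneg)
  qed
  have 3: "(\<lambda>n. \<integral>a. g a * disc_lt T (path \<omega>) t n a \<partial>\<mu>) \<longlonglongrightarrow> (\<integral>a. g a * local_time t a \<omega> \<partial>\<mu>)"
    if g[measurable]: "g \<in> borel_measurable borel" and "bounded (range g)" for g :: "real \<Rightarrow> real"
  proof -
    obtain B where B: "\<And>a. \<bar>g a\<bar> \<le> B" using \<open>bounded (range g)\<close> by (auto simp: bounded_iff)
    show ?thesis
    proof (rule integral_dominated_convergence[where w = "\<lambda>a. B * w a"])
      show "AE a in \<mu>. (\<lambda>n. g a * disc_lt T (path \<omega>) t n a) \<longlonglongrightarrow> g a * local_time t a \<omega>"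
        using w(3) by eventually_elim (intro tendsto_intros)
      show "AE a in \<mu>. norm (g a * disc_lt T (path \<omega>) t n a) \<le> B * w a" for n
        using w(2)[of n] by eventually_elim (use B in \<open>auto simp: abs_mult intro!: mult_mono order_trans[OF abs_ge_zero]\<close>)
    qed (use w(1) in auto)
  qed
  show ?case using 1 2 3 by blast
qed

end

section \<open>The occupation time formula for a path\<close>

definition disc_qv :: "real \<Rightarrow> (real \<Rightarrow> real) \<Rightarrow> nat \<Rightarrow> real \<Rightarrow> real" where
  "disc_qv T y n s = (\<Sum>j<steps T s n. (y (dyadic T n (Suc j)) - y (dyadic T n j))\<^sup>2)"

lemma steps_mono: "0 < T \<Longrightarrow> 0 \<le> s \<Longrightarrow> s \<le> t \<Longrightarrow> steps T s n \<le> steps T t n"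
  using dyadic_le_iff[of T t n "steps T s n"] dyadic_steps_le[of T s n] by auto

text \<open>Compares an increment of \<open>A\<close> with a Riemann-Stieltjes sum with respect to \<open>B\<close>. It is applied both to
  weighted sums of squared increments and to Stieltjes integrals.\<close>

lemma block_telescope:
  fixes A B c \<sigma> :: "nat \<Rightarrow> real"
  assumes "\<And>i. i < N \<Longrightarrow> \<bar>A (Suc i) - A i - c i * (B (Suc i) - B i)\<bar> \<le> e * (B (Suc i) - B i)"
  shows "\<bar>A N - A 0 - (\<Sum>i<N. c i * (B (Suc i) - B i))\<bar> \<le> e * (B N - B 0)"
proof -
  have "A N - A 0 - (\<Sum>i<N. c i * (B (Suc i) - B i)) = (\<Sum>i<N. A (Suc i) - A i - c i * (B (Suc i) - B i))"
    unfolding sum_subtractf[of "\<lambda>i. A (Suc i) - A i"] by (simp only: sum_lessThan_telescope)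
  also have "\<bar>\<dots>\<bar> \<le> (\<Sum>i<N. e * (B (Suc i) - B i))"
    by (rule order_trans[OF sum_abs sum_mono]) (use assms in auto)
  also have "\<dots> = e * (B N - B 0)"
    unfolding sum_distrib_left[symmetric] by (simp only: sum_lessThan_telescope)
  finally show ?thesis .
qed

text \<open>A path whose squared increments converge at the times that occur when \<open>[0,t]\<close> is cut along
  dyadic points.\<close>

locale qv_path =
  fixes T :: real and y q :: "real \<Rightarrow> real" and t :: real
  assumes T: "0 < T" and t: "0 \<le> t" "t \<le> T"
    and y: "continuous_on {0..T} y" and q: "continuous_on {0..T} q" "mono_on {0..T} q"
    and qv: "\<And>N i. (\<lambda>n. disc_qv T y n (min t (dyadic T N i))) \<longlonglongrightarrow> q (min t (dyadic T N i))"
begin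

abbreviation dy :: "nat \<Rightarrow> nat \<Rightarrow> real" where
  "dy n j \<equiv> y (dyadic T n (Suc j)) - y (dyadic T n j)"

text \<open>Constant extension beyond \<open>[0,T]\<close>, which makes the path continuous and Borel measurable on the whole
  line and agrees with the convention for the Stieltjes measure.\<close>

definition y' :: "real \<Rightarrow> real" where "y' u = y (max 0 (min T u))"

definition \<Phi> :: "real \<Rightarrow> real" where "\<Phi> u = q (max 0 (min T u))"

lemma y'_cont: "continuous_on UNIV y'"
  unfolding y'_def[abs_def] using T by (intro continuous_on_compose2[OF y] continuous_intros) auto

lemma y'_borel [measurable]: "y' \<in> borel_measurable borel"
  by (rule borel_measurable_continuous_onI[OF y'_cont])

lemma \<Phi>_cont: "continuous_on UNIV \<Phi>"
  unfolding \<Phi>_def[abs_def] using T by (intro continuous_on_compose2[OF q(1)] continuous_intros) auto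

lemma \<Phi>_mono: "u \<le> v \<Longrightarrow> \<Phi> u \<le> \<Phi> v"
  unfolding \<Phi>_def using T by (intro mono_onD[OF q(2)]) auto

abbreviation S :: "real measure" where "S \<equiv> stieltjes T q"

lemma S_def': "S = interval_measure \<Phi>"
  by (simp add: stieltjes_def \<Phi>_def[abs_def])

lemma sets_S [measurable_cong, simp]: "sets S = sets borel" by (simp add: stieltjes_def)

lemma space_S [simp]: "space S = UNIV" by (simp add: stieltjes_def)

lemma emeasure_S: "u \<le> v \<Longrightarrow> emeasure S {u..v} = ennreal (\<Phi> v - \<Phi> u)"
  unfolding S_def' by (intro emeasure_interval_measure_Icc \<Phi>_mono \<Phi>_cont)

lemma measure_S: "u \<le> v \<Longrightarrow> measure S {u<..v} = \<Phi> v - \<Phi> u" "u \<le> v \<Longrightarrow> emeasure S {u<..v} = ennreal (\<Phi> v - \<Phi> u)"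
proof -
  have "continuous (at_right a) \<Phi>" for a
    by (rule continuous_at_imp_continuous_at_within)
       (use \<Phi>_cont in \<open>simp add: continuous_on_eq_continuous_at\<close>)
  then show "u \<le> v \<Longrightarrow> measure S {u<..v} = \<Phi> v - \<Phi> u" "u \<le> v \<Longrightarrow> emeasure S {u<..v} = ennreal (\<Phi> v - \<Phi> u)"
    unfolding S_def' by (auto intro!: measure_interval_measure_Ioc emeasure_interval_measure_Ioc \<Phi>_mono)
qed

lemma \<Phi>_eq: "0 \<le> s \<Longrightarrow> s \<le> T \<Longrightarrow> \<Phi> s = q s" by (simp add: \<Phi>_def max_def min_def)

lemma q0: "q 0 = 0"
proof -
  have "(\<lambda>n. disc_qv T y n 0) \<longlonglongrightarrow> q 0" using qv[of 0 0] t by simp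
  then show ?thesis by (simp add: disc_qv_def steps_def LIMSEQ_const_iff)
qed

lemma S_integrable:
  fixes h :: "real \<Rightarrow> real"
  assumes [measurable]: "h \<in> borel_measurable borel" and b: "\<And>u. \<bar>h u\<bar> \<le> B"
  shows "set_integrable S {u..v} h" "set_integrable S {u<..v} h"
proof -
  have "emeasure S {u..v} < \<infinity>" by (cases "u \<le> v") (simp_all add: emeasure_S)
  moreover have "emeasure S {u<..v} < \<infinity>" by (cases "u \<le> v") (simp_all add: measure_S)
  moreover have "set_integrable S E h" if [measurable]: "E \<in> sets borel" and E: "emeasure S E < \<infinity>" for E
    unfolding set_integrable_def
  proof (rule Bochner_Integration.integrable_bound)
    show "integrable S (\<lambda>x. B * indicator E x)"
      using E by (intro integrable_mult_right integrable_real_indicator) auto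
    have "0 \<le> B" using b[of 0] by simp
    then show "AE x in S. norm (indicat_real E x *\<^sub>R h x) \<le> norm (B * indicator E x)"
      using b by (intro AE_I2) (simp add: indicator_def)
  qed measurable
  ultimately show "set_integrable S {u..v} h" "set_integrable S {u<..v} h" by simp_all
qed

text \<open>On a block of a fixed coarse dyadic grid the integrand is almost constant, both for the weighted sums and
  for the Stieltjes integral. For constant integrands the convergence is that of the squared
  increments.\<close>

lemma weighted_qv_limit:
  fixes g :: "real \<Rightarrow> real"
  assumes g: "continuous_on UNIV g" and b: "\<And>x. \<bar>g x\<bar> \<le> B"
  shows "(\<lambda>n. \<Sum>j<steps T t n. g (y (dyadic T n j)) * (dy n j)\<^sup>2)
    \<longlonglongrightarrow> (LINT u:{0..t}|S. g (y' u))" (is "(\<lambda>n. ?w n) \<longlonglongrightarrow> ?I")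
proof (rule LIMSEQ_I)
  fix r :: real assume r: "0 < r"
  define \<phi> where "\<phi> u = g (y' u)" for u
  have \<phi>: "continuous_on UNIV \<phi>" unfolding \<phi>_def[abs_def] by (intro continuous_on_compose2[OF g y'_cont]) auto
  have \<phi>m[measurable]: "\<phi> \<in> borel_measurable borel" by (rule borel_measurable_continuous_onI[OF \<phi>])
  have \<phi>b: "\<bar>\<phi> u\<bar> \<le> B" for u using b by (simp add: \<phi>_def)
  have qt: "0 \<le> q t" using mono_onD[OF q(2), of 0 t] t q0 by simp
  \<comment> \<open>the final error is at most \<open>e (q t + 1) + e + e (q t)\<close>\<close>
  define e where "e = r / (2 * q t + 3)"
  have e: "0 < e" using r qt by (simp add: e_def)
  have uc: "uniformly_continuous_on {0..T} \<phi>"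
    by (intro compact_uniformly_continuous continuous_on_subset[OF \<phi>]) auto
  obtain d where d: "0 < d" "\<And>u v. u \<in> {0..T} \<Longrightarrow> v \<in> {0..T} \<Longrightarrow> \<bar>v - u\<bar> < d \<Longrightarrow> \<bar>\<phi> v - \<phi> u\<bar> < e"
    using uniformly_continuous_onE[OF uc e] unfolding dist_real_def by blast
  have "(\<lambda>N. T / 2 ^ N) \<longlonglongrightarrow> 0" by (intro LIMSEQ_divide_realpow_zero) auto
  then obtain N where N: "T / 2 ^ N < d"
    using order_tendstoD(2)[of _ 0 sequentially d] d(1) by (auto simp: eventually_sequentially)
  define s where "s i = min t (dyadic T N i)" for i
  have s: "0 \<le> s i" "s i \<le> T" "s i \<le> s (Suc i)" "s (Suc i) - s i \<le> T / 2 ^ N" for i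
    using t dyadic_nonneg[OF T, of N i] dyadic_mono[OF T, of i "Suc i" N] dyadic_diff[of T N i] T
    by (auto simp: s_def min_def)
  have s0: "s 0 = 0" "s (2 ^ N) = t" using t by (auto simp: s_def dyadic_def)
  define A where "A n u = (\<Sum>j<steps T u n. \<phi> (dyadic T n j) * (dy n j)\<^sup>2)" for n u
  define I where "I u = (LINT v:{0..u}|S. \<phi> v)" for u
  have I0: "I 0 = 0"
  proof -
    have "emeasure S {0..0} = 0" using emeasure_S[of 0 0] by simp
    then have "{0} \<in> null_sets S" by (auto simp: null_sets_def)
    then show ?thesis unfolding I_def set_lebesgue_integral_def
      by (intro integral_eq_zero_AE AE_I'[of "{0}"]) (auto simp: indicator_def)
  qed
  have bI: "\<bar>I t - 0 - (\<Sum>i<2 ^ N. \<phi> (s i) * (q (s (Suc i)) - q (s i)))\<bar> \<le> e * (q t - 0)"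
  proof -
    have "\<bar>I (s (Suc i)) - I (s i) - \<phi> (s i) * (q (s (Suc i)) - q (s i))\<bar> \<le> e * (q (s (Suc i)) - q (s i))" for i
    proof -
      define u v where "u = s i" and "v = s (Suc i)"
      have uv: "0 \<le> u" "u \<le> v" "v \<le> T" "v - u \<le> T / 2 ^ N" using s[of i] s[of "Suc i"] by (auto simp: u_def v_def)
      have mS: "measure S {u<..v} = q v - q u" using measure_S(1)[of u v] uv by (simp add: \<Phi>_eq)
      have c: "(LINT w:{u<..v}|S. c) = c * (q v - q u)" for c
        unfolding set_lebesgue_integral_def real_scaleR_def integral_mult_left_zero by (simp add: mS)
      have "{0..v} = {0..u} \<union> {u<..v}" using uv by auto
      then have "I v = I u + (LINT w:{u<..v}|S. \<phi> w)"
        unfolding I_def by (simp only:) (intro set_integral_Un S_integrable[OF \<phi>m \<phi>b], auto)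
      moreover have "(LINT w:{u<..v}|S. \<phi> w - \<phi> u) = (LINT w:{u<..v}|S. \<phi> w) - (LINT w:{u<..v}|S. \<phi> u)"
        by (intro set_integral_diff S_integrable[OF _ \<phi>b] S_integrable[of "\<lambda>_. \<phi> u" "\<bar>\<phi> u\<bar>"]) auto
      moreover have "\<bar>LINT w:{u<..v}|S. \<phi> w - \<phi> u\<bar> \<le> e * (q v - q u)"
      proof -
        have "\<bar>LINT w:{u<..v}|S. \<phi> w - \<phi> u\<bar> \<le> (LINT w:{u<..v}|S. e)"
          unfolding set_lebesgue_integral_def
        proof (rule order_trans[OF integral_abs_bound integral_mono])
          have "\<bar>\<phi> w - \<phi> u\<bar> \<le> 2 * B" for w using \<phi>b[of w] \<phi>b[of u] by linarith
          then show "integrable S (\<lambda>w. \<bar>indicat_real {u<..v} w *\<^sub>R (\<phi> w - \<phi> u)\<bar>)"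
            using S_integrable(2)[of "\<lambda>w. \<phi> w - \<phi> u" "2 * B" u v]
            by (intro Bochner_Integration.integrable_abs) (simp add: set_integrable_def)
          show "integrable S (\<lambda>w. indicat_real {u<..v} w *\<^sub>R e)"
            using S_integrable(2)[of "\<lambda>_. e" "\<bar>e\<bar>" u v] by (simp add: set_integrable_def)
          show "\<bar>indicat_real {u<..v} w *\<^sub>R (\<phi> w - \<phi> u)\<bar> \<le> indicat_real {u<..v} w *\<^sub>R e" for w
            using d(2)[of u w] uv N by (auto simp: indicator_def)
        qed
        also have "\<dots> = e * (q v - q u)" by (rule c)
        finally show ?thesis .
      qed
      ultimately show ?thesis using c[of "\<phi> u"] by (simp add: u_def v_def)
    qed
    then show ?thesis
      using block_telescope[of "2 ^ N" "\<lambda>i. I (s i)" "\<lambda>i. \<phi> (s i)" "\<lambda>i. q (s i)" e] by (simp add: s0 I0 q0)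
  qed
  have bA: "\<bar>A n t - 0 - (\<Sum>i<2 ^ N. \<phi> (s i) * (disc_qv T y n (s (Suc i)) - disc_qv T y n (s i)))\<bar> \<le> e * (disc_qv T y n t - 0)"
    if n: "N \<le> n" for n
  proof -
    have "\<bar>A n (s (Suc i)) - A n (s i) - \<phi> (s i) * (disc_qv T y n (s (Suc i)) - disc_qv T y n (s i))\<bar>
        \<le> e * (disc_qv T y n (s (Suc i)) - disc_qv T y n (s i))" for i
    proof -
      define u v where "u = s i" and "v = s (Suc i)"
      have uv: "0 \<le> u" "u \<le> v" "v \<le> T" "v - u \<le> T / 2 ^ N" using s[of i] s[of "Suc i"] by (auto simp: u_def v_def)
      have st: "steps T u n \<le> steps T v n" using uv T by (intro steps_mono) auto
      have df: "(\<Sum>j<steps T v n. h j) - (\<Sum>j<steps T u n. h j) = (\<Sum>j\<in>{steps T u n..<steps T v n}. h j)" for h :: "nat \<Rightarrow> real"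
        unfolding lessThan_atLeast0 using st by (rule sum_diff_nat_ivl[OF le0])
      have nN: "T / 2 ^ n \<le> T / 2 ^ N" using n T by (intro divide_left_mono power_increasing) auto
      have close: "\<bar>\<phi> (dyadic T n j) - \<phi> u\<bar> \<le> e" if "j \<in> {steps T u n..<steps T v n}" for j
      proof -
        have "dyadic T n (Suc j) \<le> v" using that uv T by (subst dyadic_le_iff) auto
        moreover have "\<not> dyadic T n (Suc j) \<le> u" using that uv T by (subst dyadic_le_iff) auto
        ultimately have "\<bar>dyadic T n j - u\<bar> < d" "dyadic T n j \<le> T"
          using dyadic_diff[of T n j] nN N uv divide_pos_pos[OF T zero_less_power, of 2 n] by linarith+
        then show ?thesis using d(2)[of u "dyadic T n j"] uv dyadic_nonneg[OF T] by fastforce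
      qed
      have "A n v - A n u - \<phi> u * (disc_qv T y n v - disc_qv T y n u)
          = (\<Sum>j\<in>{steps T u n..<steps T v n}. (\<phi> (dyadic T n j) - \<phi> u) * (dy n j)\<^sup>2)"
        unfolding A_def disc_qv_def df by (simp add: sum_distrib_left sum_subtractf left_diff_distrib)
      also have "\<bar>\<dots>\<bar> \<le> (\<Sum>j\<in>{steps T u n..<steps T v n}. e * (dy n j)\<^sup>2)"
        by (rule order_trans[OF sum_abs sum_mono]) (auto simp: abs_mult intro!: mult_right_mono close)
      also have "\<dots> = e * (disc_qv T y n v - disc_qv T y n u)"
        unfolding disc_qv_def df by (simp add: sum_distrib_left)
      finally show ?thesis by (simp add: u_def v_def)
    qed
    then have "\<bar>A n (s (2 ^ N)) - A n (s 0) - (\<Sum>i<2 ^ N. \<phi> (s i) * (disc_qv T y n (s (Suc i)) - disc_qv T y n (s i)))\<bar>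
        \<le> e * (disc_qv T y n (s (2 ^ N)) - disc_qv T y n (s 0))"
      using block_telescope[of "2 ^ N" "\<lambda>i. A n (s i)" "\<lambda>i. \<phi> (s i)" "\<lambda>i. disc_qv T y n (s i)" e] by simp
    moreover have "A n 0 = 0" "disc_qv T y n 0 = 0" by (simp_all add: A_def disc_qv_def steps_def)
    ultimately show ?thesis by (simp add: s0)
  qed
  have qs: "(\<lambda>n. disc_qv T y n (s i)) \<longlonglongrightarrow> q (s i)" for i using qv[of N i] by (simp add: s_def)
  define D where "D n = (\<Sum>i<2 ^ N. \<phi> (s i) * (disc_qv T y n (s (Suc i)) - disc_qv T y n (s i)))" for n
  define D' where "D' = (\<Sum>i<2 ^ N. \<phi> (s i) * (q (s (Suc i)) - q (s i)))"
  have "D \<longlonglongrightarrow> D'" unfolding D_def[abs_def] D'_def by (intro tendsto_intros qs)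
  then obtain n1 where n1: "\<And>n. n1 \<le> n \<Longrightarrow> \<bar>D n - D'\<bar> < e" using LIMSEQ_D[OF _ e] by (metis real_norm_def)
  have "(\<lambda>n. disc_qv T y n t) \<longlonglongrightarrow> q t" using qs[of "2 ^ N"] by (simp add: s0)
  then obtain n2 where n2: "\<And>n. n2 \<le> n \<Longrightarrow> \<bar>disc_qv T y n t - q t\<bar> < 1"
    using LIMSEQ_D[of _ _ 1] by (metis real_norm_def zero_less_one)
  show "\<exists>n0. \<forall>n\<ge>n0. norm (?w n
      - ?I) < r"
  proof (intro exI allI impI)
    fix n assume n: "max N (max n1 n2) \<le> n"
    have "g (y (dyadic T n j)) = \<phi> (dyadic T n j)" if "j < steps T t n" for j
    proof -
      have "dyadic T n j \<le> t" using that t T by (subst dyadic_le_iff) auto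
      then have "dyadic T n j \<le> T" "0 \<le> dyadic T n j" using t dyadic_nonneg[OF T, of n j] by auto
      then show ?thesis by (simp add: \<phi>_def y'_def)
    qed
    then have "?w n = A n t"
      unfolding A_def by (intro sum.cong) auto
    moreover have "\<bar>A n t - I t\<bar> < r"
    proof -
      have "\<bar>A n t - I t\<bar> \<le> e * disc_qv T y n t + \<bar>D n - D'\<bar> + e * q t"
        using bA[of n] bI n unfolding D_def[symmetric] D'_def[symmetric] by auto
      also have "\<dots> < e * (q t + 1) + e + e * q t"
        using n1[of n] n2[of n] n e by (intro add_strict_right_mono add_le_less_mono mult_left_mono) auto
      also have "\<dots> \<le> e * (2 * q t + 3)" using e by (simp add: algebra_simps)
      also have "\<dots> = r" using qt by (simp add: e_def)
      finally show ?thesis .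
    qed
    ultimately show "norm (?w n
      - ?I) < r"
      by (simp add: I_def \<phi>_def)
  qed
qed

lemma increments_small:
  assumes "0 < e" shows "\<exists>n0. \<forall>n\<ge>n0. \<forall>j<steps T t n. \<bar>dy n j\<bar> \<le> e"
proof -
  have uc: "uniformly_continuous_on {0..T} y"
    by (intro compact_uniformly_continuous y) auto
  obtain d where d: "0 < d" "\<And>u v. u \<in> {0..T} \<Longrightarrow> v \<in> {0..T} \<Longrightarrow> \<bar>v - u\<bar> < d \<Longrightarrow> \<bar>y v - y u\<bar> < e"
    using uniformly_continuous_onE[OF uc assms] unfolding dist_real_def by blast
  have "(\<lambda>N. T / 2 ^ N) \<longlonglongrightarrow> 0" by (intro LIMSEQ_divide_realpow_zero) auto
  then obtain n0 where n0: "\<And>n. n0 \<le> n \<Longrightarrow> T / 2 ^ n < d"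
    using order_tendstoD(2)[of _ 0 sequentially d] d(1) by (auto simp: eventually_sequentially)
  show ?thesis
  proof (intro exI allI impI)
    fix n j assume n: "n0 \<le> n" and j: "j < steps T t n"
    have "dyadic T n (Suc j) \<le> t" using j t T by (subst dyadic_le_iff) auto
    then have "dyadic T n j \<in> {0..T}" "dyadic T n (Suc j) \<in> {0..T}"
      using t dyadic_nonneg[OF T] dyadic_mono[OF T, of j "Suc j" n] by (auto intro: order_trans)
    moreover have "\<bar>dyadic T n (Suc j) - dyadic T n j\<bar> < d" using n0[OF n] T by (simp add: dyadic_diff)
    ultimately show "\<bar>dy n j\<bar> \<le> e" using d(2) by fastforce
  qed
qed

lemma lipschitz_occupation:
  fixes g :: "real \<Rightarrow> real"
  assumes g: "continuous_on UNIV g" and b: "\<And>x. \<bar>g x\<bar> \<le> B"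
    and lip: "\<And>a c. \<bar>g a - g c\<bar> \<le> k * \<bar>a - c\<bar>" and k: "0 \<le> k"
    and l: "(\<lambda>n. \<integral>a. g a * disc_lt T y t n a \<partial>lborel) \<longlonglongrightarrow> J"
  shows "J = (LINT u:{0..t}|S. g (y' u))"
proof -
  have gm: "g \<in> borel_measurable borel" by (rule borel_measurable_continuous_onI[OF g])
  define W where "W n = (\<Sum>j<steps T t n. g (y (dyadic T n j)) * (dy n j)\<^sup>2)" for n
  define Z where "Z n = (\<integral>a. g a * disc_lt T y t n a \<partial>lborel)" for n
  have qt: "(\<lambda>n. disc_qv T y n t) \<longlonglongrightarrow> q t" using qv[of 0 1] t by (simp add: dyadic_def min_def)
  have q0': "0 \<le> disc_qv T y n t" for n by (simp add: disc_qv_def sum_nonneg)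
  note kia = kink_integral_approx[OF gm b lip k]
  have ZW: "\<bar>Z n - W n\<bar> \<le> k * e * disc_qv T y n t"
    if e: "\<And>j. j < steps T t n \<Longrightarrow> \<bar>dy n j\<bar> \<le> e" for n e
  proof -
    have "Z n = (\<integral>a. (\<Sum>j<steps T t n. 2 * (g a * kink a (y (dyadic T n j)) (y (dyadic T n (Suc j))))) \<partial>lborel)"
      unfolding Z_def disc_lt_def by (simp add: sum_distrib_left mult_ac)
    also have "\<dots> = (\<Sum>j<steps T t n. 2 * (\<integral>a. g a * kink a (y (dyadic T n j)) (y (dyadic T n (Suc j))) \<partial>lborel))"
      by (subst Bochner_Integration.integral_sum) (use kia(1) in auto)
    finally have e1: "Z n - W n = (\<Sum>j<steps T t n. 2 * (\<integral>a. g a * kink a (y (dyadic T n j)) (y (dyadic T n (Suc j))) \<partial>lborel)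
        - g (y (dyadic T n j)) * (dy n j)\<^sup>2)"
      by (simp add: W_def sum_subtractf)
    have "\<bar>Z n - W n\<bar> \<le> (\<Sum>j<steps T t n. k * e * (dy n j)\<^sup>2)"
      unfolding e1 by (rule order_trans[OF sum_abs sum_mono], rule order_trans[OF kia(2)])
         (use e k in \<open>auto intro!: mult_right_mono mult_left_mono\<close>)
    then show ?thesis by (simp add: disc_qv_def sum_distrib_left)
  qed
  have "(\<lambda>n. Z n - W n) \<longlonglongrightarrow> 0"
  proof (rule LIMSEQ_I)
    fix r :: real assume r: "0 < r"
    obtain n1 where n1: "\<And>n. n1 \<le> n \<Longrightarrow> \<bar>disc_qv T y n t - q t\<bar> < 1"
      using LIMSEQ_D[OF qt, of 1] by (metis real_norm_def zero_less_one)
    define c where "c = (k + 1) * (\<bar>q t\<bar> + 1)"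
    have c: "0 < c" using k by (simp add: c_def add_nonneg_pos)
    obtain n0 where n0: "\<And>n j. n0 \<le> n \<Longrightarrow> j < steps T t n \<Longrightarrow> \<bar>dy n j\<bar> \<le> r / c / 2"
      using increments_small[of "r / c / 2"] r c by auto
    show "\<exists>no. \<forall>n\<ge>no. norm (Z n - W n - 0) < r"
    proof (intro exI allI impI)
      fix n assume n: "max n0 n1 \<le> n"
      have "\<bar>Z n - W n\<bar> \<le> k * (r / c / 2) * disc_qv T y n t" using n by (intro ZW n0) auto
      also have "\<dots> \<le> (k + 1) * (r / c / 2) * (\<bar>q t\<bar> + 1)"
        using n1[of n] n k r c q0'[of n] by (intro mult_mono) auto
      also have "\<dots> = c * (r / c / 2)"
      proof -
        have "(k + 1) * z * (\<bar>q t\<bar> + 1) = c * z" for z by (simp add: c_def mult_ac)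
        then show ?thesis .
      qed
      also have "\<dots> = r / 2" using c by simp
      also have "\<dots> < r" using r by simp
      finally show "norm (Z n - W n - 0) < r" by simp
    qed
  qed
  moreover have "W \<longlonglongrightarrow> (LINT u:{0..t}|S. g (y' u))"
    unfolding W_def[abs_def] by (rule weighted_qv_limit[OF g b])
  ultimately have "(\<lambda>n. Z n - W n + W n) \<longlonglongrightarrow> 0 + (LINT u:{0..t}|S. g (y' u))"
    by (rule tendsto_add)
  then have "Z \<longlonglongrightarrow> (LINT u:{0..t}|S. g (y' u))" by simp
  with l show ?thesis unfolding Z_def by (rule LIMSEQ_unique)
qed

end

lemma ramp_lipschitz:
  fixes k c :: real
  assumes k: "0 \<le> k"
  shows "\<bar>min 1 (max 0 (k * (a - c))) - min 1 (max 0 (k * (b - c)))\<bar> \<le> k * \<bar>a - b\<bar>"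
proof -
  have "\<bar>k * (a - c) - k * (b - c)\<bar> = k * \<bar>a - b\<bar>"
    using k by (simp add: abs_mult right_diff_distrib[symmetric])
  then show ?thesis by linarith
qed

lemma ramp_tendsto_indicator:
  fixes a c :: real
  shows "(\<lambda>k. min 1 (max 0 (real k * (a - c)))) \<longlonglongrightarrow> indicator {c<..} a"
proof (cases "c < a")
  case True
  obtain k0 :: nat where k0: "1 / (a - c) < real k0" using reals_Archimedean2 by blast
  have "1 \<le> real k * (a - c)" if "k0 \<le> k" for k
  proof -
    have "1 / (a - c) \<le> real k" using k0 that by simp
    then show ?thesis using True by (simp add: pos_divide_le_eq)
  qed
  then have "\<forall>\<^sub>F k in sequentially. min 1 (max 0 (real k * (a - c))) = indicator {c<..} a"
    using True by (intro eventually_sequentiallyI[of k0]) (force simp: indicator_def)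
  then show ?thesis by (rule tendsto_eventually)
next
  case False
  then have "real k * (a - c) \<le> 0" for k by (intro mult_nonneg_nonpos) auto
  with False have "min 1 (max 0 (real k * (a - c))) = indicator {c<..} a" for k
    by (simp add: indicator_def max_absorb1)
  then show ?thesis by simp
qed

text \<open>Both sides are integrals of \<open>g\<close> with respect to finite measures on the line, namely \<open>l(a) da\<close> and the
  occupation measure of the path. They agree on half-lines, whose indicators are limits of
  Lipschitz ramps.\<close>

lemma (in qv_path) occupation_formula:
  fixes l :: "real \<Rightarrow> real"
  assumes l: "integrable lborel l" and l0: "AE a in lborel. 0 \<le> l a"
    and lim: "\<And>g :: real \<Rightarrow> real. g \<in> borel_measurable borel \<Longrightarrow> bounded (range g) \<Longrightarrow>
      (\<lambda>n. \<integral>a. g a * disc_lt T y t n a \<partial>lborel) \<longlonglongrightarrow> (\<integral>a. g a * l a \<partial>lborel)"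
    and g: "g \<in> borel_measurable borel"
  shows "(\<integral>a. g a * l a \<partial>lborel) = (LINT u:{0..t}|S. g (y u))"
proof -
  have lm[measurable]: "l \<in> borel_measurable borel" using l by (simp add: borel_measurable_integrable)
  define N1 where "N1 = density lborel (\<lambda>a. ennreal (l a))"
  define N2 where "N2 = distr (density S (\<lambda>u. ennreal (indicator {0..t} u))) borel y'"
  have half: "(\<integral>a. indicator {c<..} a * l a \<partial>lborel) = (LINT u:{0..t}|S. indicator {c<..} (y' u))" for c
  proof -
    define r where "r k a = min 1 (max 0 (real k * (a - c)))" for k a
    have rm[measurable]: "r k \<in> borel_measurable borel" for k unfolding r_def[abs_def] by measurable
    have rb: "\<bar>r k a\<bar> \<le> 1" for k a by (auto simp: r_def)
    have rlim: "(\<lambda>k. r k a) \<longlonglongrightarrow> indicator {c<..} a" for a unfolding r_def by (rule ramp_tendsto_indicator)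
    have eq: "(\<integral>a. r k a * l a \<partial>lborel) = (LINT u:{0..t}|S. r k (y' u))" for k
    proof (rule lipschitz_occupation[where B = 1 and k = "real k"])
      show "continuous_on UNIV (r k)" unfolding r_def[abs_def] by (intro continuous_intros)
      show "\<bar>r k a - r k b\<bar> \<le> real k * \<bar>a - b\<bar>" for a b unfolding r_def by (rule ramp_lipschitz) simp
      show "(\<lambda>n. \<integral>a. r k a * disc_lt T y t n a \<partial>lborel) \<longlonglongrightarrow> (\<integral>a. r k a * l a \<partial>lborel)"
        by (rule lim) (use rb in \<open>auto simp: bounded_iff\<close>)
    qed (use rb in auto)
    have "(\<lambda>k. \<integral>a. r k a * l a \<partial>lborel) \<longlonglongrightarrow> (\<integral>a. indicator {c<..} a * l a \<partial>lborel)"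
    proof (rule integral_dominated_convergence[where w = "\<lambda>a. \<bar>l a\<bar>"])
      show "AE a in lborel. (\<lambda>k. r k a * l a) \<longlonglongrightarrow> indicator {c<..} a * l a"
        by (intro AE_I2 tendsto_intros rlim)
      have "norm (r k a * l a) \<le> \<bar>l a\<bar>" for k a
        using mult_right_mono[OF rb[of k a], of "\<bar>l a\<bar>"] by (simp add: abs_mult)
      then show "AE a in lborel. norm (r k a * l a) \<le> \<bar>l a\<bar>" for k by simp
    qed (use l in auto)
    moreover have "(\<lambda>k. LINT u:{0..t}|S. r k (y' u)) \<longlonglongrightarrow> (LINT u:{0..t}|S. indicator {c<..} (y' u))"
      unfolding set_lebesgue_integral_def
    proof (rule integral_dominated_convergence[where w = "indicat_real {0..t}"])
      show "AE u in S. (\<lambda>k. indicat_real {0..t} u *\<^sub>R r k (y' u)) \<longlonglongrightarrow> indicat_real {0..t} u *\<^sub>R indicat_real {c<..} (y' u)"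
        by (intro AE_I2 tendsto_intros rlim)
      have "norm (indicat_real {0..t} u *\<^sub>R r k (y' u)) \<le> indicat_real {0..t} u" for k u
        using rb[of k "y' u"] by (simp add: indicator_def)
      then show "AE u in S. norm (indicat_real {0..t} u *\<^sub>R r k (y' u)) \<le> indicat_real {0..t} u" for k by simp
      show "integrable S (indicat_real {0..t})"
        using emeasure_S[OF t(1)] by (intro integrable_real_indicator) auto
    qed auto
    ultimately show ?thesis unfolding eq by (rule LIMSEQ_unique)
  qed
  have e1: "emeasure N1 {c<..} = ennreal (\<integral>a. indicator {c<..} a * l a \<partial>lborel)" for c
  proof -
    have i: "integrable lborel (\<lambda>a. indicator {c<..} a * l a)"
      using integrable_mult_indicator[OF _ l, of "{c<..}"] by simp
    have "emeasure N1 {c<..} = (\<integral>\<^sup>+a. ennreal (l a) * indicator {c<..} a \<partial>lborel)"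
      unfolding N1_def by (rule emeasure_density) auto
    also have "\<dots> = (\<integral>\<^sup>+a. ennreal (indicator {c<..} a * l a) \<partial>lborel)"
      by (intro nn_integral_cong) (simp add: indicator_def)
    also have "\<dots> = ennreal (\<integral>a. indicator {c<..} a * l a \<partial>lborel)"
    proof (rule nn_integral_eq_integral[OF i])
      show "AE a in lborel. 0 \<le> indicat_real {c<..} a * l a" using l0 by eventually_elim simp
    qed
    finally show ?thesis .
  qed
  have e2: "emeasure N2 {c<..} = ennreal (LINT u:{0..t}|S. indicator {c<..} (y' u))" for c
  proof -
    have i: "integrable S (\<lambda>u. indicat_real {0..t} u *\<^sub>R indicat_real {c<..} (y' u))"
      using S_integrable(1)[of "\<lambda>u. indicat_real {c<..} (y' u)" 1 0 t] by (simp add: set_integrable_def indicator_def)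
    have "emeasure N2 {c<..} = emeasure (density S (\<lambda>u. ennreal (indicator {0..t} u))) (y' -` {c<..})"
      unfolding N2_def by (subst emeasure_distr) auto
    also have "\<dots> = (\<integral>\<^sup>+u. ennreal (indicator {0..t} u) * indicator (y' -` {c<..}) u \<partial>S)"
      using measurable_sets[OF y'_borel, of "{c<..}"] by (intro emeasure_density) auto
    also have "\<dots> = (\<integral>\<^sup>+u. ennreal (indicat_real {0..t} u *\<^sub>R indicat_real {c<..} (y' u)) \<partial>S)"
      by (intro nn_integral_cong) (simp add: indicator_def)
    also have "\<dots> = ennreal (\<integral>u. indicat_real {0..t} u *\<^sub>R indicat_real {c<..} (y' u) \<partial>S)"
      by (rule nn_integral_eq_integral[OF i]) simp
    finally show ?thesis by (simp add: set_lebesgue_integral_def)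
  qed
  have N: "N1 = N2"
    by (rule measure_eqI_lessThan) (simp_all add: e1 e2 half, simp_all add: N1_def N2_def)
  have "(\<integral>a. g a * l a \<partial>lborel) = (\<integral>a. g a \<partial>N1)"
    unfolding N1_def using l0 g by (subst integral_density) (auto simp: mult.commute)
  also have "\<dots> = (\<integral>u. g (y' u) \<partial>density S (\<lambda>u. ennreal (indicator {0..t} u)))"
    unfolding N N2_def using g by (subst integral_distr) auto
  also have "\<dots> = (LINT u:{0..t}|S. g (y' u))"
    unfolding set_lebesgue_integral_def using g by (subst integral_density) auto
  also have "\<dots> = (LINT u:{0..t}|S. g (y u))"
    using t by (intro set_lebesgue_integral_cong) (auto simp: y'_def)
  finally show ?thesis .
qed

section \<open>The Ito-Tanaka formula\<close>

context perturbed_martingale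
begin

lemma m_shift_mono: "mono_on {0..T} (\<lambda>s. m s - m 0)"
  by (rule mono_onI) (use m_mono in auto)

lemma m_shift_continuous: "continuous_on {0..T} (\<lambda>s. m s - m 0)"
proof -
  obtain K where K: "0 < K" "\<And>s u. s \<in> {0..T} \<Longrightarrow> u \<in> {0..T} \<Longrightarrow> \<bar>m u - m s\<bar> \<le> K * \<bar>u - s\<bar>"
    using m_lip by blast
  have "K-lipschitz_on {0..T} m"
    by (rule lipschitz_onI) (use K in \<open>auto simp: dist_real_def\<close>)
  then have "continuous_on {0..T} m" by (rule lipschitz_on_continuous_on)
  then show ?thesis by (intro continuous_on_diff continuous_on_const)
qed

lemma qv_path_AE:
  assumes t: "t \<in> {0..T}"
  shows "AE \<omega> in P. qv_path T (path \<omega>) (\<lambda>s. m s - m 0) t"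
proof -
  have times: "min t (dyadic T N i) \<in> {0..T}" for N i
    using t dyadic_nonneg[OF T, of N i] by auto
  have "AE \<omega> in P. \<forall>N i. (\<lambda>n. disc_qv T (path \<omega>) n (min t (dyadic T N i))) \<longlonglongrightarrow> m (min t (dyadic T N i)) - m 0"
    unfolding AE_all_countable disc_qv_def using Y_quadratic_variation[OF times] by blast
  moreover have "AE \<omega> in P. continuous_on {0..T} (path \<omega>)" using Y_cont by (simp add: continuous_process_def)
  ultimately show ?thesis
  proof eventually_elim
    case (elim \<omega>)
    show ?case
    proof
      show "continuous_on {0..T} (\<lambda>s. m s - m 0)" by (rule m_shift_continuous)
      show "mono_on {0..T} (\<lambda>s. m s - m 0)" by (rule m_shift_mono)
    qed (use elim T t in auto)
  qed
qed

lemma dyadic_has_qv: "has_quadratic_variation P T (\<lambda>n. 2 ^ n) (dyadic T) Y (\<lambda>s \<omega>. m s - m 0)"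
  unfolding has_quadratic_variation_def
proof (intro conjI ballI)
  fix t assume t: "t \<in> {0..T}"
  show "AE \<omega> in P. (\<lambda>n. \<Sum>j\<in>{j\<in>{1..2 ^ n}. dyadic T n j \<le> t}. (Y (dyadic T n j) \<omega> - Y (dyadic T n (j - 1)) \<omega>)\<^sup>2)
      \<longlonglongrightarrow> m t - m 0"
    using Y_quadratic_variation[OF t]
    by (subst dyadic_sum[OF T, of t "\<lambda>i j. (Y (dyadic T n j) \<omega> - Y (dyadic T n i) \<omega>)\<^sup>2" for n \<omega>]) (use t in auto)
qed (simp_all add: m_shift_mono m_shift_continuous)

lemma is_local_time_local_time: "is_local_time P T Y (\<lambda>s \<omega>. m s - m 0) local_time"
  unfolding is_local_time_def
proof (intro ballI conjI allI)
  fix t assume t: "t \<in> {0..T}"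
  have d: "dyadic T n j \<in> {0..T}" if "j \<le> steps T t n" for n j
    using dyadic_in[of j n] steps_le[of T t n] T t that by auto
  show "local_time t a \<in> borel_measurable P" for a
    unfolding local_time_def[abs_def] disc_lt_def
    by (intro borel_measurable_lim_metric borel_measurable_times borel_measurable_const borel_measurable_sum
        borel_measurable_kink meas d) auto
  have fin: "emeasure lborel {a..<b} < \<infinity>" for a b :: real
    by (cases "a \<le> b") simp_all
  show "AE \<omega> in P. integrable lborel (\<lambda>a. local_time t a \<omega>) \<and>
      (\<forall>g\<in>borel_measurable borel. bounded (range g) \<longrightarrow>
        (\<integral>a. g a * local_time t a \<omega> \<partial>lborel) = (LINT u:{0..t}|stieltjes T (\<lambda>u. m u - m 0). g (Y u \<omega>)))"
    using local_time_integral_limit[OF t sets_lborel fin] qv_path_AE[OF t]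
  proof eventually_elim
    case (elim \<omega>)
    interpret qv_path T "path \<omega>" "\<lambda>s. m s - m 0" t by (rule elim(2))
    show ?case using elim(1) occupation_formula[of "\<lambda>a. local_time t a \<omega>"] by blast
  qed
qed

text \<open>Summing \<open>lincomb_convex_kink_formula\<close> over the intervals of level \<open>n\<close> expresses the Riemann sum through
  \<open>f(Y)\<close> at the end points and the integrals of the discrete local times, which converge.\<close>

theorem ito_tanaka:
  assumes f: "lincomb_convex f" and t: "t \<in> {0..T}"
  shows "AE \<omega> in P. \<exists>I J.
     has_follmer_integral (\<lambda>n. 2 ^ n) (dyadic T) (\<lambda>u. left_deriv f (Y u \<omega>)) (\<lambda>u. Y u \<omega>) t I \<and>
     has_second_deriv_integral f (\<lambda>a. local_time t a \<omega>) J \<and>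
     f (Y t \<omega>) = f (Y 0 \<omega>) + I + 1 / 2 * J"
proof -
  obtain \<mu> \<nu> where sd: "second_deriv_measure f \<mu> \<nu>" and fc: "continuous_on UNIV f"
    and ki: "\<And>x z. integrable \<mu> (\<lambda>a. kink a x z)" "\<And>x z. integrable \<nu> (\<lambda>a. kink a x z)"
    and kf: "\<And>x z. f z - f x - left_deriv f x * (z - x) = (\<integral>a. kink a x z \<partial>\<mu>) - (\<integral>a. kink a x z \<partial>\<nu>)"
    using lincomb_convex_kink_formula[OF f] by blast
  have sets: "sets \<mu> = sets borel" "sets \<nu> = sets borel"
    and fin: "\<And>a b. emeasure \<mu> {a..<b} < \<infinity>" "\<And>a b. emeasure \<nu> {a..<b} < \<infinity>"
    using sd by (auto simp: second_deriv_measure_def)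
  have "AE \<omega> in P. continuous_on {0..T} (path \<omega>)" using Y_cont by (simp add: continuous_process_def)
  with local_time_integral_limit[OF t sets(1) fin(1)] local_time_integral_limit[OF t sets(2) fin(2)]
  show ?thesis
  proof eventually_elim
    case (elim \<omega>)
    define y where "y n j = Y (dyadic T n j) \<omega>" for n j
    define J where "J = (\<integral>a. local_time t a \<omega> \<partial>\<mu>) - (\<integral>a. local_time t a \<omega> \<partial>\<nu>)"
    define I where "I = f (Y t \<omega>) - f (Y 0 \<omega>) - 1 / 2 * J"
    define N where "N n = steps T t n" for n
    define L where "L \<rho> n = (\<integral>a. disc_lt T (path \<omega>) t n a \<partial>\<rho>)" for \<rho> n
    have one: "(\<lambda>_. 1 :: real) \<in> borel_measurable borel" "bounded (range (\<lambda>_ :: real. 1 :: real))" by auto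
    have lim\<mu>: "(\<lambda>n. L \<mu> n) \<longlonglongrightarrow> (\<integral>a. local_time t a \<omega> \<partial>\<mu>)"
      and lim\<nu>: "(\<lambda>n. L \<nu> n) \<longlonglongrightarrow> (\<integral>a. local_time t a \<omega> \<partial>\<nu>)"
      using elim(1)[THEN conjunct2, THEN conjunct2, THEN bspec, OF one(1)]
        elim(2)[THEN conjunct2, THEN conjunct2, THEN bspec, OF one(1)] one(2) by (simp_all add: L_def)
    have int: "L \<mu> n = 2 * (\<Sum>j<N n. \<integral>a. kink a (y n j) (y n (Suc j)) \<partial>\<mu>)"
      "L \<nu> n = 2 * (\<Sum>j<N n. \<integral>a. kink a (y n j) (y n (Suc j)) \<partial>\<nu>)" for n
      unfolding L_def disc_lt_def y_def N_def integral_mult_right_zero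
      by (simp_all add: Bochner_Integration.integral_sum ki)
    have sum: "(\<Sum>j<N n. left_deriv f (y n j) * (y n (Suc j) - y n j)) = f (y n (N n)) - f (Y 0 \<omega>)
        - 1 / 2 * (L \<mu> n - L \<nu> n)" for n
    proof -
      have "left_deriv f x * (z - x) = (f z - f x) - ((\<integral>a. kink a x z \<partial>\<mu>) - (\<integral>a. kink a x z \<partial>\<nu>))" for x z
        using kf[of z x] by simp
      then have "(\<Sum>j<N n. left_deriv f (y n j) * (y n (Suc j) - y n j)) = (\<Sum>j<N n. f (y n (Suc j)) - f (y n j))
          - ((\<Sum>j<N n. \<integral>a. kink a (y n j) (y n (Suc j)) \<partial>\<mu>) - (\<Sum>j<N n. \<integral>a. kink a (y n j) (y n (Suc j)) \<partial>\<nu>))"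
        by (simp only: sum_subtractf)
      also have "(\<Sum>j<N n. f (y n (Suc j)) - f (y n j)) = f (y n (N n)) - f (Y 0 \<omega>)"
        by (subst sum_lessThan_telescope) (simp add: y_def)
      finally show ?thesis unfolding int by (simp add: right_diff_distrib)
    qed
    have "(\<lambda>n. f (y n (N n))) \<longlonglongrightarrow> f (Y t \<omega>)"
    proof -
      have "dyadic T n (N n) \<in> {0..T}" for n
        using t dyadic_steps_le[OF T, of t n] dyadic_nonneg[OF T, of n "N n"] by (auto simp: N_def)
      then have "(\<lambda>n. y n (N n)) \<longlonglongrightarrow> Y t \<omega>"
        unfolding y_def using elim(3) t dyadic_steps_tendsto[OF T, of t]
        by (intro continuous_on_tendsto_compose[of "{0..T}" "path \<omega>"]) (auto simp: N_def)
      then show ?thesis by (intro continuous_on_tendsto_compose[OF fc]) auto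
    qed
    then have "(\<lambda>n. f (y n (N n)) - f (Y 0 \<omega>)
        - 1 / 2 * (L \<mu> n - L \<nu> n)) \<longlonglongrightarrow> I"
      unfolding I_def J_def by (intro tendsto_intros lim\<mu> lim\<nu>)
    then have "(\<lambda>n. \<Sum>j<N n. left_deriv f (y n j) * (y n (Suc j) - y n j)) \<longlonglongrightarrow> I"
      unfolding sum .
    moreover have "(\<Sum>j\<in>{j\<in>{1..2 ^ n}. dyadic T n j \<le> t}. left_deriv f (Y (dyadic T n (j - 1)) \<omega>) *
        (Y (dyadic T n j) \<omega> - Y (dyadic T n (j - 1)) \<omega>)) = (\<Sum>j<N n. left_deriv f (y n j) * (y n (Suc j) - y n j))" for n
      unfolding y_def N_def
      using dyadic_sum[OF T, of t "\<lambda>i j. left_deriv f (Y (dyadic T n i) \<omega>) * (Y (dyadic T n j) \<omega> - Y (dyadic T n i) \<omega>)" n] t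
      by simp
    ultimately have "has_follmer_integral (\<lambda>n. 2 ^ n) (dyadic T) (\<lambda>u. left_deriv f (Y u \<omega>)) (\<lambda>u. Y u \<omega>) t I"
      by (simp add: has_follmer_integral_def)
    moreover have "has_second_deriv_integral f (\<lambda>a. local_time t a \<omega>) J"
      unfolding has_second_deriv_integral_def using sd elim(1,2) J_def by blast
    ultimately show ?case by (intro exI[of _ I] exI[of _ J]) (simp add: I_def)
  qed
qed

end

theorem theorem3p6:
  fixes P :: "'a measure" and T \<alpha> :: real
    and M X Y :: "real \<Rightarrow> 'a \<Rightarrow> real" and R :: "real \<Rightarrow> real \<Rightarrow> real" and V :: "real \<Rightarrow> real"
    and f :: "real \<Rightarrow> real"
  assumes "prob_space P" and "0 < T"
    and M: "gaussian_process P T M" "centered P T M"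
           "martingale_process P T (natural_filtration P M) M"
           "\<exists>K. K-lipschitz_on {0..T} (\<lambda>t. prob_space.variance P (M t))"
    and X: "gaussian_process P T X" "1/2 < \<alpha>" "holder_process P T \<alpha> X"
    and Y_def: "Y = (\<lambda>t \<omega>. M t \<omega> + X t \<omega>)"
    and Y: "gaussian_process P T Y" "centered P T Y" "continuous_process P T Y"
    and R_def: "R = covar P Y" and V_def: "V = (\<lambda>t. R t t)"
    and a: "\<forall>s\<in>{0<..T}. \<forall>t\<in>{0<..T}. R s t > 0"
    and b: "\<exists>c>0. \<exists>\<delta>>0. \<forall>s\<in>{0..T}. s \<le> \<delta> \<longrightarrow> V s \<ge> c * s\<^sup>2"
    and c: "\<exists>\<delta>>0. (SUP t\<in>{0<..<2*\<delta>} \<inter> {0..T}. SUP s\<in>{t/2..t}. ereal (R s s / R t s)) < \<infinity>"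
    and d: "adapted_process T (natural_filtration P M) Y"
    and f: "lincomb_convex f"
  shows "\<exists>k \<tau> Q L.
     partition_seq T k \<tau> \<and>
     has_quadratic_variation P T k \<tau> Y Q \<and>
     is_local_time P T Y Q L \<and>
     (\<forall>t\<in>{0..T}. AE \<omega> in P. \<exists>I J.
        has_follmer_integral k \<tau> (\<lambda>u. left_deriv f (Y u \<omega>)) (\<lambda>u. Y u \<omega>) t I \<and>
        has_second_deriv_integral f (\<lambda>a. L t a \<omega>) J \<and>
        f (Y t \<omega>) = f (Y 0 \<omega>) + I + 1/2 * J)"
proof -
  interpret prob_space P by fact
  have V: "V s = expectation (\<lambda>\<omega>. (Y s \<omega>)\<^sup>2)" for s
    by (simp add: V_def R_def covar_def power2_eq_square)
  have pos: "\<forall>s\<in>{0<..T}. 0 < expectation (\<lambda>\<omega>. (Y s \<omega>)\<^sup>2)"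
    using a unfolding V[symmetric] V_def by blast
  interpret G: perturbed_martingale P T \<alpha> M X Y
    using assms(2) M X Y_def Y pos b[unfolded V] d by unfold_locales
  show ?thesis
    using partition_seq_dyadic[OF assms(2)] G.dyadic_has_qv G.is_local_time_local_time G.ito_tanaka[OF f] by blast
qed

end
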